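(* Let $G$ be a planar graph with girth $g(G)\geq 10$ and maximum degree $\Delta(G)\geq 4$. Then $\chi^2(G)\leq \Delta(G)+2$.
   Context: All graphs are finite and simple. The girth $g(G)$ is the length of a shortest cycle of $G$. A $2$-distance $k$-coloring of $G$ is a map $V(G)\to\{1,\dots,k\}$ such that any two distinct vertices at distance at most $2$ in $G$ receive different colors; $\chi^2(G)$ is the smallest $k$ for which such a coloring exists. *)

theory Defs
  imports
    "HOL-Analysis.Analysis"
    "HOL-Library.Extended_Nat"
    "Graph_Theory.Pair_Digraph"
    "Graph_Theory.Shortest_Path"
begin

text \<open>
  A finite simple graph is a \<^locale>\<open>pair_graph\<close>: a finite, loop-free, symmetric set of pairs.
  The undirected edge \<open>uv\<close> is represented by the two arcs \<open>(u, v)\<close> and \<open>(v, u)\<close>.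
\<close>

text \<open>
  In a symmetric digraph \<open>[(u, v), (v, u)]\<close> is a cycle of length 2, which is not a
  cycle of the undirected graph; hence the bound on the length. The girth of a forest is
  \<open>\<infinity>\<close> (infimum of the empty set).
\<close>

definition girth :: "'a pair_pre_digraph \<Rightarrow> enat" where
  "girth G = (INF p \<in> {p. pre_digraph.cycle (with_proj G) p \<and> 3 \<le> length p}. enat (length p))"

text \<open>The graph without vertices gets maximum degree 0.\<close>

definition max_degree :: "'a pair_pre_digraph \<Rightarrow> nat" where
  "max_degree G = Max (insert 0 (out_degree (with_proj G) ` pverts G))"

definition graph_dist :: "'a pair_pre_digraph \<Rightarrow> 'a \<Rightarrow> 'a \<Rightarrow> ereal" where
  "graph_dist G u v = wf_digraph.\<mu> (with_proj G) (\<lambda>_. 1) u v"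

definition two_distance_coloring :: "'a pair_pre_digraph \<Rightarrow> nat \<Rightarrow> ('a \<Rightarrow> nat) \<Rightarrow> bool" where
  "two_distance_coloring G k c \<longleftrightarrow>
     c ` pverts G \<subseteq> {1..k} \<and>
     (\<forall>u \<in> pverts G. \<forall>v \<in> pverts G. u \<noteq> v \<and> graph_dist G u v \<le> 2 \<longrightarrow> c u \<noteq> c v)"

definition two_distance_chromatic_number :: "'a pair_pre_digraph \<Rightarrow> nat" where
  "two_distance_chromatic_number G = (LEAST k. \<exists>c. two_distance_coloring G k c)"

text \<open>
  A drawing in the plane: distinct vertices are distinct points, each edge is a simple arc
  joining its ends (the two arcs of one edge are the same curve, traversed in opposite
  directions), an edge meets no vertices other than its ends, and two different edges meet at
  most in vertices.
\<close>

definition plane_drawing ::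
  "'a pair_pre_digraph \<Rightarrow> ('a \<Rightarrow> complex) \<Rightarrow> ('a \<times> 'a \<Rightarrow> real \<Rightarrow> complex) \<Rightarrow> bool" where
  "plane_drawing G pos \<gamma> \<longleftrightarrow>
     inj_on pos (pverts G) \<and>
     (\<forall>(u, v) \<in> parcs G.
        arc (\<gamma> (u, v)) \<and> pathstart (\<gamma> (u, v)) = pos u \<and> pathfinish (\<gamma> (u, v)) = pos v \<and>
        \<gamma> (v, u) = reversepath (\<gamma> (u, v)) \<and>
        path_image (\<gamma> (u, v)) \<inter> pos ` pverts G = {pos u, pos v}) \<and>
     (\<forall>(u, v) \<in> parcs G. \<forall>(x, y) \<in> parcs G. {u, v} \<noteq> {x, y} \<longrightarrow>
        path_image (\<gamma> (u, v)) \<inter> path_image (\<gamma> (x, y)) \<subseteq> pos ` pverts G)"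

definition planar :: "'a pair_pre_digraph \<Rightarrow> bool" where
  "planar G \<longleftrightarrow> (\<exists>pos \<gamma>. plane_drawing G pos \<gamma>)"

end

theory Submission
  imports Defs
begin

text \<open>
  Topology enters only through the bound \<open>4 |E| \<le> 5 (|V| - 1)\<close> for every subgraph. By Janiszewski's
  theorem, an edge on a cycle borders at most two faces, and if there are at least two faces, the
  edges around each of them contain a cycle, hence there are at least ten of them. As deleting an edge
  of a cycle lowers the number of faces, there are at least \<open>|E| - |V| + 2\<close> faces, and double counting
  gives the bound.

  The colouring part takes a minimal induced subgraph that has no colouring with \<open>D + 2\<close> colours
  (\<open>D \<ge> 4\<close> the maximum degree) and contradicts the bound by discharging with charges proportional to
  \<open>2 deg v - 5\<close>. For \<open>D \<ge> 5\<close> every vertex of degree \<open>D\<close> can pay for all vertices of degree 2 next to it.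
  For \<open>D = 4\<close> the critical vertices are those of degree 3 with three neighbours of degree 2; they
  collect the missing charge from vertices at distance 2 and, through these, at distance 3 or 4.
\<close>

section \<open>Cycles in finite edge sets\<close>

text \<open>The edge bound says that every nonempty subgraph has average degree below 5/2, so
  \<open>2 * deg v - 5\<close> has a negative sum, and only vertices of degree 2 are in debt. Say
  that a vertex sees the vertices within distance 2. Greedy colouring works at a vertex that sees at
  most D + 1 coloured ones. The split at D = 4 has two causes. A vertex of degree D can settle the
  whole debt of D neighbours of degree 2 only if \<open>4 * D - 10 >= 2 * D\<close>. And a vertex of
  degree 3 with three neighbours of degree 2 sees six vertices, which is too many for greedy
  colouring when D = 4. In that case sets of available colours are compared: if two of them differ,
  distinct representatives exist; if they agree, recolouring a vertex further away makes them
  differ. For a chain of two vertices of degree 2, two colours are reserved at its far vertex, and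
  the vertex where the chain starts avoids both. In the topological part no boundary walks occur: a
  face borders an edge if the midpoint of the edge is in its closure, and one half of Euler's
  formula suffices.\<close>

fun path_edges :: "'a list \<Rightarrow> 'a set set" where
  "path_edges (x # y # zs) = insert {x, y} (path_edges (y # zs))"
| "path_edges _ = {}"

definition cycle_edges :: "'a list \<Rightarrow> 'a set set" where
  "cycle_edges xs = insert {last xs, hd xs} (path_edges xs)"

definition is_cycle :: "'a set set \<Rightarrow> 'a list \<Rightarrow> bool" where
  "is_cycle F xs \<longleftrightarrow> 3 \<le> length xs \<and> distinct xs \<and> cycle_edges xs \<subseteq> F"

lemma path_edges_Cons: "ys \<noteq> [] \<Longrightarrow> path_edges (x # ys) = insert {x, hd ys} (path_edges ys)"
  by (cases ys) auto

lemma path_edges_append: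
  "us \<noteq> [] \<Longrightarrow> vs \<noteq> [] \<Longrightarrow>
    path_edges (us @ vs) = insert {last us, hd vs} (path_edges us \<union> path_edges vs)"
proof (induction us)
  case (Cons u us)
  then show ?case by (cases "us = []") (auto simp: path_edges_Cons)
qed simp

lemma path_edges_subset: "e \<in> path_edges xs \<Longrightarrow> e \<subseteq> set xs"
  by (induction xs rule: path_edges.induct) auto

lemma finite_path_edges [simp]: "finite (path_edges xs)"
  by (induction xs rule: path_edges.induct) auto

lemma card_path_edges: "distinct xs \<Longrightarrow> card (path_edges xs) = length xs - 1"
proof (induction xs rule: path_edges.induct)
  case (1 x y zs)
  then have "{x, y} \<notin> path_edges (y # zs)"
    using path_edges_subset[of "{x, y}" "y # zs"] by auto
  with 1 show ?case by simp
qed auto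

lemma closing_edge_notin_path:
  assumes "3 \<le> length xs" "distinct xs"
  shows "{last xs, hd xs} \<notin> path_edges xs"
proof -
  obtain x y z zs where xs: "xs = x # y # z # zs"
    using assms(1) by (cases xs; cases "tl xs"; cases "tl (tl xs)") auto
  have "last (z # zs) \<noteq> y" "x \<notin> set (y # z # zs)"
    using assms(2) last_in_set[of "z # zs"] by (auto simp: xs)
  then show ?thesis
    using path_edges_subset[of "{last xs, x}" "y # z # zs"] by (auto simp: xs doubleton_eq_iff)
qed

lemma card_cycle_edges:
  assumes "3 \<le> length xs" "distinct xs"
  shows "card (cycle_edges xs) = length xs"
  using assms card_path_edges[of xs] closing_edge_notin_path[of xs]
  by (simp add: cycle_edges_def)

lemma path_edges_split:
  "e \<in> path_edges xs \<Longrightarrow> \<exists>as bs. xs = as @ bs \<and> as \<noteq> [] \<and> bs \<noteq> [] \<and> e = {last as, hd bs}"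
proof (induction xs rule: path_edges.induct)
  case (1 x y zs)
  show ?case
  proof (cases "e = {x, y}")
    case True
    then show ?thesis by (intro exI[of _ "[x]"] exI[of _ "y # zs"]) auto
  next
    case False
    with 1 obtain as bs where "y # zs = as @ bs" "as \<noteq> []" "bs \<noteq> []" "e = {last as, hd bs}"
      by auto
    then show ?thesis by (intro exI[of _ "x # as"] exI[of _ bs]) auto
  qed
qed auto

lemma cycle_rotate_to_edge:
  assumes "is_cycle F xs" "e \<in> cycle_edges xs"
  obtains ys where "is_cycle F ys" "cycle_edges ys = cycle_edges xs" "e = {last ys, hd ys}"
proof (cases "e \<in> path_edges xs")
  case True
  then obtain as bs where s: "xs = as @ bs" "as \<noteq> []" "bs \<noteq> []" "e = {last as, hd bs}"
    using path_edges_split by blast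
  have eq: "cycle_edges (bs @ as) = cycle_edges xs"
    using s by (auto simp: cycle_edges_def path_edges_append insert_commute)
  show ?thesis
    using assms(1) s eq by (intro that[of "bs @ as"]) (auto simp: is_cycle_def)
next
  case False
  then show ?thesis using assms by (intro that[of xs]) (auto simp: cycle_edges_def)
qed

text \<open>Consider a longest path. A second edge at its first vertex would either prolong it or
  return to it and close a cycle, so the first vertex is a leaf.\<close>

lemma acyclic_leaf:
  assumes fin: "finite F" and ne: "F \<noteq> {}"
    and pairs: "\<And>e. e \<in> F \<Longrightarrow> \<exists>u v. u \<noteq> v \<and> e = {u, v}"
    and acyc: "\<nexists>xs. is_cycle F xs"
  shows "\<exists>v w. v \<noteq> w \<and> {v, w} \<in> F \<and> (\<forall>e \<in> F. v \<in> e \<longrightarrow> e = {v, w})"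
proof (rule ccontr)
  assume no: "\<not> ?thesis"
  define P where "P = {xs. distinct xs \<and> 2 \<le> length xs \<and> path_edges xs \<subseteq> F \<and> set xs \<subseteq> \<Union>F}"
  have "finite (\<Union>F)"
    using fin pairs by fastforce
  then have "finite P"
    by (rule finite_subset[rotated, OF finite_subset_distinct]) (auto simp: P_def)
  moreover obtain e where "e \<in> F"
    using ne by blast
  then obtain u v where "u \<noteq> v" "{u, v} \<in> F"
    using pairs[of e] by auto
  then have "[u, v] \<in> P"
    by (auto simp: P_def)
  ultimately have "Max (length ` P) \<in> length ` P"
    by (intro Max_in) auto
  then obtain xs where xs: "xs \<in> P" "length xs = Max (length ` P)"
    by auto
  have max: "length ys \<le> length xs" if "ys \<in> P" for ys
    using \<open>finite P\<close> that by (auto simp: xs(2))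
  obtain x y zs where s: "xs = x # y # zs"
    using xs(1) by (cases xs; cases "tl xs") (auto simp: P_def)
  have xy: "x \<noteq> y" "{x, y} \<in> F"
    using xs(1) by (auto simp: P_def s)
  then obtain e where e: "e \<in> F" "x \<in> e" "e \<noteq> {x, y}"
    using no by blast
  then obtain z where z: "e = {x, z}" "z \<noteq> x" "z \<noteq> y"
    using pairs[OF e(1)] by (auto simp: insert_commute)
  have "z \<in> set xs"
  proof (rule ccontr)
    assume "z \<notin> set xs"
    then have "z # xs \<in> P"
      using xs(1) e z by (auto simp: P_def s insert_commute)
    then show False using max by force
  qed
  then have "z \<in> set zs"
    using z by (auto simp: s)
  then obtain as bs where ab: "zs = as @ z # bs"
    using split_list[of z zs] by blast
  have "path_edges (x # y # as @ [z]) \<subseteq> path_edges xs"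
    using path_edges_append[of "x # y # as @ [z]" bs] by (cases "bs = []") (auto simp: s ab)
  then have "is_cycle F (x # y # as @ [z])"
    using xs(1) e z by (auto simp: is_cycle_def cycle_edges_def P_def s ab insert_commute)
  then show False using acyc by blast
qed

text \<open>Forests are dismantled leaf by leaf, both for counting their edges and for showing that
  their drawings do not separate the plane.\<close>

lemma acyclic_induct [consumes 2, case_names pairs empty leaf]:
  assumes "finite F" "\<nexists>xs. is_cycle F xs"
    and "\<And>e. e \<in> F \<Longrightarrow> \<exists>u v. u \<noteq> v \<and> e = {u, v}"
    and "P {}"
    and "\<And>v w F'. \<lbrakk>insert {v, w} F' \<subseteq> F; v \<noteq> w; {v, w} \<notin> F'; v \<notin> \<Union>F'; P F'\<rbrakk>
      \<Longrightarrow> P (insert {v, w} F')"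
  shows "P F"
proof -
  have "P F'" if "F' \<subseteq> F" for F'
    using finite_subset[OF that assms(1)] that
  proof (induction F' rule: finite_psubset_induct)
    case (psubset F')
    show ?case
    proof (cases "F' = {}")
      case False
      have "\<nexists>xs. is_cycle F' xs"
        using assms(2) psubset.prems by (auto simp: is_cycle_def)
      moreover have "\<exists>u v. u \<noteq> v \<and> e = {u, v}" if "e \<in> F'" for e
        using assms(3) psubset.prems that by auto
      ultimately obtain v w where vw: "v \<noteq> w" "{v, w} \<in> F'" "\<forall>e \<in> F'. v \<in> e \<longrightarrow> e = {v, w}"
        using acyclic_leaf[OF psubset.hyps False] by metis
      have eq: "insert {v, w} (F' - {{v, w}}) = F'"
        using vw(2) by blast
      have "P (insert {v, w} (F' - {{v, w}}))"
      proof (rule assms(5))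
        show "P (F' - {{v, w}})"
          using vw(2) psubset.prems by (intro psubset.IH) auto
        show "insert {v, w} (F' - {{v, w}}) \<subseteq> F"
          using psubset.prems by (simp only: eq)
        show "v \<notin> \<Union>(F' - {{v, w}})"
          using vw(3) by blast
      qed (use vw(1) in auto)
      then show ?thesis by (simp only: eq)
    qed (simp add: assms(4))
  qed
  from this[of F] show ?thesis by simp
qed

lemma card_acyclic:
  assumes "finite F" "\<nexists>xs. is_cycle F xs"
    and "\<And>e. e \<in> F \<Longrightarrow> \<exists>u v. u \<noteq> v \<and> e = {u, v}"
    and "finite W" "W \<noteq> {}" "\<Union>F \<subseteq> W"
  shows "card F < card W"
proof -
  have "\<forall>W. finite W \<longrightarrow> W \<noteq> {} \<longrightarrow> \<Union>F \<subseteq> W \<longrightarrow> card F < card W"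
    using assms(1,2)
  proof (induction rule: acyclic_induct)
    case (pairs e)
    then show ?case using assms(3) by blast
  next
    case empty
    then show ?case by (simp add: card_gt_0_iff)
  next
    case (leaf v w F')
    have fF: "finite F'"
      using leaf(1) assms(1) by (meson finite_subset insert_subset)
    show ?case
    proof (intro allI impI)
      fix W :: "'a set"
      assume W: "finite W" "\<Union>(insert {v, w} F') \<subseteq> W"
      have "card F' < card (W - {v})"
        using leaf W by (intro leaf(5)[rule_format]) auto
      then show "card (insert {v, w} F') < card W"
        using W leaf(3) fF by (simp add: card_Diff_singleton)
    qed
  qed
  with assms show ?thesis by blast
qed

section \<open>Faces of arc drawings\<close>

locale arc_drawing =
  fixes F0 :: "'a set set" and V :: "'a set" and pos :: "'a \<Rightarrow> complex"
    and ar :: "'a \<Rightarrow> 'a \<Rightarrow> real \<Rightarrow> complex"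
  assumes finite_edges: "finite F0"
    and edge_pair: "e \<in> F0 \<Longrightarrow> \<exists>u v. u \<noteq> v \<and> u \<in> V \<and> v \<in> V \<and> e = {u, v}"
    and inj_pos: "inj_on pos V"
    and arc_edge: "{u, v} \<in> F0 \<Longrightarrow> arc (ar u v)"
    and start_edge: "{u, v} \<in> F0 \<Longrightarrow> pathstart (ar u v) = pos u"
    and finish_edge: "{u, v} \<in> F0 \<Longrightarrow> pathfinish (ar u v) = pos v"
    and reverse_edge: "{u, v} \<in> F0 \<Longrightarrow> ar v u = reversepath (ar u v)"
    and edge_vertices: "{u, v} \<in> F0 \<Longrightarrow> path_image (ar u v) \<inter> pos ` V = {pos u, pos v}"
    and edge_Int: "{u, v} \<in> F0 \<Longrightarrow> {x, y} \<in> F0 \<Longrightarrow> {u, v} \<noteq> {x, y} \<Longrightarrow>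
      path_image (ar u v) \<inter> path_image (ar x y) \<subseteq> pos ` V"
begin

definition curve :: "'a set \<Rightarrow> complex set" where
  "curve e = (\<Union>(u, v) \<in> {(u, v). e = {u, v}}. path_image (ar u v))"

definition skel :: "'a set set \<Rightarrow> complex set" where
  "skel F = \<Union>(curve ` F)"

text \<open>Reversing an edge fixes the parameter 1/2, so the choice of orientation does not matter.
  The condition \<open>mid e \<in> closure f\<close> serves throughout as the definition of
  "\<open>f\<close> borders \<open>e\<close>".\<close>

definition mid :: "'a set \<Rightarrow> complex" where
  "mid e = (SOME z. \<exists>u v. e = {u, v} \<and> z = ar u v (1/2))"

text \<open>The piece of the edge that starts at \<open>u\<close>. For s < 1/2 the stubs at both
  ends make up the edge with a symmetric piece around its midpoint cut out.\<close>

definition stub :: "real \<Rightarrow> 'a \<Rightarrow> 'a \<Rightarrow> complex set" where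
  "stub s u v = ar u v ` {0..s}"

definition faces :: "'a set set \<Rightarrow> complex set set" where
  "faces F = components (- skel F)"

lemma edge_ends: "{u, v} \<in> F0 \<Longrightarrow> u \<noteq> v \<and> u \<in> V \<and> v \<in> V"
  using edge_pair[of "{u, v}"] by (auto simp: doubleton_eq_iff)

lemma curve_edge: assumes "{u, v} \<in> F0" shows "curve {u, v} = path_image (ar u v)"
proof -
  have "path_image (ar v u) = path_image (ar u v)"
    using reverse_edge[OF assms] by simp
  moreover have "{(a, b). {u, v} = {a, b}} = {(u, v), (v, u)}"
    by (auto simp: doubleton_eq_iff)
  ultimately show ?thesis by (simp add: curve_def)
qed

lemma reverse_edge_at: "{u, v} \<in> F0 \<Longrightarrow> ar v u t = ar u v (1 - t)"
  using reverse_edge[of u v] by (simp add: reversepath_def)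

lemma mid_edge: assumes "{u, v} \<in> F0" shows "mid {u, v} = ar u v (1/2)"
proof -
  have *: "z = ar u v (1/2)" if "\<exists>x y. {u, v} = {x, y} \<and> z = ar x y (1/2)" for z
    using that reverse_edge_at[OF assms, of "1/2"] by (auto simp: doubleton_eq_iff)
  show ?thesis
    unfolding mid_def by (rule *, rule someI[of _ "ar u v (1/2)"]) blast
qed

lemma edge_inj:
  "{u, v} \<in> F0 \<Longrightarrow> s \<in> {0..1} \<Longrightarrow> t \<in> {0..1} \<Longrightarrow> ar u v s = ar u v t \<longleftrightarrow> s = t"
  using arc_edge[of u v] by (auto simp: arc_def inj_on_def)

lemma edge_at_ends: "{u, v} \<in> F0 \<Longrightarrow> ar u v 0 = pos u \<and> ar u v 1 = pos v"
  using start_edge finish_edge by (simp add: pathstart_def pathfinish_def)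

lemma curve_Int:
  assumes "e \<in> F0" "e' \<in> F0" "e \<noteq> e'"
  shows "curve e \<inter> curve e' \<subseteq> pos ` (e \<inter> e')"
proof
  fix z assume z: "z \<in> curve e \<inter> curve e'"
  obtain u v x y where e: "e = {u, v}" "u \<in> V" "v \<in> V" "e' = {x, y}" "x \<in> V" "y \<in> V"
    using edge_pair[OF assms(1)] edge_pair[OF assms(2)] by metis
  obtain p where p: "z = pos p" "p \<in> V"
    using edge_Int[of u v x y] z assms e by (auto simp: curve_edge)
  have "p \<in> e" "p \<in> e'"
    using edge_vertices[of u v] edge_vertices[of x y] z p assms e inj_pos
    by (auto simp: curve_edge dest: inj_onD)
  then show "z \<in> pos ` (e \<inter> e')" using p by blast
qed

lemma curve_nonsep: "e \<in> F0 \<Longrightarrow> compact (curve e) \<and> connected (- curve e)"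
  using edge_pair[of e] arc_edge
  by (metis arc_imp_path compact_path_image connected_arc_complement curve_edge
      DIM_complex order_refl)

lemma compact_skel: "F \<subseteq> F0 \<Longrightarrow> compact (skel F)"
  unfolding skel_def using curve_nonsep finite_edges
  by (intro compact_Union) (auto intro: finite_subset)

lemma closed_skel: "F \<subseteq> F0 \<Longrightarrow> closed (skel F)"
  by (simp add: compact_skel compact_imp_closed)

lemma skel_mono: "F \<subseteq> F' \<Longrightarrow> skel F \<subseteq> skel F'"
  by (auto simp: skel_def)

lemma skel_insert: "skel (insert e F) = curve e \<union> skel F"
  by (simp add: skel_def)

lemma skel_empty [simp]: "skel {} = {}"
  by (simp add: skel_def)

lemma mid_in_curve: "e \<in> F0 \<Longrightarrow> mid e \<in> curve e"
  using edge_pair[of e] by (auto simp: curve_edge mid_edge path_image_def)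

lemma mid_notin_skel:
  assumes "e \<in> F0" "F \<subseteq> F0" "e \<notin> F"
  shows "mid e \<notin> skel F"
proof
  assume "mid e \<in> skel F"
  then obtain e' where e': "e' \<in> F" "mid e \<in> curve e'"
    by (auto simp: skel_def)
  obtain u v where e: "e = {u, v}" using edge_pair[OF assms(1)] by blast
  have "mid e \<in> pos ` {u, v}"
    using curve_Int[of e e'] mid_in_curve[OF assms(1)] e' assms e by blast
  then show False
    using edge_at_ends[of u v] edge_inj[of u v "1/2" 0] edge_inj[of u v "1/2" 1] assms(1) e
    by (auto simp: mid_edge)
qed

section \<open>Cycles as Jordan curves\<close>

lemma path_arc:
  assumes "path_edges xs \<subseteq> F0" "distinct xs" "2 \<le> length xs"
  shows "\<exists>g. arc g \<and> pathstart g = pos (hd xs) \<and> pathfinish g = pos (last xs) \<and>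
    path_image g = skel (path_edges xs)"
  using assms
proof (induction xs rule: path_edges.induct)
  case (1 x y zs)
  have xy: "{x, y} \<in> F0" using "1.prems" by simp
  show ?case
  proof (cases "zs = []")
    case True
    then show ?thesis
      using xy arc_edge start_edge finish_edge curve_edge
      by (intro exI[of _ "ar x y"]) (auto simp: skel_insert)
  next
    case False
    have "2 \<le> length (y # zs)" using False by (cases zs) auto
    with 1 obtain g where g: "arc g" "pathstart g = pos y" "pathfinish g = pos (last (y # zs))"
      "path_image g = skel (path_edges (y # zs))" by auto
    have "path_image (ar x y) \<inter> path_image g \<subseteq> {pos y}"
    proof
      fix z assume z: "z \<in> path_image (ar x y) \<inter> path_image g"
      then obtain e where e: "e \<in> path_edges (y # zs)" "z \<in> curve e"
        by (auto simp: g(4) skel_def)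
      have "x \<notin> e" using path_edges_subset[OF e(1)] "1.prems" by auto
      then have "z \<in> pos ` ({x, y} \<inter> e)"
        using curve_Int[of "{x, y}" e] e z xy "1.prems" by (auto simp: curve_edge)
      then show "z \<in> {pos y}" using \<open>x \<notin> e\<close> by auto
    qed
    then have "arc (ar x y +++ g)"
      using g xy arc_edge finish_edge by (intro arc_join) auto
    then show ?thesis
      using g xy start_edge finish_edge False
      by (intro exI[of _ "ar x y +++ g"]) (auto simp: path_image_join skel_insert curve_edge)
  qed
qed auto

text \<open>The cycle is rotated until \<open>e\<close> is its closing edge; the other edges then
  form a path, whose drawing is the single arc \<open>g\<close>.\<close>

lemma cycle_edge:
  assumes "is_cycle F xs" "F \<subseteq> F0" "e \<in> cycle_edges xs"
  obtains u v g where "e = {u, v}" "e \<in> F" "arc g" "pathstart g = pos u" "pathfinish g = pos v"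
    "path_image g \<subseteq> skel (F - {e})" "skel (cycle_edges xs) = curve e \<union> path_image g"
proof -
  obtain ys where ys: "is_cycle F ys" "cycle_edges ys = cycle_edges xs" "e = {last ys, hd ys}"
    using cycle_rotate_to_edge[OF assms(1,3)] .
  have d: "3 \<le> length ys" "distinct ys" "e \<in> F" "path_edges ys \<subseteq> F"
    using ys by (auto simp: is_cycle_def cycle_edges_def)
  have n: "e \<notin> path_edges ys" using closing_edge_notin_path[OF d(1,2)] ys by simp
  obtain g where g: "arc g" "pathstart g = pos (hd ys)" "pathfinish g = pos (last ys)"
    "path_image g = skel (path_edges ys)"
    using path_arc[of ys] d assms(2) by auto
  show ?thesis
  proof (rule that[of "hd ys" "last ys" g])
    show "path_image g \<subseteq> skel (F - {e})"
      unfolding g(4) using d n by (intro skel_mono) auto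
    show "skel (cycle_edges xs) = curve e \<union> path_image g"
      using ys by (metis cycle_edges_def g(4) skel_insert)
  qed (use ys d g in auto)
qed

text \<open>One edge of the cycle and the arc formed by the others meet only at the two ends, so the
  Jordan curve theorem applies; \<open>I\<close> and \<open>J\<close> are the inside and the
  outside.\<close>

lemma cycle_sides:
  assumes "is_cycle F xs" "F \<subseteq> F0"
  obtains I J where "connected I" "connected J" "I \<inter> J = {}" "I \<union> J = - skel (cycle_edges xs)"
    "frontier I = skel (cycle_edges xs)" "frontier J = skel (cycle_edges xs)"
proof -
  have "{last xs, hd xs} \<in> cycle_edges xs" by (simp add: cycle_edges_def)
  from cycle_edge[OF assms this] obtain u v g where *: "{last xs, hd xs} = {u, v}"
    "{last xs, hd xs} \<in> F" "arc g" "pathstart g = pos u" "pathfinish g = pos v"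
    "path_image g \<subseteq> skel (F - {{last xs, hd xs}})"
    "skel (cycle_edges xs) = curve {last xs, hd xs} \<union> path_image g" .
  have uv: "{u, v} \<in> F" "{v, u} \<in> F0" "{u, v} \<in> F0" "path_image g \<subseteq> skel (F - {{u, v}})"
    using * assms by (auto simp: insert_commute)
  define c where "c = g +++ ar v u"
  have C: "path_image c = skel (cycle_edges xs)"
    using * uv finish_edge start_edge unfolding c_def
    by (subst path_image_join) (auto simp: curve_edge[of v u, symmetric] insert_commute)
  have "path_image g \<inter> path_image (ar v u) \<subseteq> pos ` {u, v}"
  proof
    fix z assume z: "z \<in> path_image g \<inter> path_image (ar v u)"
    then obtain e where e: "e \<in> F" "e \<noteq> {u, v}" "z \<in> curve e"
      using uv(4) by (auto simp: skel_def)
    have "z \<in> curve {u, v}" using z uv by (simp add: curve_edge[of v u, symmetric] insert_commute)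
    then show "z \<in> pos ` {u, v}"
      using curve_Int[of e "{u, v}"] e uv assms(2) by blast
  qed
  then have "simple_path c"
    unfolding c_def using * uv arc_edge start_edge finish_edge
    by (intro simple_path_join_loop) auto
  moreover have "pathfinish c = pathstart c"
    using * uv finish_edge by (simp add: c_def)
  ultimately have J: "connected (inside (path_image c))" "connected (outside (path_image c))"
    "inside (path_image c) \<inter> outside (path_image c) = {}"
    "inside (path_image c) \<union> outside (path_image c) = - path_image c"
    "frontier (inside (path_image c)) = path_image c"
    "frontier (outside (path_image c)) = path_image c"
    using Jordan_inside_outside[of c] by auto
  show ?thesis by (rule that[OF J[unfolded C]])
qed

section \<open>The faces next to an edge of a cycle\<close>

lemma stub_eq: "0 \<le> s \<Longrightarrow> s \<le> 1 \<Longrightarrow> stub s u v = path_image (subpath 0 s (ar u v))"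
  by (simp add: stub_def path_image_subpath)

lemma stub_props:
  assumes "{u, v} \<in> F0" "0 < s" "s \<le> 1"
  shows "compact (stub s u v)" "connected (stub s u v)" "connected (- stub s u v)"
    "stub s u v \<subseteq> curve {u, v}" "pos u \<in> stub s u v"
proof -
  have a: "arc (subpath 0 s (ar u v))"
    using arc_edge[OF assms(1)] assms by (intro arc_subpath_arc) auto
  show "compact (stub s u v)" "connected (stub s u v)" "connected (- stub s u v)"
    using a assms connected_arc_complement[OF a]
    by (auto simp: stub_eq compact_arc_image connected_arc_image)
  show "stub s u v \<subseteq> curve {u, v}"
    using assms by (auto simp: stub_def curve_edge path_image_def)
  show "pos u \<in> stub s u v"
    using assms edge_at_ends[OF assms(1)] by (force simp: stub_def)
qed

lemma mid_notin_stub: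
  assumes "{u, v} \<in> F0" "s < 1/2"
  shows "mid {u, v} \<notin> stub s u v"
proof
  assume "mid {u, v} \<in> stub s u v"
  then obtain t where "t \<in> {0..s}" "ar u v (1/2) = ar u v t"
    using mid_edge[OF assms(1)] by (auto simp: stub_def)
  then show False
    using edge_inj[OF assms(1), of "1/2" t] assms(2) by simp
qed

text \<open>Janiszewski's theorem, applied to the cycle and to the rest of the drawing: a small disc
  around the midpoint joins points of \<open>f1\<close> and \<open>f2\<close> off the rest, and the
  side \<open>J\<close> joins them off the cycle, so they can be joined off the union.\<close>

lemma face_unique_on_side:
  assumes cyc: "is_cycle F xs" "F \<subseteq> F0" "e \<in> cycle_edges xs"
    and J: "connected J" "J \<subseteq> - skel (cycle_edges xs)"
    and f: "f1 \<in> faces F" "f2 \<in> faces F" "f1 \<subseteq> J" "f2 \<subseteq> J"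
      "mid e \<in> closure f1" "mid e \<in> closure f2"
  shows "f1 = f2"
proof -
  obtain u v g where e: "e = {u, v}" "e \<in> F" "arc g" "pathstart g = pos u" "pathfinish g = pos v"
    "path_image g \<subseteq> skel (F - {e})" "skel (cycle_edges xs) = curve e \<union> path_image g"
    using cycle_edge[OF cyc] .
  have uv: "{u, v} \<in> F0" "{v, u} \<in> F0" "e \<in> F0"
    using e cyc(2) by (auto simp: insert_commute)
  note st = stub_props[OF uv(1), of "1/4"] stub_props[OF uv(2), of "1/4"]
  define C where "C = skel (cycle_edges xs)"
  \<comment> \<open>\<open>C\<close> and \<open>T\<close> together make up \<open>skel F\<close>,
    and they meet in the arc \<open>g\<close> with the two stubs attached to its ends, a connected
    set. As 1/4 < 1/2, the stubs miss the midpoint.\<close>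
  define T where "T = skel (F - {e}) \<union> (stub (1/4) u v \<union> stub (1/4) v u)"
  have st_sub: "stub (1/4) u v \<union> stub (1/4) v u \<subseteq> curve e"
    using st by (auto simp: e(1) insert_commute)
  have skF: "skel F = curve e \<union> skel (F - {e})"
    using e(2) by (metis insert_Diff skel_insert)
  have "closed T"
    unfolding T_def using st cyc(2)
    by (intro closed_Un closed_skel compact_imp_closed[of "stub _ _ _"]) auto
  have "compact C"
    unfolding C_def using cyc by (intro compact_skel) (auto simp: is_cycle_def)
  have "C \<union> T = skel F"
    using e st_sub skF by (auto simp: C_def T_def)
  have gp: "pos u \<in> path_image g" "pos v \<in> path_image g"
    using e(4,5) by (metis pathstart_in_path_image pathfinish_in_path_image)+
  have "curve e \<inter> skel (F - {e}) \<subseteq> path_image g"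
  proof
    fix z assume "z \<in> curve e \<inter> skel (F - {e})"
    then obtain e' where "e' \<in> F - {e}" "z \<in> curve e'" "z \<in> curve e" by (auto simp: skel_def)
    then have "z \<in> pos ` {u, v}" using curve_Int[of e e'] uv cyc(2) e(1) by blast
    then show "z \<in> path_image g" using gp by auto
  qed
  then have CT: "C \<inter> T = (path_image g \<union> stub (1/4) u v) \<union> stub (1/4) v u"
    using e(6,7) st_sub by (auto simp: C_def T_def)
  have "connected (C \<inter> T)"
    unfolding CT using st gp e(3) by (intro connected_Un connected_arc_image) auto
  have "mid e \<notin> stub (1/4) u v" "mid e \<notin> stub (1/4) v u"
    using mid_notin_stub[OF uv(1), of "1/4"] mid_notin_stub[OF uv(2), of "1/4"] e(1)
    by (simp_all add: insert_commute)
  then have "mid e \<notin> T"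
    using mid_notin_skel[of e "F - {e}"] uv cyc(2) by (auto simp: T_def)
  then obtain d where d: "d > 0" "ball (mid e) d \<subseteq> - T"
    using \<open>closed T\<close> open_contains_ball[of "- T"] by auto
  obtain a where a: "a \<in> f1" "a \<in> ball (mid e) d"
    using f(5) d(1) by (auto simp: closure_approachable dist_commute)
  obtain b where b: "b \<in> f2" "b \<in> ball (mid e) d"
    using f(6) d(1) by (auto simp: closure_approachable dist_commute)
  have "connected_component (- T) a b"
    unfolding connected_component_def using a b d by (intro exI[of _ "ball (mid e) d"]) auto
  moreover have "connected_component (- C) a b"
    unfolding connected_component_def C_def using a b f J by (intro exI[of _ J]) auto
  ultimately have "connected_component (- (C \<union> T)) a b"
    using Janiszewski[OF \<open>compact C\<close> \<open>closed T\<close> \<open>connected (C \<inter> T)\<close>] by blast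
  then obtain t where "connected t" "t \<subseteq> - skel F" "a \<in> t" "b \<in> t"
    using \<open>C \<union> T = skel F\<close> by (auto simp: connected_component_def)
  then show ?thesis
    using f a b joinable_components_eq[of t "- skel F" f1 f2] by (auto simp: faces_def)
qed

text \<open>A face cannot cross the cycle, so it lies on one of the two sides, and each side has at
  most one face that reaches the midpoint.\<close>

lemma edge_on_two_faces:
  assumes "is_cycle F xs" "F \<subseteq> F0" "e \<in> cycle_edges xs"
  shows "finite {f \<in> faces F. mid e \<in> closure f}" "card {f \<in> faces F. mid e \<in> closure f} \<le> 2"
proof -
  obtain I J where IJ: "connected I" "connected J" "I \<inter> J = {}"
    "I \<union> J = - skel (cycle_edges xs)" "frontier I = skel (cycle_edges xs)"
    "frontier J = skel (cycle_edges xs)"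
    using cycle_sides[OF assms(1,2)] .
  have sides: "f \<subseteq> I \<or> f \<subseteq> J" if "f \<in> faces F" for f
  proof (rule ccontr)
    assume no: "\<not> ?thesis"
    have f: "connected f" "f \<subseteq> - skel F"
      using that by (auto simp: faces_def in_components_connected dest: in_components_subset)
    have sk: "skel (cycle_edges xs) \<subseteq> skel F"
      using assms(1) by (intro skel_mono) (auto simp: is_cycle_def)
    have "f \<inter> I \<noteq> {}" "f - I \<noteq> {}"
      using no f sk IJ by blast+
    then have "f \<inter> frontier I \<noteq> {}" using f by (intro connected_Int_frontier)
    then show False using f sk IJ by auto
  qed
  define A where "A = {f \<in> faces F. mid e \<in> closure f}"
  have "inj_on (\<lambda>f. f \<subseteq> I) A"
  proof (rule inj_onI)
    fix f1 f2 assume f: "f1 \<in> A" "f2 \<in> A" "(f1 \<subseteq> I) = (f2 \<subseteq> I)"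
    show "f1 = f2"
    proof (cases "f1 \<subseteq> I")
      case True
      with f IJ show ?thesis by (intro face_unique_on_side[OF assms, of I]) (auto simp: A_def)
    next
      case False
      with f sides IJ show ?thesis
        by (intro face_unique_on_side[OF assms, of J]) (auto simp: A_def)
    qed
  qed
  then have "card A \<le> card (UNIV :: bool set)" "finite A"
    using card_inj_on_le[of "\<lambda>f. f \<subseteq> I" A UNIV] inj_on_finite[of "\<lambda>f. f \<subseteq> I" A UNIV] by simp_all
  then show "finite {f \<in> faces F. mid e \<in> closure f}" "card {f \<in> faces F. mid e \<in> closure f} \<le> 2"
    by (simp_all add: A_def)
qed

text \<open>Sending each face to the component of the larger complement that contains it is onto,
  but not injective: the component of \<open>mid e\<close> swallows a face from each side of the
  cycle.\<close>

lemma faces_remove_edge: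
  assumes "is_cycle F xs" "F \<subseteq> F0" "e \<in> cycle_edges xs" "finite (faces F)"
  shows "card (faces (F - {e})) < card (faces F)"
proof -
  obtain I J where IJ: "connected I" "connected J" "I \<inter> J = {}"
    "I \<union> J = - skel (cycle_edges xs)" "frontier I = skel (cycle_edges xs)"
    "frontier J = skel (cycle_edges xs)"
    using cycle_sides[OF assms(1,2)] .
  have e: "e \<in> F" "e \<in> F0" using assms by (auto simp: is_cycle_def)
  have skF: "skel F = curve e \<union> skel (F - {e})"
    using e(1) by (metis insert_Diff skel_insert)
  have eC: "curve e \<subseteq> skel (cycle_edges xs)" using assms(3) by (auto simp: skel_def)
  define S where "S = - skel (F - {e})"
  have "open S" unfolding S_def using assms(2) by (intro open_Compl closed_skel) auto
  define h where "h f = (SOME W. W \<in> components S \<and> f \<subseteq> W)" for f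
  have h: "h f \<in> components S \<and> f \<subseteq> h f" if "f \<in> faces F" for f
  proof -
    have "connected f" "f \<subseteq> S" "f \<noteq> {}"
      using that skF in_components_subset[of f "- skel F"]
      by (auto simp: faces_def S_def in_components_connected in_components_nonempty)
    then have "\<exists>W. W \<in> components S \<and> f \<subseteq> W" using exists_component_superset[of f S] by auto
    then show ?thesis unfolding h_def by (rule someI_ex)
  qed
  have h_eq: "h f = W" if "f \<in> faces F" "W \<in> components S" "x \<in> f" "x \<in> W" for f W x
    using that h[OF that(1)] components_eq[of "h f" S W] by blast
  have face: "\<exists>f \<in> faces F. x \<in> f" if "x \<notin> skel F" for x
    using that by (intro bexI[of _ "connected_component_set (- skel F) x"])
      (auto simp: faces_def componentsI)
  \<comment> \<open>The cycle is the frontier of both sides, so an open set that meets the cycle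
    contains points of either side. Inside \<open>S\<close> such points avoid all edges, as
    \<open>curve e\<close> is part of the cycle.\<close>
  have hit: "\<exists>f \<in> faces F. h f = W \<and> f \<inter> A \<noteq> {}"
    if W: "W \<in> components S" "W \<inter> U \<inter> skel (cycle_edges xs) \<noteq> {}" "open U"
      "U \<subseteq> S" "A = I \<or> A = J" for W U A
  proof -
    have "open (W \<inter> U)" using \<open>open S\<close> W open_components by blast
    moreover have "skel (cycle_edges xs) \<subseteq> closure A"
      using W(5) IJ(5,6) by (auto simp: frontier_def)
    then obtain z where "z \<in> W \<inter> U" "z \<in> closure A"
      using W(2) by blast
    ultimately obtain x where x: "x \<in> W \<inter> U" "x \<in> A"
      using open_Int_closure_eq_empty[of "W \<inter> U" A] by blast
    then have "x \<notin> skel F"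
      using W IJ eC by (auto simp: S_def skF)
    then show ?thesis using face h_eq[OF _ W(1)] x by blast
  qed
  have surj: "components S \<subseteq> h ` faces F"
  proof
    fix W assume W: "W \<in> components S"
    then obtain x where x: "x \<in> W" "x \<in> S"
      using in_components_nonempty[OF W] in_components_subset[OF W] by blast
    show "W \<in> h ` faces F"
    proof (cases "x \<in> curve e")
      case True
      then show ?thesis using hit[OF W, of S I] x eC \<open>open S\<close> by blast
    next
      case False
      then show ?thesis using face[of x] h_eq[OF _ W] x by (force simp: S_def skF)
    qed
  qed
  have mS: "mid e \<in> S" using mid_notin_skel[of e "F - {e}"] e assms(2) by (auto simp: S_def)
  then obtain W where W: "W \<in> components S" "mid e \<in> W"
    using componentsI[OF mS] by (metis connected_component_refl mem_Collect_eq)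
  have m: "W \<inter> S \<inter> skel (cycle_edges xs) \<noteq> {}"
    using W mS mid_in_curve[OF e(2)] eC by blast
  obtain f1 where f1: "f1 \<in> faces F" "h f1 = W" "f1 \<inter> I \<noteq> {}"
    using hit[OF W(1) m \<open>open S\<close> subset_refl, of I] by blast
  obtain f2 where f2: "f2 \<in> faces F" "h f2 = W" "f2 \<inter> J \<noteq> {}"
    using hit[OF W(1) m \<open>open S\<close> subset_refl, of J] by blast
  have "f1 \<noteq> f2"
  proof
    assume "f1 = f2"
    then have "f1 \<inter> frontier I \<noteq> {}"
      using f1 f2 IJ by (intro connected_Int_frontier) (auto simp: faces_def in_components_connected)
    moreover have "f1 \<subseteq> - skel F" using f1 by (auto simp: faces_def dest: in_components_subset)
    moreover have "skel (cycle_edges xs) \<subseteq> skel F"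
      using assms(1) by (intro skel_mono) (auto simp: is_cycle_def)
    ultimately show False using IJ by auto
  qed
  then have "\<not> inj_on h (faces F)" using f1 f2 by (auto dest: inj_onD)
  then have "card (h ` faces F) < card (faces F)"
    using assms(4) by (meson card_image_le eq_card_imp_inj_on le_neq_implies_less)
  moreover have "card (components S) \<le> card (h ` faces F)"
    using surj assms(4) by (intro card_mono) auto
  ultimately show ?thesis by (simp add: faces_def S_def)
qed


section \<open>Forests do not separate the plane; cycles around a face\<close>

lemma nonsep_Un:
  fixes A B :: "complex set"
  assumes "compact A" "connected (- A)" "compact B" "connected (- B)" "connected (A \<inter> B)"
  shows "connected (- (A \<union> B))"
  using Janiszewski_connected[of A B] assms by (simp add: compact_imp_closed)

text \<open>A leaf edge is an arc that meets the rest in at most one point, so adding it keeps the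
  complement connected by Janiszewski's theorem.\<close>

lemma acyclic_nonsep:
  assumes "F \<subseteq> F0" "\<nexists>xs. is_cycle F xs"
  shows "connected (- skel F)"
proof -
  have fin: "finite F" using assms(1) finite_edges finite_subset by blast
  show ?thesis
    using fin assms(2)
  proof (induction rule: acyclic_induct)
    case (pairs e)
    then show ?case using assms(1) edge_pair by blast
  next
    case empty
    show ?case by (simp add: connected_UNIV)
  next
    case (leaf v w F')
    have F: "{v, w} \<in> F0" "F' \<subseteq> F0" using leaf(1) assms(1) by auto
    have sub: "curve {v, w} \<inter> skel F' \<subseteq> {pos w}"
    proof
      fix z assume "z \<in> curve {v, w} \<inter> skel F'"
      then obtain e where "e \<in> F'" "z \<in> curve e" "z \<in> curve {v, w}" by (auto simp: skel_def)
      then show "z \<in> {pos w}"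
        using curve_Int[of "{v, w}" e] F leaf(3,4) by fastforce
    qed
    then have "connected (curve {v, w} \<inter> skel F')"
      by (metis connected_empty connected_sing subset_singletonD)
    then show ?case
      unfolding skel_insert using F leaf(5) curve_nonsep compact_skel by (intro nonsep_Un) auto
  qed
qed

text \<open>If the edges around a face formed a forest, then their union together with what remains of
  the other edges after cutting out a piece around the midpoint would contain the frontier of the
  face without separating the plane.\<close>

lemma face_has_cycle:
  assumes "F \<subseteq> F0" "f \<in> faces F" "f \<noteq> - skel F"
  shows "\<exists>xs. is_cycle {e \<in> F. mid e \<in> closure f} xs"
proof (rule ccontr)
  assume acyc: "\<not> ?thesis"
  define I where "I = {e \<in> F. mid e \<in> closure f}"
  have I: "I \<subseteq> F0" using assms(1) by (auto simp: I_def)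
  \<comment> \<open>Since \<open>closure f\<close> is closed, missing the midpoint means missing a
    whole middle piece of the edge. The piece is symmetric, so one \<open>s\<close> fits both
    orientations.\<close>
  have cut: "\<exists>s. 0 < s \<and> s < 1/2 \<and> (\<forall>u v t. e = {u, v} \<longrightarrow> s < t \<longrightarrow> t < 1 - s \<longrightarrow> ar u v t \<notin> closure f)"
    if e: "e \<in> F - I" for e
  proof -
    obtain u v where uv: "e = {u, v}" "{u, v} \<in> F0"
      using e assms(1) edge_pair by blast
    have "continuous (at (1/2)) (ar u v)"
      using arc_edge[OF uv(2)]
      by (auto simp: arc_def path_def intro!: continuous_on_interior[of "{0..1}"])
    moreover have "ar u v (1/2) \<in> - closure f"
      using e uv mid_edge[OF uv(2)] by (auto simp: I_def)
    ultimately have "\<forall>\<^sub>F t in at (1/2). ar u v t \<in> - closure f"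
      unfolding continuous_at by (intro topological_tendstoD) auto
    then obtain d where d: "d > 0" "\<And>t. dist t (1/2) < d \<Longrightarrow> ar u v t \<in> - closure f"
      using \<open>ar u v (1/2) \<in> - closure f\<close> unfolding eventually_at by (metis UNIV_I)
    \<comment> \<open>The bound 1/2 - d keeps the middle piece within distance d of 1/2; the 1/4
      ensures that \<open>s\<close> is positive when d is large.\<close>
    define s where "s = max (1/4) (1/2 - d)"
    have s: "0 < s" "s < 1/2" using d(1) by (auto simp: s_def max_def)
    have "ar u v t \<notin> closure f" if "s < t" "t < 1 - s" for t
    proof -
      have "dist t (1/2) < d" using that by (auto simp: s_def dist_real_def)
      then show ?thesis using d(2) by auto
    qed
    moreover have "ar v u t \<notin> closure f" if "s < t" "t < 1 - s" for t
      using calculation[of "1 - t"] that reverse_edge_at[OF uv(2)] by simp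
    ultimately show ?thesis
      using s uv(1) by (intro exI[of _ s]) (auto simp: doubleton_eq_iff)
  qed
  then have "\<forall>e \<in> F - I. \<exists>s. 0 < s \<and> s < 1/2 \<and>
      (\<forall>u v t. e = {u, v} \<longrightarrow> s < t \<longrightarrow> t < 1 - s \<longrightarrow> ar u v t \<notin> closure f)"
    by blast
  from bchoice[OF this] obtain s where "\<forall>e \<in> F - I. 0 < s e \<and> s e < 1/2 \<and>
      (\<forall>u v t. e = {u, v} \<longrightarrow> s e < t \<longrightarrow> t < 1 - s e \<longrightarrow> ar u v t \<notin> closure f)" ..
  then have s: "\<And>e. e \<in> F - I \<Longrightarrow> 0 < s e \<and> s e < 1/2"
    "\<And>e u v t. e \<in> F - I \<Longrightarrow> e = {u, v} \<Longrightarrow> s e < t \<Longrightarrow> t < 1 - s e \<Longrightarrow> ar u v t \<notin> closure f"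
    by blast+
  \<comment> \<open>Ordered pairs, because every edge outside \<open>I\<close> leaves two stubs, one
    at each end.\<close>
  define Q where "Q = {(u, v). {u, v} \<in> F - I}"
  define K where "K Q' = skel I \<union> (\<Union>(u, v) \<in> Q'. stub (s {u, v}) u v)" for Q'
  have "Q \<subseteq> V \<times> V" "Q \<subseteq> \<Union>F0 \<times> \<Union>F0" using assms(1) edge_ends by (auto simp: Q_def)
  moreover have "finite (\<Union>F0)" using finite_edges edge_pair by fastforce
  ultimately have "finite Q" by (meson finite_SigmaI finite_subset)
  have st: "compact (stub (s {u, v}) u v)" "connected (- stub (s {u, v}) u v)"
    "stub (s {u, v}) u v \<subseteq> curve {u, v}" if "(u, v) \<in> Q" for u v
    using stub_props[of u v "s {u, v}"] s(1)[of "{u, v}"] that assms(1) by (auto simp: Q_def)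
  have "compact (K Q') \<and> connected (- K Q')" if "Q' \<subseteq> Q" for Q'
    using finite_subset[OF that \<open>finite Q\<close>] that
  proof (induction Q')
    case empty
    then show ?case
      using acyclic_nonsep[OF I] compact_skel[OF I] acyc by (simp add: K_def I_def)
  next
    case (insert p Q')
    obtain u v where p: "p = (u, v)" by fastforce
    have uv: "{u, v} \<in> F0" "{u, v} \<in> F - I" "(u, v) \<in> Q" "(u, v) \<notin> Q'"
      using insert assms(1) by (auto simp: Q_def p)
    define B where "B = stub (s {u, v}) u v"
    \<comment> \<open>Stubs end before the middle of their edge, so a new stub meets everything
      added earlier at most in its base point.\<close>
    have "B \<inter> K Q' \<subseteq> {pos u}"
    proof
      fix z assume z: "z \<in> B \<inter> K Q'"
      have vert: "z = pos u" if "z = pos x" "x \<in> {u, v}" for x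
      proof (cases "x = v")
        case True
        obtain t where t: "t \<in> {0..s {u, v}}" "z = ar u v t"
          using z by (auto simp: B_def stub_def)
        then have "ar u v t = ar u v 1"
          using True that edge_at_ends[OF uv(1)] by simp
        with t show ?thesis using edge_inj[OF uv(1), of t 1] s(1)[OF uv(2)] by auto
      qed (use that in auto)
      have zc: "z \<in> curve {u, v}" using z st(3)[OF uv(3)] by (auto simp: B_def)
      have other: "z = pos u" if "e \<in> F" "e \<noteq> {u, v}" "z \<in> curve e" for e
        using curve_Int[of "{u, v}" e] that uv(1) assms(1) zc vert by blast
      consider e where "e \<in> I" "z \<in> curve e"
        | x y where "(x, y) \<in> Q'" "z \<in> stub (s {x, y}) x y"
        using z by (auto simp: K_def skel_def)
      then have "z = pos u"
      proof cases
        case 1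
        then show ?thesis using other[of e] uv by (auto simp: I_def)
      next
        case 2
        show ?thesis
        proof (cases "{x, y} = {u, v}")
          case True
          then have "x = v" "y = u" using uv 2 by (auto simp: doubleton_eq_iff)
          then obtain a b where ab: "a \<in> {0..s {u, v}}" "z = ar v u a" "b \<in> {0..s {u, v}}" "z = ar u v b"
            using z 2 by (auto simp: B_def stub_def insert_commute)
          then show ?thesis
            using edge_inj[OF uv(1), of "1 - a" b] s(1)[OF uv(2)] reverse_edge_at[OF uv(1), of a] by auto
        next
          case False
          then show ?thesis
            using other[of "{x, y}"] 2 insert.prems st(3)[of x y] by (auto simp: Q_def p)
        qed
      qed
      then show "z \<in> {pos u}" by simp
    qed
    then have "connected (B \<inter> K Q')"
      by (metis connected_empty connected_sing subset_singletonD)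
    moreover have "K (insert p Q') = B \<union> K Q'"
      by (auto simp: K_def B_def p)
    ultimately show ?case
      using insert st[OF uv(3)] nonsep_Un[of B "K Q'"] by (auto simp: B_def)
  qed
  then have con: "connected (- K Q)" by blast
  have sub: "K Q \<subseteq> skel F"
    using st(3) by (auto simp: K_def skel_def I_def Q_def)
  have "frontier f \<subseteq> K Q"
  proof
    fix z assume z: "z \<in> frontier f"
    then have "z \<in> skel F"
      using frontier_of_components_closed_complement[OF closed_skel[OF assms(1)]] assms(2)
      by (auto simp: faces_def)
    then obtain e where e: "e \<in> F" "z \<in> curve e" by (auto simp: skel_def)
    show "z \<in> K Q"
    proof (cases "e \<in> I")
      case True
      then show ?thesis using e by (auto simp: K_def skel_def)
    next
      case False
      obtain u v where uv: "e = {u, v}" "{u, v} \<in> F0" using e assms(1) edge_pair by blast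
      have Q: "(u, v) \<in> Q" "(v, u) \<in> Q" using False e uv by (auto simp: Q_def insert_commute)
      obtain t where t: "t \<in> {0..1}" "z = ar u v t"
        using e uv by (auto simp: curve_edge path_image_def)
      have "ar u v t \<in> closure f" using z t by (auto simp: frontier_def)
      then have "t \<le> s {u, v} \<or> 1 - s {u, v} \<le> t"
        using s(2)[of e u v t] e False uv by force
      moreover have "ar u v t \<in> stub (s {u, v}) u v" if "t \<le> s {u, v}"
        using t(1) that by (auto simp: stub_def)
      moreover have "ar v u (1 - t) \<in> stub (s {v, u}) v u" if "1 - s {u, v} \<le> t"
        using t(1) that by (auto simp: stub_def insert_commute)
      moreover have "ar v u (1 - t) = ar u v t"
        using reverse_edge_at[OF uv(2), of "1 - t"] by simp
      ultimately have "z \<in> stub (s {u, v}) u v \<or> z \<in> stub (s {v, u}) v u"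
        using t(2) by metis
      then show ?thesis using Q by (auto simp: K_def)
    qed
  qed
  moreover have f: "f \<noteq> {}" "f \<subseteq> - skel F"
    using assms(2) by (auto simp: faces_def in_components_nonempty dest: in_components_subset)
  \<comment> \<open>A connected set that meets \<open>f\<close> but not its frontier lies in
    \<open>f\<close>. As \<open>K Q\<close> is part of the drawing, \<open>f\<close> would then be
    the whole complement.\<close>
  ultimately have "- K Q \<subseteq> f"
    using connected_Int_frontier[OF con, of f] sub by blast
  then show False using f sub assms(3) by auto
qed

section \<open>Counting faces and edges\<close>

text \<open>If there are several faces, each of them borders an edge on a cycle, and each of these
  finitely many edges borders at most two faces.\<close>

lemma finite_faces: assumes "F \<subseteq> F0" shows "finite (faces F)"
proof (cases "- skel F \<in> faces F")
  case True
  then have "faces F = {- skel F}"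
    unfolding faces_def
    by (metis components_eq_sing_iff in_components_connected in_components_nonempty)
  then show ?thesis by simp
next
  case False
  define C where "C = {e \<in> F. \<exists>xs. is_cycle F xs \<and> e \<in> cycle_edges xs}"
  have "finite F" using assms finite_edges finite_subset by blast
  then have "finite C" by (auto simp: C_def)
  have "faces F \<subseteq> (\<Union>e \<in> C. {f \<in> faces F. mid e \<in> closure f})"
  proof
    fix f assume f: "f \<in> faces F"
    then obtain xs where xs: "is_cycle {e \<in> F. mid e \<in> closure f} xs"
      using face_has_cycle[OF assms] False by metis
    define e where "e = {last xs, hd xs}"
    have "e \<in> cycle_edges xs" by (simp add: cycle_edges_def e_def)
    moreover have "is_cycle F xs" "mid e \<in> closure f" "e \<in> F"
      using xs calculation by (auto simp: is_cycle_def)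
    ultimately show "f \<in> (\<Union>e \<in> C. {f \<in> faces F. mid e \<in> closure f})"
      using f by (auto simp: C_def)
  qed
  moreover have "finite (\<Union>e \<in> C. {f \<in> faces F. mid e \<in> closure f})"
    using \<open>finite C\<close> edge_on_two_faces(1)[OF _ assms] by (auto simp: C_def)
  ultimately show ?thesis by (rule finite_subset)
qed

text \<open>Deleting an edge of a cycle costs one edge and at least one face. What remains in the
  end is a forest, with fewer edges than vertices and at least one face. As an inequality the
  statement covers disconnected graphs as well.\<close>

lemma euler_lower_bound:
  assumes "F \<subseteq> F0" "finite W" "W \<noteq> {}" "\<Union>F \<subseteq> W"
  shows "card F + 2 \<le> card (faces F) + card W"
  using finite_subset[OF assms(1) finite_edges] assms(1,4)
proof (induction F rule: finite_psubset_induct)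
  case (psubset F)
  show ?case
  proof (cases "\<exists>xs. is_cycle F xs")
    case True
    then obtain xs e where xs: "is_cycle F xs" "e \<in> cycle_edges xs" "e \<in> F"
      by (auto simp: is_cycle_def cycle_edges_def)
    have "card (faces (F - {e})) < card (faces F)"
      using xs psubset.prems finite_faces by (intro faces_remove_edge) auto
    moreover have "card (F - {e}) + 2 \<le> card (faces (F - {e})) + card W"
      using xs psubset.prems by (intro psubset.IH) auto
    moreover have "card (F - {e}) + 1 = card F"
      using xs psubset.hyps card_Suc_Diff1[of F e] by simp
    ultimately show ?thesis by simp
  next
    case False
    have "\<exists>u v. u \<noteq> v \<and> e = {u, v}" if "e \<in> F" for e
      using edge_pair[OF subsetD[OF psubset.prems(1) that]] by auto
    then have "card F < card W"
      by (rule card_acyclic[OF psubset.hyps False _ assms(2,3) psubset.prems(2)])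
    moreover have "- skel F \<noteq> {}"
    proof
      assume "- skel F = {}"
      then have "skel F = UNIV" by auto
      then show False using compact_skel[OF psubset.prems(1)] not_compact_UNIV by metis
    qed
    then have "faces F \<noteq> {}" by (simp add: faces_def)
    then have "card (faces F) > 0"
      using finite_faces[OF psubset.prems(1)] by (simp add: card_gt_0_iff)
    ultimately show ?thesis by simp
  qed
qed

text \<open>With several faces, the double count gives \<open>5 * card (faces F) <= card F\<close>,
  and the conclusion holds even with 10 in place of 5. The 5 comes from the case of a single face,
  where only \<open>card F + 1 <= card W\<close> is available.\<close>

lemma girth_edge_bound:
  assumes "F \<subseteq> F0" "finite W" "W \<noteq> {}" "\<Union>F \<subseteq> W"
    and girth: "\<And>xs. is_cycle F xs \<Longrightarrow> 10 \<le> length xs"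
  shows "4 * card F + 5 \<le> 5 * card W"
proof (cases "- skel F \<in> faces F")
  case True
  then have "faces F = {- skel F}"
    unfolding faces_def
    by (metis components_eq_sing_iff in_components_connected in_components_nonempty)
  then show ?thesis using euler_lower_bound[OF assms(1-4)] by simp
next
  case False
  have fin: "finite F" using assms(1) finite_edges finite_subset by blast
  \<comment> \<open>The count is restricted to edges on cycles, since the bound of two faces per
    edge has been shown for these only.\<close>
  define C where "C = {e \<in> F. \<exists>xs. is_cycle F xs \<and> e \<in> cycle_edges xs}"
  have C: "finite C" "card C \<le> card F" using fin by (auto simp: C_def intro: card_mono)
  have "10 \<le> card {e \<in> C. mid e \<in> closure f}" if f: "f \<in> faces F" for f
  proof -
    obtain xs where xs: "is_cycle {e \<in> F. mid e \<in> closure f} xs"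
      using face_has_cycle[OF assms(1) f] False f by metis
    then have *: "is_cycle F xs" by (auto simp: is_cycle_def)
    have "10 \<le> card (cycle_edges xs)"
      using girth[OF *] xs by (simp add: is_cycle_def card_cycle_edges)
    also have "\<dots> \<le> card {e \<in> C. mid e \<in> closure f}"
    proof (rule card_mono)
      show "cycle_edges xs \<subseteq> {e \<in> C. mid e \<in> closure f}"
        using xs * by (auto simp: C_def is_cycle_def)
    qed (use C(1) in auto)
    finally show ?thesis .
  qed
  then have "10 * card (faces F) \<le> (\<Sum>f \<in> faces F. card {e \<in> C. mid e \<in> closure f})"
    using sum_bounded_below[of "faces F" 10 "\<lambda>f. card {e \<in> C. mid e \<in> closure f}"]
    by (simp add: mult.commute)
  also have "\<dots> = (\<Sum>e \<in> C. card {f \<in> faces F. mid e \<in> closure f})"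
    using C(1) finite_faces[OF assms(1)] by (intro sum_multicount_gen[symmetric]) auto
  also have "\<dots> \<le> 2 * card C"
    using sum_bounded_above[of C "\<lambda>e. card {f \<in> faces F. mid e \<in> closure f}" 2]
      edge_on_two_faces(2)[OF _ assms(1)] by (force simp: C_def mult.commute)
  finally show ?thesis using C euler_lower_bound[OF assms(1-4)] by linarith
qed

end

section \<open>Extending colourings\<close>

text \<open>Let x belong to \<open>L1\<close> but not to \<open>L2\<close>. If x differs from
  \<open>e\<close>, it is used for \<open>L1\<close> and is no obstacle in \<open>L2\<close>. If x
  equals \<open>e\<close>, then \<open>L2\<close> does not lose a colour to \<open>e\<close> and can
  be served last, with three colours against two exclusions.\<close>

lemma distinct_representatives3:
  fixes L1 L2 L3 :: "'c set"
  assumes "finite L1" "finite L2" "finite L3"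
    and "3 \<le> card L1" "3 \<le> card L2" "3 \<le> card L3" and "L1 \<noteq> L2"
  shows "\<exists>a \<in> L1. \<exists>b \<in> L2. \<exists>d \<in> L3. distinct [e, a, b, d]"
proof -
  have pick: "\<exists>x \<in> L. x \<notin> {u, u'}" if "finite L" "3 \<le> card L" for L :: "'c set" and u u'
  proof (rule ccontr)
    assume "\<not> ?thesis"
    then have "card L \<le> card {u, u'}" by (intro card_mono) auto
    also have "\<dots> \<le> 2" by (cases "u = u'") auto
    finally show False using that by simp
  qed
  have *: "\<exists>a \<in> L1. \<exists>b \<in> L2. \<exists>d \<in> L3. distinct [e, a, b, d]"
    if L: "finite L1" "finite L2" "3 \<le> card L1" "3 \<le> card L2" "x \<in> L1" "x \<notin> L2" for L1 L2 x
  proof (cases "x = e")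
    case False
    obtain d where d: "d \<in> L3" "d \<notin> {e, x}" using pick[of L3 e x] assms by blast
    obtain b where "b \<in> L2" "b \<notin> {e, d}" using pick[of L2 e d] L by blast
    then show ?thesis
      using d L False by (intro bexI[of _ x] bexI[of _ b] bexI[of _ d]) auto
  next
    case True
    obtain d where d: "d \<in> L3" "d \<notin> {e, x}" using pick[of L3 e x] assms by blast
    obtain a where a: "a \<in> L1" "a \<notin> {e, d}" using pick[of L1 e d] L by blast
    obtain b where "b \<in> L2" "b \<notin> {a, d}" using pick[of L2 a d] L by blast
    then show ?thesis
      using a d L True by (intro bexI[of _ a] bexI[of _ b] bexI[of _ d]) auto
  qed
  consider x where "x \<in> L1" "x \<notin> L2" | x where "x \<in> L2" "x \<notin> L1"
    using assms(7) by blast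
  then show ?thesis
  proof cases
    case 1
    then show ?thesis using *[of L1 L2] assms by blast
  next
    case 2
    then obtain a b d where "a \<in> L2" "b \<in> L1" "d \<in> L3" "distinct [e, a, b, d]"
      using *[of L2 L1] assms by blast
    then show ?thesis by (intro bexI[of _ b] bexI[of _ a] bexI[of _ d]) auto
  qed
qed

text \<open>Made for induced subgraphs: \<open>nb\<close> is empty outside \<open>V\<close>, and
  \<open>D\<close> remains the maximum degree of the original graph, so it is merely an upper bound
  for the degrees here.\<close>

locale critical =
  fixes V :: "'a set" and nb :: "'a \<Rightarrow> 'a set" and D :: nat
  assumes finite_V: "finite V"
    and nb_sym: "y \<in> nb x \<Longrightarrow> x \<in> nb y"
    and nb_V: "y \<in> nb x \<Longrightarrow> x \<in> V"
    and nb_irrefl: "x \<notin> nb x"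
    and D_ge: "4 \<le> D"
    and deg_le: "card (nb x) \<le> D"
begin

definition near :: "'a \<Rightarrow> 'a set" where
  "near x = (nb x \<union> \<Union>(nb ` nb x)) - {x}"

definition proper :: "'a set \<Rightarrow> ('a \<Rightarrow> nat) \<Rightarrow> bool" where
  "proper A c \<longleftrightarrow> (\<forall>x \<in> A. c x < D + 2 \<and> (\<forall>y \<in> A \<inter> near x. c x \<noteq> c y))"

text \<open>Adjacency is accepted in either direction, so that an equation like
  \<open>nb p = {v, q}\<close> settles the steps of a walk on both sides of
  \<open>p\<close>.\<close>

fun nbwalk :: "'a list \<Rightarrow> bool" where
  "nbwalk (x # y # z # zs) \<longleftrightarrow> (y \<in> nb x \<or> x \<in> nb y) \<and> x \<noteq> z \<and> nbwalk (y # z # zs)"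
| "nbwalk [x, y] \<longleftrightarrow> y \<in> nb x \<or> x \<in> nb y"
| "nbwalk _ \<longleftrightarrow> True"

text \<open>The vertices that a neighbour \<open>q\<close> of \<open>w\<close> sees through
  \<open>w\<close>; their number is the degree of \<open>w\<close>.\<close>

definition outer :: "'a \<Rightarrow> 'a \<Rightarrow> 'a set" where
  "outer w q = insert w (nb w - {q})"

lemma nb_V': "y \<in> nb x \<Longrightarrow> y \<in> V"
  using nb_V nb_sym by blast

lemma finite_nb [simp]: "finite (nb x)"
  using nb_V' finite_V by (meson finite_subset subsetI)

lemma near_iff: "y \<in> near x \<longleftrightarrow> y \<noteq> x \<and> (y \<in> nb x \<or> (\<exists>z. z \<in> nb x \<and> y \<in> nb z))"
  by (auto simp: near_def)

lemma near_sym: "y \<in> near x \<Longrightarrow> x \<in> near y"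
  unfolding near_iff by (metis nb_sym)

lemma in_V: "nb x = insert a B \<Longrightarrow> x \<in> V"
  using nb_V[of a x] by blast

lemma finite_near [simp]: "finite (near x)"
  by (auto simp: near_def)

lemma properD: "proper A c \<Longrightarrow> x \<in> A \<Longrightarrow> y \<in> A \<Longrightarrow> y \<in> near x \<Longrightarrow> c x \<noteq> c y"
  by (auto simp: proper_def)

lemma proper_less: "proper A c \<Longrightarrow> x \<in> A \<Longrightarrow> c x < D + 2"
  by (auto simp: proper_def)

lemma proper_mono: "proper A c \<Longrightarrow> A' \<subseteq> A \<Longrightarrow> proper A' c"
  by (auto simp: proper_def)

lemma proper_insert:
  assumes "proper A c" "w \<notin> A" "a < D + 2" "\<And>y. y \<in> near w \<Longrightarrow> y \<in> A \<Longrightarrow> a \<noteq> c y"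
  shows "proper (insert w A) (c(w := a))"
  unfolding proper_def
proof (intro ballI conjI)
  fix x assume x: "x \<in> insert w A"
  show "(c(w := a)) x < D + 2"
    using assms(1,3) x by (auto simp: proper_def)
  fix y assume y: "y \<in> insert w A \<inter> near x"
  then have xy: "y \<noteq> x" "y \<in> near x" "x \<in> insert w A" "y \<in> insert w A"
    using x by (simp_all add: near_iff)
  have yx: "x \<in> near y" using xy(2) by (rule near_sym)
  from xy consider "x = w" "y \<in> A" "y \<noteq> w" | "y = w" "x \<in> A" "x \<noteq> w"
    | "x \<in> A" "y \<in> A" "x \<noteq> w" "y \<noteq> w" by blast
  then show "(c(w := a)) x \<noteq> (c(w := a)) y"
  proof cases
    case 1
    then show ?thesis using assms(4)[of y] xy by simp
  next
    case 2
    then show ?thesis using assms(4)[of x] yx by auto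
  next
    case 3
    then show ?thesis using properD[OF assms(1), of x y] xy by simp
  qed
qed

lemma proper_upd:
  assumes "proper A c" "a < D + 2" "\<And>y. y \<in> near w \<Longrightarrow> y \<in> A \<Longrightarrow> y \<noteq> w \<Longrightarrow> a \<noteq> c y"
  shows "proper A (c(w := a))"
proof (cases "w \<in> A")
  case True
  have "proper (insert w (A - {w})) (c(w := a))"
    using assms by (intro proper_insert) (auto intro: proper_mono)
  then show ?thesis using True by (simp add: insert_absorb)
next
  case False
  then show ?thesis using assms(1) by (auto simp: proper_def)
qed

text \<open>Greedy colouring: one of the D + 2 colours is left. \<open>X\<close> collects colours to
  be kept free for a later step.\<close>

lemma extend:
  assumes "proper A c" "w \<notin> A" "near w \<inter> A \<subseteq> Y" "finite Y" "finite X" "card Y + card X \<le> D + 1"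
  shows "\<exists>c'. proper (insert w A) c' \<and> (\<forall>x \<in> A. c' x = c x) \<and> c' w \<notin> X"
proof -
  have "card (c ` (near w \<inter> A) \<union> X) \<le> card (near w \<inter> A) + card X"
    by (meson add_mono card_Un_le card_image_le finite_Int finite_near le_trans order_refl)
  also have "\<dots> \<le> card Y + card X"
    using assms(3,4) by (simp add: card_mono)
  also have "\<dots> < card {..<D + 2}"
    using assms(6) by simp
  finally have "\<not> {..<D + 2} \<subseteq> c ` (near w \<inter> A) \<union> X"
    using assms(5) by (metis card_mono finite_UnI finite_imageI finite_Int finite_near not_less)
  then obtain a where a: "a < D + 2" "a \<notin> c ` (near w \<inter> A)" "a \<notin> X" by auto
  then have "proper (insert w A) (c(w := a))"
    using assms(1,2) by (intro proper_insert) auto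
  then show ?thesis
    using assms(2) a(3) by (intro exI[of _ "c(w := a)"]) auto
qed

lemma extend_list:
  assumes "proper A c" "w \<notin> A" "near w \<inter> A \<subseteq> set ys" "finite X" "length ys + card X \<le> D + 1"
  shows "\<exists>c'. proper (insert w A) c' \<and> (\<forall>x \<in> A. c' x = c x) \<and> c' w \<notin> X"
  using assms card_length[of ys] by (intro extend[where Y = "set ys"]) auto

lemma extend2:
  assumes "proper A c" "w \<notin> A" "nb w = {a, b}" "insert a (nb a) \<inter> A \<subseteq> set xs"
    "insert b (nb b) \<inter> A \<subseteq> set ys" "length xs + length ys \<le> D + 1"
  shows "\<exists>c'. proper (insert w A) c' \<and> (\<forall>x \<in> A. c' x = c x)"
proof -
  have "near w \<inter> A \<subseteq> set (xs @ ys)"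
    using assms(2-5) by (auto simp: near_def)
  from extend_list[OF assms(1,2) this, of "{}"] show ?thesis using assms(6) by auto
qed

lemma card_outer: assumes "q \<in> nb w" shows "card (outer w q) = card (nb w)"
  using nb_irrefl[of w] card_Suc_Diff1[OF finite_nb assms] by (simp add: outer_def)

lemma finite_outer [simp]: "finite (outer w q)"
  by (simp add: outer_def)

text \<open>On the side of \<open>b\<close> everything is counted as coloured, which costs
  \<open>card (nb b)\<close>; on the side of \<open>a\<close> only the vertices that are really
  coloured are listed.\<close>

lemma extend1:
  assumes "proper A c" "w \<notin> A" "nb w = {a, b}" "insert a (nb a) \<inter> A \<subseteq> set xs"
    "length xs + card (nb b) \<le> D + 1"
  shows "\<exists>c'. proper (insert w A) c' \<and> (\<forall>x \<in> A. c' x = c x)"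
proof -
  have w: "w \<in> nb b" using assms(3) nb_sym by auto
  have "near w \<inter> A \<subseteq> set xs \<union> outer b w"
    using assms(2-4) by (auto simp: near_def outer_def)
  moreover have "card (set xs \<union> outer b w) + card {} \<le> D + 1"
    using assms(5) card_Un_le[of "set xs" "outer b w"] card_length[of xs] card_outer[OF w] by simp
  ultimately have "\<exists>c'. proper (insert w A) c' \<and> (\<forall>x \<in> A. c' x = c x) \<and> c' w \<notin> {}"
    using assms(1,2) by (intro extend[where Y = "set xs \<union> outer b w"]) auto
  then show ?thesis by blast
qed

definition arm1 :: "'a \<Rightarrow> 'a \<Rightarrow> 'a \<Rightarrow> bool" where
  "arm1 v x u \<longleftrightarrow> nb x = {v, u} \<and> v \<noteq> u"

definition arm2 :: "'a \<Rightarrow> 'a \<Rightarrow> 'a \<Rightarrow> 'a \<Rightarrow> bool" where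
  "arm2 v p q w \<longleftrightarrow> nb p = {v, q} \<and> nb q = {p, w} \<and> v \<noteq> q \<and> p \<noteq> w"

lemmas arm_defs = arm1_def arm2_def

end

text \<open>Girth at least 10 is used in the form that nonbacktracking walks with at most 10 vertices are
  paths.\<close>

locale minimal_counterexample = critical +
  assumes girth: "nbwalk xs \<Longrightarrow> length xs \<le> 10 \<Longrightarrow> distinct xs"
    and not_colourable: "\<not> proper V c"
    and minimal: "S \<subset> V \<Longrightarrow> \<exists>c. \<forall>x \<in> S. c x < D + 2 \<and>
      (\<forall>y \<in> S. x \<noteq> y \<longrightarrow> y \<in> nb x \<or> (\<exists>z \<in> S. z \<in> nb x \<and> y \<in> nb z) \<longrightarrow> c x \<noteq> (c y :: nat))"
begin

text \<open>The assumption \<open>minimal\<close> separates vertices at distance 2 only if a middle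
  vertex survives. When every deleted vertex has at most one surviving neighbour, no pair loses its
  middle vertex, so the colouring respects distances in the whole graph.\<close>

lemma delete:
  assumes "T \<noteq> {}" "T \<subseteq> V" "\<And>t a b. \<lbrakk>t \<in> T; a \<in> nb t; b \<in> nb t; a \<notin> T; b \<notin> T\<rbrakk> \<Longrightarrow> a = b"
  obtains c where "proper (V - T) c"
proof -
  have "V - T \<subset> V" using assms by blast
  from minimal[OF this] obtain c where c: "\<And>x. x \<in> V - T \<Longrightarrow> c x < D + 2"
    "\<And>x y. \<lbrakk>x \<in> V - T; y \<in> V - T; x \<noteq> y; y \<in> nb x \<or> (\<exists>z \<in> V - T. z \<in> nb x \<and> y \<in> nb z)\<rbrakk>
      \<Longrightarrow> c x \<noteq> (c y :: nat)"
    by blast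
  have "proper (V - T) c"
    unfolding proper_def
  proof (intro ballI conjI)
    fix x y assume x: "x \<in> V - T" and y: "y \<in> (V - T) \<inter> near x"
    have "y \<in> nb x \<or> (\<exists>z \<in> V - T. z \<in> nb x \<and> y \<in> nb z)"
    proof (cases "y \<in> nb x")
      case False
      then obtain z where z: "z \<in> nb x" "y \<in> nb z" "x \<noteq> y" using y by (auto simp: near_def)
      then have "z \<notin> T" using assms(3)[of z x y] x y nb_sym by blast
      then show ?thesis using z nb_V by blast
    qed simp
    then show "c x \<noteq> c y" using c(2)[of x y] x y by (auto simp: near_def)
  qed (use c in auto)
  then show ?thesis using that by blast
qed

lemma no_proper: "proper A c \<Longrightarrow> V \<subseteq> A \<Longrightarrow> False"
  using not_colourable proper_mono by blast

text \<open>The walk is prolonged by a further neighbour z of \<open>w\<close>. The walk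
  \<open>z # w # q # xs\<close> may have 10 vertices, hence the 7.\<close>

lemma outer_disjoint:
  assumes "nbwalk (w # q # xs)" "length xs \<le> 7"
  shows "outer w q \<inter> set xs = {}"
proof -
  have "w \<notin> set xs" using girth[OF assms(1)] assms(2) by auto
  moreover have "z \<notin> set xs" if "z \<in> nb w" "z \<noteq> q" for z
    using girth[of "z # w # q # xs"] assms that by auto
  ultimately show ?thesis by (auto simp: outer_def)
qed

lemma deg_ge2: assumes "v \<in> V" shows "2 \<le> card (nb v)"
proof (rule ccontr)
  assume less: "\<not> 2 \<le> card (nb v)"
  have eq: "a = b" if "a \<in> nb v" "b \<in> nb v" for a b
    using less that card_le_Suc0_iff_eq[of "nb v"] by simp
  obtain c where c: "proper (V - {v}) c"
    using delete[of "{v}"] assms eq by blast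
  have "\<exists>Y. finite Y \<and> near v \<inter> (V - {v}) \<subseteq> Y \<and> card Y \<le> D"
  proof (cases "nb v = {}")
    case False
    then obtain u where u: "nb v = {u}" using eq by blast
    then have "card (outer u v) \<le> D"
      using nb_sym[of u v] card_outer[of v u] deg_le[of u] by simp
    then show ?thesis
      using u by (intro exI[of _ "outer u v"]) (auto simp: near_def outer_def)
  qed (auto simp: near_def intro: exI[of _ "{}"])
  then obtain Y where Y: "finite Y" "near v \<inter> (V - {v}) \<subseteq> Y" "card Y \<le> D" by blast
  have "\<exists>c'. proper (insert v (V - {v})) c' \<and> (\<forall>x \<in> V - {v}. c' x = c x) \<and> c' v \<notin> {}"
    using Y by (intro extend[OF c]) auto
  then show False
    using no_proper by blast
qed

section \<open>Chains of two vertices of degree 2\<close>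

lemma arm2_distinct: assumes "arm2 v p q w" shows "distinct [v, p, q, w]" "q \<notin> nb v"
proof -
  have v: "v \<in> nb p" "q \<in> nb p" "v \<noteq> q" using assms by (auto simp: arm2_def)
  show "distinct [v, p, q, w]"
    by (rule girth) (use assms in \<open>auto simp: arm2_def\<close>)
  show "q \<notin> nb v"
    using girth[of "[v, p, q, v]"] v nb_irrefl by auto
qed

text \<open>The far vertex \<open>q\<close> comes first and sees \<open>v\<close> and at most D
  vertices through \<open>w\<close>; then \<open>p\<close> sees \<open>q\<close>, \<open>w\<close>
  and the at most D - 1 vertices in \<open>xs\<close>.\<close>

lemma extend_arm2:
  assumes arm: "arm2 v p q w" and c: "proper A c" "p \<notin> A" "q \<notin> A"
    and xs: "insert v (nb v) \<inter> A \<subseteq> set xs" "length xs + 1 \<le> D"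
  shows "\<exists>c'. proper (insert p (insert q A)) c' \<and> (\<forall>x \<in> A. c' x = c x)"
proof -
  note d = arm2_distinct[OF arm]
  have "\<exists>c'. proper (insert q A) c' \<and> (\<forall>x \<in> A. c' x = c x)"
    by (rule extend1[OF c(1), where a = p and b = w and xs = "[v]"])
      (use arm d c deg_le[of w] in \<open>auto simp: arm2_def\<close>)
  then obtain c1 where c1: "proper (insert q A) c1" "\<forall>x \<in> A. c1 x = c x" by blast
  have "\<exists>c'. proper (insert p (insert q A)) c' \<and> (\<forall>x \<in> insert q A. c' x = c1 x)"
    by (rule extend2[OF c1(1), where a = v and b = q and xs = xs and ys = "[q, w]"])
      (use arm d c xs in \<open>auto simp: arm2_def\<close>)
  then show ?thesis using c1(2) by auto
qed

text \<open>Otherwise \<open>p\<close> sees at most D - 1 vertices through \<open>v\<close>, and the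
  deleted pair \<open>p\<close>, \<open>q\<close> can be coloured again.\<close>

lemma arm2_deg:
  assumes arm: "arm2 v p q w"
  shows "card (nb v) = D"
proof (rule ccontr)
  assume n: "card (nb v) \<noteq> D"
  define T where "T = {p, q}"
  have V: "T \<subseteq> V" using in_V arm by (auto simp: T_def arm2_def)
  note d = arm2_distinct[OF arm]
  have v: "p \<in> nb v" using nb_sym arm by (auto simp: arm2_def)
  obtain c where c: "proper (V - T) c"
    by (rule delete[of T]) (use V arm in \<open>auto simp: T_def arm2_def\<close>)
  obtain xs where xs: "set xs = outer v p" "distinct xs"
    using finite_distinct_list[OF finite_outer] by blast
  have "length xs < D"
    using xs card_outer[OF v] deg_le[of v] n distinct_card[of xs] by simp
  moreover have "insert v (nb v) \<inter> (V - T) \<subseteq> set xs"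
    using xs by (auto simp: T_def outer_def)
  ultimately show False
    using extend_arm2[OF arm c, of xs] no_proper by (fastforce simp: T_def)
qed

lemma spare_colours:
  assumes "q \<in> nb w"
  obtains B where "B \<subseteq> {..<D + 2}" "card B = 2" "B \<inter> c ` outer w q = {}"
proof -
  have "card (c ` outer w q) \<le> D"
    using card_image_le[of "outer w q" c] card_outer[OF assms] deg_le[of w] by simp
  then have "2 \<le> card ({..<D + 2} - c ` outer w q)"
    using diff_card_le_card_Diff[of "c ` outer w q" "{..<D + 2}"] by simp
  then obtain B where "B \<subseteq> {..<D + 2} - c ` outer w q" "card B = 2"
    using obtain_subset_with_card_n by metis
  then show ?thesis by (intro that[of B]) auto
qed

text \<open>If \<open>v\<close> avoids two colours that are available at \<open>q\<close>, then \<open>q\<close> only has to avoid the colour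
  of \<open>p\<close>, so \<open>p\<close> and \<open>q\<close> can be coloured last.\<close>

lemma finish_arm2:
  assumes arm: "arm2 v p q w" and c: "proper A c" "V \<subseteq> A \<union> {p, q}" "p \<notin> A" "q \<notin> A"
    and B: "B \<subseteq> {..<D + 2}" "card B = 2" "B \<inter> c ` outer w q = {}" "c v \<notin> B"
  shows False
proof -
  note d = arm2_distinct[OF arm]
  have o: "p \<notin> outer w q"
    using outer_disjoint[of w q "[p, v]"] arm by (auto simp: arm2_def)
  \<comment> \<open>While \<open>q\<close> is uncoloured, \<open>p\<close> sees \<open>w\<close> and
    at most D vertices through \<open>v\<close>.\<close>
  have "\<exists>c'. proper (insert p A) c' \<and> (\<forall>x \<in> A. c' x = c x)"
    by (rule extend1[OF c(1), where a = q and b = v and xs = "[w]"])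
      (use arm d c deg_le[of v] in \<open>auto simp: arm2_def\<close>)
  then obtain c1 where c1: "proper (insert p A) c1" "\<forall>x \<in> A. c1 x = c x" by blast
  have "\<not> B \<subseteq> {c1 p}"
  proof
    assume "B \<subseteq> {c1 p}"
    then have "card B \<le> card {c1 p}" by (intro card_mono) auto
    then show False using B by simp
  qed
  then obtain b where b: "b \<in> B" "b \<noteq> c1 p" by blast
  have "proper (insert q (insert p A)) (c1(q := b))"
  proof (rule proper_insert[OF c1(1)])
    fix y assume y: "y \<in> near q" "y \<in> insert p A"
    then have "y = p \<or> y = v \<or> y \<in> outer w q"
      using arm by (auto simp: near_def outer_def arm2_def)
    then show "b \<noteq> c1 y"
      using y b B c1(2) d o by (metis disjoint_iff imageI insertE)
  qed (use b B c d in auto)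
  then show False using no_proper c by blast
qed

text \<open>As long as \<open>p1\<close> is uncoloured, \<open>p2\<close> sees through
  \<open>v\<close> only \<open>v\<close>, \<open>m\<close> and \<open>n\<close>, so the second chain
  is filled greedily. The first one comes last, thanks to the colours \<open>B\<close> reserved at
  \<open>q1\<close>.\<close>

lemma finish_two_arms:
  assumes "D = 4" and nbv: "nb v = {p1, p2, m, n}" "p1 \<noteq> p2"
    and arms: "arm2 v p1 q1 w1" "arm2 v p2 q2 w2"
    and c: "proper A c" "V \<subseteq> A \<union> {p1, q1, p2, q2}" "A \<inter> {p1, q1, p2, q2} = {}" "v \<in> A"
    and B: "B \<subseteq> {..<D + 2}" "card B = 2" "B \<inter> c ` outer w1 q1 = {}" "c v \<notin> B"
    and O: "outer w1 q1 \<subseteq> A"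
  shows False
proof -
  have d: "distinct [q1, p1, v, p2, q2]"
    by (rule girth) (use arms nbv in \<open>auto simp: arm2_def\<close>)
  have "\<exists>c'. proper (insert p2 (insert q2 A)) c' \<and> (\<forall>x \<in> A. c' x = c x)"
    by (rule extend_arm2[OF arms(2) c(1), where xs = "[v, m, n]"])
      (use nbv c assms(1) in auto)
  then obtain c1 where c1: "proper (insert p2 (insert q2 A)) c1" "\<forall>x \<in> A. c1 x = c x" by blast
  have eq: "c1 ` outer w1 q1 = c ` outer w1 q1"
    using c1(2) O by (intro image_cong) auto
  show False
  proof (rule finish_arm2[OF arms(1) c1(1) _ _ _ B(1,2)])
    show "B \<inter> c1 ` outer w1 q1 = {}" unfolding eq by (rule B(3))
    show "c1 v \<notin> B" using c1(2) B(4) c(4) by auto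
  qed (use c d in auto)
qed

end

section \<open>Reducible configurations\<close>

context minimal_counterexample
begin

text \<open>The digits in the names of the following lemmas are the numbers of consecutive vertices of
  degree 2 that are met in the directions of the neighbours of \<open>v\<close>.\<close>

lemma no_2222:
  assumes "D = 4" and nbv: "nb v = {p1, p2, p3, p4}" "distinct [p1, p2, p3, p4]"
    and arms: "arm2 v p1 q1 w1" "arm2 v p2 q2 w2" "arm2 v p3 q3 w3" "arm2 v p4 q4 w4"
  shows False
proof -
  have d: "distinct [w1, q1, p1, v, p2, q2]" "distinct [w1, q1, p1, v, p3, q3]"
    "distinct [w1, q1, p1, v, p4, q4]" "distinct [w2, q2, p2, v, p3, q3]"
    "distinct [w2, q2, p2, v, p4, q4]" "distinct [w3, q3, p3, v, p4, q4]"
    by ((rule girth; use arms nbv in \<open>auto simp: arm2_def\<close>)+)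
  define T where "T = {v, p1, q1, p2, q2, p3, q3, p4, q4}"
  have V: "T \<subseteq> V" using in_V arms nbv by (auto simp: T_def arm2_def)
  obtain c where c: "proper (V - T) c"
    by (rule delete[of T]) (use V arms nbv in \<open>auto simp: T_def arm2_def\<close>)
  have qw: "q1 \<in> nb w1" using arms nb_sym by (auto simp: arm2_def)
  obtain B where B: "B \<subseteq> {..<D + 2}" "card B = 2" "B \<inter> c ` outer w1 q1 = {}"
    using spare_colours[OF qw] .
  have O: "outer w1 q1 \<subseteq> V - T"
    using outer_disjoint[of w1 q1 "[p1, v, p2, q2]"] outer_disjoint[of w1 q1 "[p1, v, p3, q3]"]
      outer_disjoint[of w1 q1 "[p1, v, p4, q4]"] arms nbv nb_V' nb_V[OF qw]
    by (auto simp: arm2_def T_def outer_def)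
  \<comment> \<open>Everything that \<open>v\<close> sees has been deleted, so it only has to avoid
    the reserved colours.\<close>
  have "\<exists>c'. proper (insert v (V - T)) c' \<and> (\<forall>x \<in> V - T. c' x = c x) \<and> c' v \<notin> B"
    by (rule extend_list[OF c, where ys = "[]"])
      (use arms nbv B assms(1) finite_subset[OF B(1)] in \<open>auto simp: T_def near_def arm2_def\<close>)
  then obtain c1 where c1: "proper (insert v (V - T)) c1" "\<forall>x \<in> V - T. c1 x = c x" "c1 v \<notin> B"
    by blast
  let ?A1 = "insert v (V - T)"
  have "\<exists>c'. proper (insert p4 (insert q4 ?A1)) c' \<and> (\<forall>x \<in> ?A1. c' x = c1 x)"
    by (rule extend_arm2[OF arms(4) c1(1), where xs = "[v]"])
      (use arms nbv d assms(1) in \<open>auto simp: T_def\<close>)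
  then obtain c2 where c2: "proper (insert p4 (insert q4 ?A1)) c2" "\<forall>x \<in> ?A1. c2 x = c1 x"
    by blast
  let ?A2 = "insert p4 (insert q4 ?A1)"
  have "\<exists>c'. proper (insert p3 (insert q3 ?A2)) c' \<and> (\<forall>x \<in> ?A2. c' x = c2 x)"
    by (rule extend_arm2[OF arms(3) c2(1), where xs = "[v, p4]"])
      (use arms nbv d assms(1) girth[of "[v, p4, q4, v]"] in \<open>auto simp: T_def arm2_def\<close>)
  then obtain c3 where c3: "proper (insert p3 (insert q3 ?A2)) c3" "\<forall>x \<in> ?A2. c3 x = c2 x"
    by blast
  have eq: "c3 ` outer w1 q1 = c ` outer w1 q1"
    using c1(2) c2(2) c3(2) O by (intro image_cong) auto
  show False
  proof (rule finish_two_arms[OF assms(1) _ _ arms(1,2) c3(1) _ _ _ B(1,2)])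
    show "B \<inter> c3 ` outer w1 q1 = {}" unfolding eq by (rule B(3))
    show "c3 v \<notin> B" using c1(3) c2(2) c3(2) by auto
    show "nb v = {p1, p2, p3, p4}" by (rule nbv(1))
  qed (use O d in \<open>auto simp: T_def\<close>)
qed

text \<open>The order matters: \<open>s\<close> sees up to D vertices through \<open>t\<close>, so
  it must follow directly after \<open>v\<close>, before any other neighbour of \<open>v\<close> is
  coloured.\<close>

lemma no_2221:
  assumes "D = 4" and nbv: "nb v = {p1, p2, p3, s}" "distinct [p1, p2, p3, s]"
    and arms: "arm2 v p1 q1 w1" "arm2 v p2 q2 w2" "arm2 v p3 q3 w3" "arm1 v s t"
  shows False
proof -
  have d: "distinct [w1, q1, p1, v, p2, q2]" "distinct [w1, q1, p1, v, p3, q3]"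
    "distinct [w1, q1, p1, v, s, t]" "distinct [w2, q2, p2, v, p3, q3]"
    "distinct [w2, q2, p2, v, s, t]" "distinct [w3, q3, p3, v, s, t]"
    by ((rule girth; use arms nbv in \<open>auto simp: arm_defs\<close>)+)
  define T where "T = {v, p1, q1, p2, q2, p3, q3, s}"
  have V: "T \<subseteq> V" using in_V arms nbv by (auto simp: T_def arm_defs)
  obtain c where c: "proper (V - T) c"
    by (rule delete[of T]) (use V arms nbv in \<open>auto simp: T_def arm_defs\<close>)
  have qw: "q1 \<in> nb w1" using arms nb_sym by (auto simp: arm2_def)
  obtain B where B: "B \<subseteq> {..<D + 2}" "card B = 2" "B \<inter> c ` outer w1 q1 = {}"
    using spare_colours[OF qw] .
  have O: "outer w1 q1 \<subseteq> V - T"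
    using outer_disjoint[of w1 q1 "[p1, v, p2, q2]"] outer_disjoint[of w1 q1 "[p1, v, p3, q3]"]
      outer_disjoint[of w1 q1 "[p1, v, s, t]"] arms nbv nb_V' nb_V[OF qw]
    by (auto simp: arm_defs T_def outer_def)
  have "\<exists>c'. proper (insert v (V - T)) c' \<and> (\<forall>x \<in> V - T. c' x = c x) \<and> c' v \<notin> B"
    by (rule extend_list[OF c, where ys = "[t]"])
      (use arms nbv B assms(1) finite_subset[OF B(1)] in \<open>auto simp: T_def near_def arm_defs\<close>)
  then obtain c1 where c1: "proper (insert v (V - T)) c1" "\<forall>x \<in> V - T. c1 x = c x" "c1 v \<notin> B"
    by blast
  let ?A1 = "insert v (V - T)"
  have "\<exists>c'. proper (insert s ?A1) c' \<and> (\<forall>x \<in> ?A1. c' x = c1 x)"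
    by (rule extend1[OF c1(1), where a = v and b = t and xs = "[v]"])
      (use arms nbv d deg_le[of t] in \<open>auto simp: T_def arm_defs\<close>)
  then obtain c2 where c2: "proper (insert s ?A1) c2" "\<forall>x \<in> ?A1. c2 x = c1 x"
    by blast
  let ?A2 = "insert s ?A1"
  have "\<exists>c'. proper (insert p3 (insert q3 ?A2)) c' \<and> (\<forall>x \<in> ?A2. c' x = c2 x)"
    by (rule extend_arm2[OF arms(3) c2(1), where xs = "[v, s]"])
      (use arms nbv d assms(1) in \<open>auto simp: T_def arm2_def\<close>)
  then obtain c3 where c3: "proper (insert p3 (insert q3 ?A2)) c3" "\<forall>x \<in> ?A2. c3 x = c2 x"
    by blast
  have eq: "c3 ` outer w1 q1 = c ` outer w1 q1"
    using c1(2) c2(2) c3(2) O by (intro image_cong) auto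
  show False
  proof (rule finish_two_arms[OF assms(1) _ _ arms(1,2) c3(1) _ _ _ B(1,2)])
    show "B \<inter> c3 ` outer w1 q1 = {}" unfolding eq by (rule B(3))
    show "c3 v \<notin> B" using c1(3) c2(2) c3(2) by auto
    show "nb v = {p1, p2, p3, s}" by (rule nbv(1))
  qed (use O d in \<open>auto simp: T_def\<close>)
qed

text \<open>\<open>m\<close> stays coloured. Thus \<open>v\<close> has to avoid the two reserved
  colours and at most three vertices seen through \<open>m\<close>, exactly D + 1
  exclusions.\<close>

lemma no_2220:
  assumes "D = 4" and nbv: "nb v = {p1, p2, p3, m}" "distinct [p1, p2, p3, m]"
    and arms: "arm2 v p1 q1 w1" "arm2 v p2 q2 w2" "arm2 v p3 q3 w3" and m: "card (nb m) \<le> 3"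
  shows False
proof -
  have d: "distinct [w1, q1, p1, v, p2, q2]" "distinct [w1, q1, p1, v, p3, q3]"
    "distinct [w1, q1, p1, v, m]" "distinct [w2, q2, p2, v, p3, q3]"
    "distinct [w2, q2, p2, v, m]" "distinct [w3, q3, p3, v, m]"
    by ((rule girth; use arms nbv in \<open>auto simp: arm_defs\<close>)+)
  define T where "T = {v, p1, q1, p2, q2, p3, q3}"
  have V: "T \<subseteq> V" using in_V arms nbv by (auto simp: T_def arm_defs)
  obtain c where c: "proper (V - T) c"
    by (rule delete[of T]) (use V arms nbv in \<open>auto simp: T_def arm_defs\<close>)
  have qw: "q1 \<in> nb w1" "v \<in> nb m" using arms nbv nb_sym by (auto simp: arm2_def)
  obtain B where B: "B \<subseteq> {..<D + 2}" "card B = 2" "B \<inter> c ` outer w1 q1 = {}"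
    using spare_colours[OF qw(1)] .
  have O: "outer w1 q1 \<subseteq> V - T"
    using outer_disjoint[of w1 q1 "[p1, v, p2, q2]"] outer_disjoint[of w1 q1 "[p1, v, p3, q3]"]
      arms nbv nb_V' nb_V[OF qw(1)]
    by (auto simp: arm_defs T_def outer_def)
  have "\<exists>c'. proper (insert v (V - T)) c' \<and> (\<forall>x \<in> V - T. c' x = c x) \<and> c' v \<notin> B"
    by (rule extend[OF c, where Y = "outer m v"])
      (use arms nbv B assms(1) finite_subset[OF B(1)] m card_outer[OF qw(2)]
        in \<open>auto simp: T_def near_def arm_defs outer_def\<close>)
  then obtain c1 where c1: "proper (insert v (V - T)) c1" "\<forall>x \<in> V - T. c1 x = c x" "c1 v \<notin> B"
    by blast
  let ?A1 = "insert v (V - T)"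
  have "\<exists>c'. proper (insert p3 (insert q3 ?A1)) c' \<and> (\<forall>x \<in> ?A1. c' x = c1 x)"
    by (rule extend_arm2[OF arms(3) c1(1), where xs = "[v, m]"])
      (use arms nbv d assms(1) in \<open>auto simp: T_def arm2_def\<close>)
  then obtain c2 where c2: "proper (insert p3 (insert q3 ?A1)) c2" "\<forall>x \<in> ?A1. c2 x = c1 x"
    by blast
  have eq: "c2 ` outer w1 q1 = c ` outer w1 q1"
    using c1(2) c2(2) O by (intro image_cong) auto
  show False
  proof (rule finish_two_arms[OF assms(1) _ _ arms(1,2) c2(1) _ _ _ B(1,2)])
    show "B \<inter> c2 ` outer w1 q1 = {}" unfolding eq by (rule B(3))
    show "c2 v \<notin> B" using c1(3) c2(2) by auto
    show "nb v = {p1, p2, p3, m}" by (rule nbv(1))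
  qed (use O d in \<open>auto simp: T_def\<close>)
qed

text \<open>\<open>s\<close> directly follows \<open>v\<close>, because \<open>t\<close> may have
  degree 4. Then \<open>x\<close> sees \<open>v\<close>, \<open>s\<close> and at most three vertices
  through \<open>u\<close>.\<close>

lemma no_2211:
  assumes "D = 4" and nbv: "nb v = {p1, p2, x, s}" "distinct [p1, p2, x, s]"
    and arms: "arm2 v p1 q1 w1" "arm2 v p2 q2 w2" "arm1 v x u" "arm1 v s t"
    and u: "card (nb u) \<le> 3"
  shows False
proof -
  have d: "distinct [w1, q1, p1, v, p2, q2]" "distinct [w1, q1, p1, v, x, u]"
    "distinct [w1, q1, p1, v, s, t]" "distinct [w2, q2, p2, v, x, u]"
    "distinct [w2, q2, p2, v, s, t]" "distinct [u, x, v, s, t]"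
    by ((rule girth; use arms nbv in \<open>auto simp: arm_defs\<close>)+)
  define T where "T = {v, p1, q1, p2, q2, x, s}"
  have V: "T \<subseteq> V" using in_V arms nbv by (auto simp: T_def arm_defs)
  obtain c where c: "proper (V - T) c"
    by (rule delete[of T]) (use V arms nbv in \<open>auto simp: T_def arm_defs\<close>)
  have qw: "q1 \<in> nb w1" using arms nb_sym by (auto simp: arm2_def)
  obtain B where B: "B \<subseteq> {..<D + 2}" "card B = 2" "B \<inter> c ` outer w1 q1 = {}"
    using spare_colours[OF qw] .
  have O: "outer w1 q1 \<subseteq> V - T"
    using outer_disjoint[of w1 q1 "[p1, v, p2, q2]"] outer_disjoint[of w1 q1 "[p1, v, x, u]"]
      outer_disjoint[of w1 q1 "[p1, v, s, t]"] arms nbv nb_V' nb_V[OF qw]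
    by (auto simp: arm_defs T_def outer_def)
  have "\<exists>c'. proper (insert v (V - T)) c' \<and> (\<forall>x \<in> V - T. c' x = c x) \<and> c' v \<notin> B"
    by (rule extend_list[OF c, where ys = "[t, u]"])
      (use arms nbv B assms(1) finite_subset[OF B(1)] in \<open>auto simp: T_def near_def arm_defs\<close>)
  then obtain c1 where c1: "proper (insert v (V - T)) c1" "\<forall>x \<in> V - T. c1 x = c x" "c1 v \<notin> B"
    by blast
  let ?A1 = "insert v (V - T)"
  have "\<exists>c'. proper (insert s ?A1) c' \<and> (\<forall>x \<in> ?A1. c' x = c1 x)"
    by (rule extend1[OF c1(1), where a = v and b = t and xs = "[v]"])
      (use arms nbv d deg_le[of t] in \<open>auto simp: T_def arm_defs\<close>)
  then obtain c2 where c2: "proper (insert s ?A1) c2" "\<forall>x \<in> ?A1. c2 x = c1 x"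
    by blast
  let ?A2 = "insert s ?A1"
  have "\<exists>c'. proper (insert x ?A2) c' \<and> (\<forall>x \<in> ?A2. c' x = c2 x)"
    by (rule extend1[OF c2(1), where a = v and b = u and xs = "[v, s]"])
      (use arms nbv d u assms(1) in \<open>auto simp: T_def arm_defs\<close>)
  then obtain c3 where c3: "proper (insert x ?A2) c3" "\<forall>x \<in> ?A2. c3 x = c2 x"
    by blast
  have eq: "c3 ` outer w1 q1 = c ` outer w1 q1"
    using c1(2) c2(2) c3(2) O by (intro image_cong) auto
  show False
  proof (rule finish_two_arms[OF assms(1) _ _ arms(1,2) c3(1) _ _ _ B(1,2)])
    show "B \<inter> c3 ` outer w1 q1 = {}" unfolding eq by (rule B(3))
    show "c3 v \<notin> B" using c1(3) c2(2) c3(2) by auto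
    show "nb v = {p1, p2, x, s}" by (rule nbv(1))
  qed (use O d in \<open>auto simp: T_def\<close>)
qed

text \<open>If \<open>m\<close> kept its colour, \<open>v\<close> would face \<open>t\<close>,
  \<open>m\<close>, \<open>x\<close>, \<open>r\<close> and two reserved colours, one exclusion too
  many. So \<open>m\<close>, \<open>x\<close>, \<open>r\<close> are deleted too and restored after
  \<open>v\<close>; \<open>m\<close> then sees exactly five vertices.\<close>

lemma no_2210:
  assumes "D = 4" and nbv: "nb v = {p1, p2, s, m}" "distinct [p1, p2, s, m]"
    and arms: "arm2 v p1 q1 w1" "arm2 v p2 q2 w2" "arm1 v s t"
    and nbm: "nb m = {v, x, r}" "distinct [v, x, r]" "arm1 m x u" "arm1 m r r'"
    and deg: "card (nb t) \<le> 3" "card (nb u) \<le> 3" "card (nb r') \<le> 3"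
  shows False
proof -
  have d: "distinct [w1, q1, p1, v, p2, q2]" "distinct [w1, q1, p1, v, s, t]"
    "distinct [w1, q1, p1, v, m, x, u]" "distinct [w1, q1, p1, v, m, r, r']"
    "distinct [w2, q2, p2, v, s, t]" "distinct [w2, q2, p2, v, m, x, u]"
    "distinct [w2, q2, p2, v, m, r, r']" "distinct [t, s, v, m, x, u]"
    "distinct [t, s, v, m, r, r']" "distinct [u, x, m, r, r']"
    by ((rule girth; use arms nbv nbm in \<open>auto simp: arm_defs\<close>)+)
  define T where "T = {v, p1, q1, p2, q2, s, m, x, r}"
  have V: "T \<subseteq> V" using in_V arms nbv nbm by (auto simp: T_def arm_defs)
  obtain c where c: "proper (V - T) c"
    by (rule delete[of T]) (use V arms nbv nbm in \<open>auto simp: T_def arm_defs\<close>)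
  have qw: "q1 \<in> nb w1" using arms nb_sym by (auto simp: arm2_def)
  obtain B where B: "B \<subseteq> {..<D + 2}" "card B = 2" "B \<inter> c ` outer w1 q1 = {}"
    using spare_colours[OF qw] .
  have O: "outer w1 q1 \<subseteq> V - T"
    using outer_disjoint[of w1 q1 "[p1, v, p2, q2]"] outer_disjoint[of w1 q1 "[p1, v, s, t]"]
      outer_disjoint[of w1 q1 "[p1, v, m, x]"] outer_disjoint[of w1 q1 "[p1, v, m, r]"]
      arms nbv nbm nb_V' nb_V[OF qw]
    by (auto simp: arm_defs T_def outer_def)
  have "\<exists>c'. proper (insert v (V - T)) c' \<and> (\<forall>x \<in> V - T. c' x = c x) \<and> c' v \<notin> B"
    by (rule extend_list[OF c, where ys = "[t]"])
      (use arms nbv nbm B assms(1) finite_subset[OF B(1)] in \<open>auto simp: T_def near_def arm_defs\<close>)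
  then obtain c1 where c1: "proper (insert v (V - T)) c1" "\<forall>x \<in> V - T. c1 x = c x" "c1 v \<notin> B"
    by blast
  let ?A1 = "insert v (V - T)"
  have "\<exists>c'. proper (insert x ?A1) c' \<and> (\<forall>x \<in> ?A1. c' x = c1 x)"
    by (rule extend1[OF c1(1), where a = m and b = u and xs = "[v]"])
      (use arms nbv nbm d deg assms(1) in \<open>auto simp: T_def arm_defs\<close>)
  then obtain c2 where c2: "proper (insert x ?A1) c2" "\<forall>x \<in> ?A1. c2 x = c1 x"
    by blast
  let ?A2 = "insert x ?A1"
  have "\<exists>c'. proper (insert r ?A2) c' \<and> (\<forall>x \<in> ?A2. c' x = c2 x)"
    by (rule extend1[OF c2(1), where a = m and b = r' and xs = "[v, x]"])
      (use arms nbv nbm d deg assms(1) in \<open>auto simp: T_def arm_defs\<close>)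
  then obtain c3 where c3: "proper (insert r ?A2) c3" "\<forall>x \<in> ?A2. c3 x = c2 x"
    by blast
  let ?A3 = "insert r ?A2"
  have "\<exists>c'. proper (insert m ?A3) c' \<and> (\<forall>x \<in> ?A3. c' x = c3 x) \<and> c' m \<notin> {}"
    by (rule extend_list[OF c3(1), where ys = "[v, x, r, u, r']"])
      (use arms nbv nbm d assms(1) in \<open>auto simp: T_def near_def arm_defs\<close>)
  then obtain c4 where c4: "proper (insert m ?A3) c4" "\<forall>x \<in> ?A3. c4 x = c3 x"
    by blast
  let ?A4 = "insert m ?A3"
  have "\<exists>c'. proper (insert s ?A4) c' \<and> (\<forall>x \<in> ?A4. c' x = c4 x)"
    by (rule extend1[OF c4(1), where a = v and b = t and xs = "[v, m]"])
      (use arms nbv nbm d deg assms(1) girth[of "[v, m, x, v]"] girth[of "[v, m, r, v]"]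
        in \<open>auto simp: T_def arm_defs\<close>)
  then obtain c5 where c5: "proper (insert s ?A4) c5" "\<forall>x \<in> ?A4. c5 x = c4 x"
    by blast
  have eq: "c5 ` outer w1 q1 = c ` outer w1 q1"
    using c1(2) c2(2) c3(2) c4(2) c5(2) O by (intro image_cong) auto
  show False
  proof (rule finish_two_arms[OF assms(1) _ _ arms(1,2) c5(1) _ _ _ B(1,2)])
    show "B \<inter> c5 ` outer w1 q1 = {}" unfolding eq by (rule B(3))
    show "c5 v \<notin> B" using c1(3) c2(2) c3(2) c4(2) c5(2) by auto
    show "nb v = {p1, p2, s, m}" by (rule nbv(1))
  qed (use O d in \<open>auto simp: T_def\<close>)
qed

section \<open>Vertices of degree 3 with three neighbours of degree 2\<close>

text \<open>With the order \<open>y\<close>, \<open>z\<close>, \<open>x\<close>, \<open>u\<close>,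
  the third vertex can afford \<open>y\<close> and \<open>z\<close> if \<open>x'\<close> has degree
  below D. The last one sees six vertices, within D + 1 because D is at least 5.\<close>

lemma bad_vertex_ends:
  assumes "5 \<le> D" and nbu: "nb u = {x, y, z}" "distinct [x, y, z]"
    and arms: "arm1 u x x'" "arm1 u y y'" "arm1 u z z'"
  shows "card (nb x') = D"
proof (rule ccontr)
  assume n: "card (nb x') \<noteq> D"
  then have x': "card (nb x') < D" using deg_le[of x'] by simp
  have d: "distinct [x', x, u, y, y']" "distinct [x', x, u, z, z']" "distinct [y', y, u, z, z']"
    by ((rule girth; use arms nbu in \<open>auto simp: arm_defs\<close>)+)
  define T where "T = {u, x, y, z}"
  have V: "T \<subseteq> V" using in_V arms nbu by (auto simp: T_def arm_defs)
  obtain c where c: "proper (V - T) c"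
    by (rule delete[of T]) (use V arms nbu in \<open>auto simp: T_def arm_defs\<close>)
  let ?A0 = "V - T"
  have "\<exists>c'. proper (insert y ?A0) c' \<and> (\<forall>x \<in> ?A0. c' x = c x)"
    by (rule extend1[OF c, where a = u and b = y' and xs = "[]"])
      (use arms nbu d deg_le[of y'] in \<open>auto simp: T_def arm_defs\<close>)
  then obtain c1 where c1: "proper (insert y ?A0) c1" by blast
  let ?A1 = "insert y ?A0"
  have "\<exists>c'. proper (insert z ?A1) c' \<and> (\<forall>x \<in> ?A1. c' x = c1 x)"
    by (rule extend1[OF c1, where a = u and b = z' and xs = "[y]"])
      (use arms nbu d deg_le[of z'] in \<open>auto simp: T_def arm_defs\<close>)
  then obtain c2 where c2: "proper (insert z ?A1) c2" by blast
  let ?A2 = "insert z ?A1"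
  have "\<exists>c'. proper (insert x ?A2) c' \<and> (\<forall>x \<in> ?A2. c' x = c2 x)"
    by (rule extend1[OF c2, where a = u and b = x' and xs = "[y, z]"])
      (use arms nbu d x' in \<open>auto simp: T_def arm_defs\<close>)
  then obtain c3 where c3: "proper (insert x ?A2) c3" by blast
  let ?A3 = "insert x ?A2"
  have "\<exists>c'. proper (insert u ?A3) c' \<and> (\<forall>x \<in> ?A3. c' x = c3 x) \<and> c' u \<notin> {}"
    by (rule extend_list[OF c3, where ys = "[x, y, z, x', y', z']"])
      (use arms nbu d assms(1) in \<open>auto simp: T_def near_def arm_defs\<close>)
  then show False using no_proper by (fastforce simp: T_def)
qed


text \<open>Once \<open>z\<close> has got a colour \<open>e\<close>, the four deleted vertices need
  pairwise distinct colours, and \<open>x\<close>, \<open>y\<close>, \<open>u\<close> have lists of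
  at least three. If the lists of \<open>x\<close> and \<open>y\<close>, or of \<open>x\<close> and
  \<open>u\<close>, differed, distinct representatives would complete the colouring.\<close>

lemma bad_vertex_colours:
  assumes "D = 4" and nbu: "nb u = {x, y, z}" "distinct [x, y, z]"
    and arms: "arm1 u x x'" "arm1 u y y'" "arm1 u z z'"
    and deg: "card (nb x') \<le> 3" "card (nb y') \<le> 3"
    and c: "proper (V - {u, x, y, z}) c"
  shows "c ` outer x' x = c ` outer y' y" "c ` outer x' x = c ` {x', y', z'}"
proof -
  have d: "distinct [x', x, u, y, y']" "distinct [x', x, u, z, z']" "distinct [y', y, u, z, z']"
    by ((rule girth; use arms nbu in \<open>auto simp: arm_defs\<close>)+)
  define A where "A = V - {u, x, y, z}"
  have A: "u \<notin> A" "x \<notin> A" "y \<notin> A" "z \<notin> A" "V \<subseteq> insert u (insert x (insert y (insert z A)))"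
    by (auto simp: A_def)
  have mem: "x \<in> nb x'" "y \<in> nb y'" "z \<in> nb z'"
    using nb_sym arms by (auto simp: arm_defs)
  have V': "x' \<in> V" "y' \<in> V" "z' \<in> V"
    using mem nb_V by blast+
  have out: "outer x' x \<subseteq> V" "outer y' y \<subseteq> V" "x \<notin> outer x' x" "y \<notin> outer y' y"
    using V' nb_V' d by (auto simp: outer_def)
  have dis: "outer x' x \<inter> {u, y, y'} = {}" "outer x' x \<inter> {u, z, z'} = {}"
    "outer y' y \<inter> {u, x, x'} = {}" "outer y' y \<inter> {u, z, z'} = {}"
    using outer_disjoint[of x' x "[u, y, y']"] outer_disjoint[of x' x "[u, z, z']"]
      outer_disjoint[of y' y "[u, x, x']"] outer_disjoint[of y' y "[u, z, z']"] arms nbu d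
    by (auto simp: arm_defs)
  have O: "outer x' x \<subseteq> A" "outer y' y \<subseteq> A" "{x', y', z'} \<subseteq> A"
    using out dis V' d by (auto simp: A_def)
  define L where "L S = {..<6} - c ` S" for S
  have fin: "finite (L S)" for S by (simp add: L_def)
  have L: "6 \<le> card (L S) + card S" if "finite S" for S
    using card_image_le[OF that, of c] diff_card_le_card_Diff[of "c ` S" "{..<6}"] that
    by (simp add: L_def)
  have less: "c t < 6" if "t \<in> A" for t
    using proper_less[OF c, of t] that assms(1) by (simp add: A_def)
  have L_eq: "c ` S = c ` S'" if "L S = L S'" "S \<subseteq> A" "S' \<subseteq> A" for S S'
  proof -
    have "c ` S \<subseteq> {..<6}" "c ` S' \<subseteq> {..<6}"
      using that(2,3) less by auto
    then have "c ` S = {..<6} - L S" "c ` S' = {..<6} - L S'"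
      by (simp_all add: L_def double_diff)
    then show ?thesis using that(1) by simp
  qed
  have L3: "3 \<le> card (L (outer x' x))" "3 \<le> card (L (outer y' y))" "3 \<le> card (L {x', y', z'})"
    using L[of "outer x' x"] L[of "outer y' y"] L[of "{x', y', z'}"] deg card_outer mem
      card_length[of "[x', y', z']"] by (auto simp del: card_insert_if)
  \<comment> \<open>\<open>z'\<close> may have degree 4, so the list of \<open>z\<close> can be as
    short as two; its colour is therefore fixed first.\<close>
  have "L (outer z' z) \<noteq> {}"
    using L[of "outer z' z"] deg_le[of z'] card_outer[OF mem(3)] assms(1) by auto
  then obtain e where e: "e \<in> L (outer z' z)" by blast
  have no: False if "a \<in> L (outer x' x)" "b \<in> L (outer y' y)" "k \<in> L {x', y', z'}"
    "distinct [e, a, b, k]" for a b k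
  proof -
    have nears: "near z \<inter> A \<subseteq> outer z' z" "near x \<inter> insert z A \<subseteq> insert z (outer x' x)"
      "near y \<inter> insert x (insert z A) \<subseteq> insert x (insert z (outer y' y))"
      "near u \<inter> insert y (insert x (insert z A)) \<subseteq> {x, y, z, x', y', z'}"
      using arms nbu A by (auto simp: near_def outer_def arm_defs)
    have "proper (insert z A) (c(z := e))"
      using c e nears(1) A assms(1) by (intro proper_insert) (auto simp: A_def[symmetric] L_def)
    then have "proper (insert x (insert z A)) (c(z := e, x := a))"
      by (rule proper_insert) (use that nears(2) A O assms(1) d in \<open>auto simp: L_def\<close>)
    then have "proper (insert y (insert x (insert z A))) (c(z := e, x := a, y := b))"
      by (rule proper_insert) (use that nears(3) A O assms(1) d in \<open>auto simp: L_def\<close>)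
    then have "proper (insert u (insert y (insert x (insert z A)))) (c(z := e, x := a, y := b, u := k))"
      by (rule proper_insert) (use that nears(4) A O assms(1) d in \<open>auto simp: L_def\<close>)
    then show False using no_proper A(5) by blast
  qed
  show "c ` outer x' x = c ` outer y' y"
  proof (rule L_eq[OF _ O(1,2)], rule ccontr)
    assume "L (outer x' x) \<noteq> L (outer y' y)"
    then show False
      using distinct_representatives3[OF fin fin fin L3] no by blast
  qed
  show "c ` outer x' x = c ` {x', y', z'}"
  proof (rule L_eq[OF _ O(1,3)], rule ccontr)
    assume "L (outer x' x) \<noteq> L {x', y', z'}"
    then obtain a b k where "a \<in> L (outer x' x)" "b \<in> L {x', y', z'}" "k \<in> L (outer y' y)"
      "distinct [e, a, b, k]"
      using distinct_representatives3[OF fin fin fin L3(1,3,2)] by blast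
    then show False using no[of a k b] by auto
  qed
qed

lemma recolour:
  assumes "proper A c" "w \<in> A" "near w \<inter> (A - {w}) \<subseteq> set ys" "finite X" "length ys + card X \<le> D + 1"
  obtains a where "proper A (c(w := a))" "a \<notin> X"
proof -
  obtain c' where c': "proper (insert w (A - {w})) c'" "\<forall>x \<in> A - {w}. c' x = c x" "c' w \<notin> X"
    using extend_list[OF proper_mono[OF assms(1), of "A - {w}"] _ assms(3-5)] by blast
  then have *: "proper A c'" using assms(2) by (simp add: insert_absorb)
  have "proper A (c(w := c' w))"
    using * c'(2) assms(2) unfolding proper_def by (metis Diff_iff IntD1 fun_upd_apply singletonD)
  then show ?thesis using that c'(3) by blast
qed

text \<open>Giving \<open>v\<close> another colour changes the colours around \<open>x\<close>, but not those around \<open>y\<close>.\<close>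

lemma no_bad_end_of_bad_vertex:
  assumes "D = 4" and nbu: "nb u = {x, y, z}" "distinct [x, y, z]"
    and arms: "arm1 u x v" "arm1 u y y'" "arm1 u z z'"
    and nbv: "nb v = {x, r, s}" "distinct [x, r, s]" "arm1 v r r'" "arm1 v s s'"
    and deg: "card (nb y') \<le> 3"
  shows False
proof -
  have d: "distinct [r', r, v, x, u, y, y']" "distinct [r', r, v, x, u, z, z']"
    "distinct [s', s, v, x, u, y, y']" "distinct [s', s, v, x, u, z, z']"
    by ((rule girth; use arms nbu nbv in \<open>auto simp: arm_defs\<close>)+)
  define T where "T = {u, x, y, z}"
  have V: "T \<subseteq> V" "v \<in> V" "r \<in> V" "s \<in> V"
    using in_V arms nbu nbv by (auto simp: T_def arm_defs)
  obtain c where c: "proper (V - T) c"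
    by (rule delete[of T]) (use V arms nbu in \<open>auto simp: T_def arm_defs\<close>)
  have cv: "card (nb v) \<le> 3" using nbv by simp
  have o: "v \<notin> outer y' y"
    using outer_disjoint[of y' y "[u, x, v]"] arms nbu nbv by (auto simp: arm_defs)
  have ov: "outer v x = {v, r, s}" using nbv by (auto simp: outer_def)
  \<comment> \<open>With \<open>x\<close> and \<open>u\<close> deleted, \<open>v\<close> sees four
    coloured vertices; its old colour is the fifth exclusion, the most that D + 1 allows.\<close>
  obtain a where a: "proper (V - T) (c(v := a))" "a \<notin> {c v}"
    by (rule recolour[OF c, where w = v and ys = "[r, s, r', s']" and X = "{c v}"])
      (use V arms nbu nbv d assms(1) in \<open>auto simp: T_def near_def arm_defs\<close>)
  have "c ` outer v x = c ` outer y' y"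
    by (rule bad_vertex_colours(1)[OF assms(1) nbu arms cv deg c[unfolded T_def]])
  moreover have "(c(v := a)) ` outer v x = (c(v := a)) ` outer y' y"
    by (rule bad_vertex_colours(1)[OF assms(1) nbu arms cv deg a(1)[unfolded T_def]])
  moreover have "(c(v := a)) ` outer y' y = c ` outer y' y"
    using o by (intro image_cong) auto
  ultimately have "{a, c r, c s} = {c v, c r, c s}"
    using ov nbv d by auto
  moreover have "c v \<noteq> c r" "c v \<noteq> c s"
    using properD[OF c, of v r] properD[OF c, of v s] V nbv nb_irrefl d
    by (auto simp: near_def T_def)
  ultimately show False using a(2) by blast
qed

text \<open>Either one of \<open>r\<close> and \<open>v\<close> can be recoloured, which changes the colours around \<open>x\<close>, or their
  colours can be exchanged, which changes the colours at distance 2 from \<open>u\<close>.\<close>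

lemma no_two_3_ends_of_bad_vertex:
  assumes "D = 4" and nbu: "nb u = {x, y, z}" "distinct [x, y, z]"
    and arms: "arm1 u x v" "arm1 u y y'" "arm1 u z z'"
    and nbv: "nb v = {x, r, s}" "distinct [x, r, s]" "arm1 v r r'"
    and deg: "card (nb y') \<le> 3" "card (nb r') \<le> 3" "card (nb s) \<le> 3"
  shows False
proof -
  have d: "distinct [r', r, v, x, u, y, y']" "distinct [r', r, v, x, u, z, z']"
    "distinct [s, v, x, u, y, y']" "distinct [s, v, x, u, z, z']"
    by ((rule girth; use arms nbu nbv in \<open>auto simp: arm_defs\<close>)+)
  define T where "T = {u, x, y, z}"
  define A where "A = V - T"
  have V: "T \<subseteq> V" "v \<in> V" "r \<in> V" "s \<in> V"
    using in_V arms nbu nbv nb_V'[of s v] by (auto simp: T_def arm_defs)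
  have A: "v \<in> A" "r \<in> A" "s \<in> A" "u \<notin> A" "x \<notin> A" "y \<notin> A" "z \<notin> A"
    using V d by (auto simp: A_def T_def)
  obtain c where c: "proper A c"
    unfolding A_def by (rule delete[of T]) (use V arms nbu in \<open>auto simp: T_def arm_defs\<close>)
  have cv: "card (nb v) \<le> 3" using nbv by simp
  have o: "v \<notin> outer y' y" "r \<notin> outer y' y"
    using outer_disjoint[of y' y "[u, x, v, r]"] arms nbu nbv by (auto simp: arm_defs)
  have ov: "outer v x = {v, r, s}" using nbv by (auto simp: outer_def)
  define P where "P = c ` outer y' y"
  have col: "{c' v, c' r, c' s} = P" "{c' v, c' y', c' z'} = P"
    if "proper A c'" "\<And>t. t \<noteq> v \<Longrightarrow> t \<noteq> r \<Longrightarrow> c' t = c t" for c'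
  proof -
    have "c' ` outer y' y = P"
      unfolding P_def using o that(2) by (intro image_cong refl) metis
    moreover note bad_vertex_colours[OF assms(1) nbu arms cv deg(1), of c']
    ultimately show "{c' v, c' r, c' s} = P" "{c' v, c' y', c' z'} = P"
      using that(1) ov by (auto simp: A_def T_def)
  qed
  have P: "{c v, c r, c s} = P" "{c v, c y', c z'} = P"
    using col[OF c] by simp_all
  have ne: "c v \<noteq> c r" "c v \<noteq> c s" "c r \<noteq> c s"
    using properD[OF c, of v r] properD[OF c, of v s] properD[OF c, of r s] A nbv d
    by (auto simp: near_def arm_defs)
  have "r \<in> nb v" "v \<in> nb s" "r \<in> nb r'" using nbv nb_sym by (auto simp: arm_defs)
  then have co: "card (outer r' r) \<le> 3" "card (outer s v) \<le> 3"
    using card_outer deg by auto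
  \<comment> \<open>With both \<open>v\<close> and \<open>r\<close> uncoloured, each of them sees at
    most four coloured vertices, so each can be offered a colour \<open>a\<close> or
    \<open>b\<close> other than its old one.\<close>
  define A2 where "A2 = A - {v, r}"
  have c2: "proper A2 c" using c by (rule proper_mono) (auto simp: A2_def)
  have nr: "near r \<inter> A2 \<subseteq> insert s (outer r' r)" "near v \<inter> A2 \<subseteq> insert r' (outer s v)"
    using nbv arms A nbu by (auto simp: near_def outer_def arm_defs A2_def)
  have "\<exists>c'. proper (insert r A2) c' \<and> (\<forall>x \<in> A2. c' x = c x) \<and> c' r \<notin> {c r}"
    by (rule extend[OF c2, where Y = "insert s (outer r' r)"])
      (use nr co assms(1) card_insert_le_m1[of 4 "outer r' r" s] in \<open>auto simp: A2_def\<close>)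
  then obtain a where a: "a < D + 2" "a \<noteq> c r" "\<And>t. t \<in> near r \<Longrightarrow> t \<in> A2 \<Longrightarrow> a \<noteq> c t"
    unfolding proper_def A2_def by (metis Int_iff insertCI singletonI)
  have "\<exists>c'. proper (insert v A2) c' \<and> (\<forall>x \<in> A2. c' x = c x) \<and> c' v \<notin> {c v}"
    by (rule extend[OF c2, where Y = "insert r' (outer s v)"])
      (use nr co assms(1) card_insert_le_m1[of 4 "outer s v" r'] in \<open>auto simp: A2_def\<close>)
  then obtain b where b: "b < D + 2" "b \<noteq> c v" "\<And>t. t \<in> near v \<Longrightarrow> t \<in> A2 \<Longrightarrow> b \<noteq> c t"
    unfolding proper_def A2_def by (metis Int_iff insertCI singletonI)
  \<comment> \<open>If only the other vertex's old colour is not in the way, recolouring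
    \<open>r\<close> alone is proper; this removes \<open>c r\<close> from the palette around
    \<open>x\<close>, which must stay equal to \<open>P\<close>. The same argument forces
    \<open>b = c r\<close>.\<close>
  have "a = c v"
  proof (rule ccontr)
    assume av: "a \<noteq> c v"
    have "proper A (c(r := a))"
      by (rule proper_upd[OF c a(1)]) (use a(3) av in \<open>auto simp: A2_def\<close>)
    then have "{c v, a, c s} = P"
      using col(1)[of "c(r := a)"] d nbv(2) by auto
    then have "c r \<in> {c v, a, c s}" unfolding P(1)[symmetric] by auto
    then show False using a(2) ne by auto
  qed
  moreover have "b = c r"
  proof (rule ccontr)
    assume br: "b \<noteq> c r"
    have "proper A (c(v := b))"
      by (rule proper_upd[OF c b(1)]) (use b(3) br in \<open>auto simp: A2_def\<close>)
    then have "{b, c r, c s} = P"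
      using col(1)[of "c(v := b)"] d nbv(2) by auto
    then have "c v \<in> {b, c r, c s}" unfolding P(1)[symmetric] by auto
    then show False using b(2) ne by auto
  qed
  ultimately have ab: "a = c v" "b = c r" by auto
  \<comment> \<open>After the exchange the colour of \<open>v\<close> is \<open>c r\<close>, so
    \<open>c v\<close>, still an element of \<open>P\<close>, must occur at \<open>y'\<close> or
    \<open>z'\<close>. In the old colouring \<open>v\<close>, \<open>y'\<close>, \<open>z'\<close>
    then carry at most two colours, although \<open>P\<close> has three.\<close>
  have "proper (insert r A2) (c(r := c v))"
    by (rule proper_insert[OF c2]) (use a ab in \<open>auto simp: A2_def\<close>)
  then have "proper (insert v (insert r A2)) (c(r := c v, v := c r))"
    by (rule proper_insert) (use b ab ne d in \<open>auto simp: A2_def\<close>)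
  moreover have "insert v (insert r A2) = A" using A by (auto simp: A2_def)
  ultimately have "{c r, c y', c z'} = P"
    using col(2)[of "c(r := c v, v := c r)"] d by auto
  then have eq: "{c r, c y', c z'} = {c v, c r, c s}" "{c v, c y', c z'} = {c v, c r, c s}"
    using P by simp_all
  then have "c v = c y' \<or> c v = c z'" using ne by blast
  moreover have "card {c v, c y', c z'} = 3"
    unfolding eq(2) using ne by simp
  ultimately show False
    by (auto simp: card_insert_if split: if_splits)
qed

text \<open>Giving \<open>t1\<close> another colour makes the colours available at \<open>s1\<close> and \<open>s2\<close> different.\<close>

lemma no_bad_end_2111:
  assumes "D = 4" and nbv: "nb v = {p, s1, s2, s3}" "distinct [p, s1, s2, s3]"
    and arms: "arm2 v p q w" "arm1 v s1 t1" "arm1 v s2 t2" "arm1 v s3 t3"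
    and deg: "card (nb t2) \<le> 3" "card (nb t3) \<le> 3"
    and nbt: "nb t1 = {s1, y, z}" "distinct [s1, y, z]" "arm1 t1 y y'" "arm1 t1 z z'"
  shows False
proof -
  have d: "distinct [w, q, p, v, s1, t1, y, y']" "distinct [w, q, p, v, s1, t1, z, z']"
    "distinct [w, q, p, v, s2, t2]" "distinct [w, q, p, v, s3, t3]"
    "distinct [t1, s1, v, s2, t2]" "distinct [t1, s1, v, s3, t3]" "distinct [t2, s2, v, s3, t3]"
    "distinct [t2, s2, v, s1, t1, y, y']" "distinct [t2, s2, v, s1, t1, z, z']"
    "distinct [t3, s3, v, s1, t1, y, y']" "distinct [t3, s3, v, s1, t1, z, z']"
    by ((rule girth; use arms nbv nbt in \<open>auto simp: arm_defs\<close>)+)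
  define T where "T = {v, p, q, s1, s2, s3}"
  define A where "A = V - T"
  have V: "T \<subseteq> V" using in_V arms nbv by (auto simp: T_def arm_defs)
  have T: "v \<notin> A" "p \<notin> A" "q \<notin> A" "s1 \<notin> A" "s2 \<notin> A" "s3 \<notin> A" "V \<subseteq> A \<union> T"
    by (auto simp: A_def T_def)
  have mem: "q \<in> nb w" "s1 \<in> nb t1" "s2 \<in> nb t2" "s3 \<in> nb t3"
    using arms nb_sym by (auto simp: arm_defs)
  have deg1: "card (nb t1) \<le> 3" using nbt by simp
  have VV: "w \<in> V" "t1 \<in> V" "t2 \<in> V" "y \<in> V" "z \<in> V"
    using mem[THEN nb_V] nb_V'[of y t1] nb_V'[of z t1] nbt(1) by auto
  have out: "outer w q \<subseteq> V" "outer t1 s1 \<subseteq> V" "outer t2 s2 \<subseteq> V"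
    "q \<notin> outer w q" "s1 \<notin> outer t1 s1" "s2 \<notin> outer t2 s2"
    using VV nb_V' d by (auto simp: outer_def)
  have dis: "outer w q \<inter> {p, v, s1} = {}" "outer w q \<inter> {p, v, s2} = {}"
    "outer w q \<inter> {p, v, s3} = {}" "outer t1 s1 \<inter> {v, p, q} = {}"
    "outer t1 s1 \<inter> {v, s2} = {}" "outer t1 s1 \<inter> {v, s3} = {}" "outer t2 s2 \<inter> {v, p, q} = {}"
    "outer t2 s2 \<inter> {v, s1} = {}" "outer t2 s2 \<inter> {v, s3} = {}"
    using outer_disjoint[of w q "[p, v, s1]"] outer_disjoint[of w q "[p, v, s2]"]
      outer_disjoint[of w q "[p, v, s3]"] outer_disjoint[of t1 s1 "[v, p, q]"]
      outer_disjoint[of t1 s1 "[v, s2]"] outer_disjoint[of t1 s1 "[v, s3]"]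
      outer_disjoint[of t2 s2 "[v, p, q]"]
      outer_disjoint[of t2 s2 "[v, s1]"] outer_disjoint[of t2 s2 "[v, s3]"] arms nbv d
    by (auto simp: arm_defs)
  have sub: "outer w q \<subseteq> A" "outer t1 s1 \<subseteq> A" "outer t2 s2 \<subseteq> A" "t1 \<in> A" "y \<in> A" "z \<in> A"
    using out dis VV d by (auto simp: A_def T_def)
  have o: "t1 \<notin> outer t2 s2"
    using outer_disjoint[of t2 s2 "[v, s1, t1]"] arms nbv nbt by (auto simp: arm_defs)
  have ot: "outer t1 s1 = {t1, y, z}" using nbt by (auto simp: outer_def)
  \<comment> \<open>If the palettes differ, \<open>v\<close> can avoid \<open>B\<close> and its
    three visible vertices, then \<open>s1\<close>, \<open>s2\<close>, \<open>s3\<close> take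
    distinct representatives other than the colour of \<open>v\<close>, and the chain
    \<open>p\<close>, \<open>q\<close> is filled last.\<close>
  have same: "c ` outer t1 s1 = c ` outer t2 s2" if c: "proper A c" for c
  proof (rule ccontr)
    assume ne: "c ` outer t1 s1 \<noteq> c ` outer t2 s2"
    obtain B where B: "B \<subseteq> {..<D + 2}" "card B = 2" "B \<inter> c ` outer w q = {}"
      using spare_colours[OF mem(1)] .
    have "\<exists>c'. proper (insert v A) c' \<and> (\<forall>x \<in> A. c' x = c x) \<and> c' v \<notin> B"
      by (rule extend_list[OF c, where ys = "[t1, t2, t3]"])
        (use arms nbv B assms(1) finite_subset[OF B(1)] T in \<open>auto simp: near_def arm_defs\<close>)
    then obtain c1 where c1: "proper (insert v A) c1" "\<forall>x \<in> A. c1 x = c x" "c1 v \<notin> B"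
      by blast
    have im: "c1 ` S = c ` S" if "S \<subseteq> A" for S using c1(2) that by (intro image_cong) auto
    define L where "L S = {..<6} - c1 ` S" for S
    have fin: "finite (L S)" for S by (simp add: L_def)
    have L: "6 \<le> card (L S) + card S" if "finite S" for S
      using card_image_le[OF that, of c1] diff_card_le_card_Diff[of "c1 ` S" "{..<6}"] that
      by (simp add: L_def)
    have L3: "3 \<le> card (L (outer t1 s1))" "3 \<le> card (L (outer t2 s2))" "3 \<le> card (L (outer t3 s3))"
      using L[of "outer t1 s1"] L[of "outer t2 s2"] L[of "outer t3 s3"] deg deg1 card_outer mem
      by auto
    have less: "c t < 6" if "t \<in> A" for t
      using proper_less[OF c that] assms(1) by simp
    have "c ` S = {..<6} - L S" if "S \<subseteq> A" for S
    proof -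
      have "c ` S \<subseteq> {..<6}" using less that by auto
      then show ?thesis unfolding L_def im[OF that] by (simp add: double_diff)
    qed
    then have "L (outer t1 s1) \<noteq> L (outer t2 s2)"
      using ne sub by metis
    then obtain a b k where abk: "a \<in> L (outer t1 s1)" "b \<in> L (outer t2 s2)" "k \<in> L (outer t3 s3)"
      "distinct [c1 v, a, b, k]"
      using distinct_representatives3[OF fin fin fin L3] by blast
    have nears: "near s1 \<inter> insert v A \<subseteq> insert v (outer t1 s1)"
      "near s2 \<inter> insert s1 (insert v A) \<subseteq> insert s1 (insert v (outer t2 s2))"
      "near s3 \<inter> insert s2 (insert s1 (insert v A)) \<subseteq> insert s2 (insert s1 (insert v (outer t3 s3)))"
      using arms nbv T by (auto simp: near_def outer_def arm_defs)
    have "proper (insert s1 (insert v A)) (c1(s1 := a))"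
      by (rule proper_insert[OF c1(1)]) (use abk nears(1) T assms(1) d in \<open>auto simp: L_def\<close>)
    then have "proper (insert s2 (insert s1 (insert v A))) (c1(s1 := a, s2 := b))"
      by (rule proper_insert) (use abk nears(2) T assms(1) d in \<open>auto simp: L_def\<close>)
    then have c2: "proper (insert s3 (insert s2 (insert s1 (insert v A)))) (c1(s1 := a, s2 := b, s3 := k))"
      by (rule proper_insert) (use abk nears(3) T assms(1) d in \<open>auto simp: L_def\<close>)
    let ?c = "c1(s1 := a, s2 := b, s3 := k)"
    have eq: "?c ` outer w q = c ` outer w q"
      using sub(1) T c1(2) by (intro image_cong) auto
    show False
    proof (rule finish_arm2[OF arms(1) c2 _ _ _ B(1,2)])
      show "B \<inter> ?c ` outer w q = {}" unfolding eq by (rule B(3))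
      show "?c v \<notin> B" using c1(3) d by auto
    qed (use T d in \<open>auto simp: T_def\<close>)
  qed
  obtain c where c: "proper A c"
    unfolding A_def by (rule delete[of T]) (use V arms nbv in \<open>auto simp: T_def arm_defs\<close>)
  \<comment> \<open>\<open>t1\<close> sees only \<open>y\<close>, \<open>z\<close>,
    \<open>y'\<close>, \<open>z'\<close> among the coloured vertices, so it can change its colour;
    the palette around \<open>s1\<close> changes, the one around \<open>s2\<close> does not.\<close>
  obtain a where a: "proper A (c(t1 := a))" "a \<notin> {c t1}"
    by (rule recolour[OF c, where w = t1 and ys = "[y, z, y', z']" and X = "{c t1}"])
      (use sub T arms nbt assms(1) in \<open>auto simp: near_def arm_defs\<close>)
  have "(c(t1 := a)) ` outer t2 s2 = c ` outer t2 s2"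
    using o by (intro image_cong) auto
  then have "(c(t1 := a)) ` {t1, y, z} = c ` {t1, y, z}"
    using same[OF c] same[OF a(1)] unfolding ot by simp
  moreover have "y \<noteq> t1" "z \<noteq> t1" using d by auto
  ultimately have "{a, c y, c z} = {c t1, c y, c z}" by (simp add: insert_commute)
  moreover have "c t1 \<noteq> c y" "c t1 \<noteq> c z"
    using properD[OF c, of t1 y] properD[OF c, of t1 z] sub nbt d by (auto simp: near_def)
  ultimately show False using a(2) by blast
qed

end

section \<open>Discharging\<close>

context minimal_counterexample
begin

abbreviation deg :: "'a \<Rightarrow> nat" where "deg v \<equiv> card (nb v)"

lemma nb2:
  assumes "deg x = 2" "v \<in> nb x"
  obtains w where "nb x = {v, w}" "v \<noteq> w"
proof -
  obtain a b where "nb x = {a, b}" "a \<noteq> b" using assms(1) by (auto simp: card_2_iff)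
  then show ?thesis using assms(2) that by (auto simp: insert_commute)
qed

lemma nb3:
  assumes "deg x = 3" "v \<in> nb x"
  obtains a b where "nb x = {v, a, b}" "distinct [v, a, b]"
proof -
  have "card (nb x - {v}) = 2" using assms by simp
  then obtain a b where "nb x - {v} = {a, b}" "a \<noteq> b" by (auto simp: card_2_iff)
  then have "nb x = {v, a, b}" "distinct [v, a, b]" using assms(2) by auto
  then show ?thesis using that by blast
qed

lemma edge_cases:
  assumes "m \<in> nb v"
  obtains (two) q w where "deg m = 2" "deg q = 2" "arm2 v m q w"
    | (one) b where "deg m = 2" "arm1 v m b" "3 \<le> deg b"
    | (zero) "3 \<le> deg m"
proof (cases "deg m = 2")
  case True
  obtain b where b: "nb m = {v, b}" "v \<noteq> b"
    using nb2[OF True, of v] nb_sym[OF assms] by blast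
  then have mb: "m \<in> nb b" using nb_sym[of b m] by simp
  show ?thesis
  proof (cases "deg b = 2")
    case True
    obtain w where "nb b = {m, w}" "m \<noteq> w" using nb2[OF True mb] by blast
    then have "arm2 v m b w" using b by (simp add: arm2_def)
    then show ?thesis using two \<open>deg m = 2\<close> True by blast
  next
    case False
    then have "3 \<le> deg b" using deg_ge2[of b] nb_V[OF mb] by simp
    then show ?thesis using one \<open>deg m = 2\<close> b by (auto simp: arm1_def)
  qed
next
  case False
  then have "3 \<le> deg m" using deg_ge2[of m] nb_V'[OF assms] by simp
  then show ?thesis using zero by blast
qed

lemma sum_nb_swap:
  fixes f :: "'a \<Rightarrow> 'a \<Rightarrow> int"
  shows "(\<Sum>v \<in> V. \<Sum>m \<in> nb v. f v m) = (\<Sum>v \<in> V. \<Sum>m \<in> nb v. f m v)"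
proof -
  have eq: "{m \<in> V. m \<in> nb v} = nb v" "{m \<in> V. v \<in> nb m} = nb v" for v
    using nb_V nb_V' nb_sym by blast+
  show ?thesis
    using sum.swap_restrict[OF finite_V finite_V, of f "\<lambda>v m. m \<in> nb v"] by (simp only: eq)
qed

text \<open>Charge moves along edges (\<open>pay\<close>) and along paths whose middle vertex has degree 2 (\<open>far\<close>).\<close>

lemma discharge:
  fixes pay far :: "'a \<Rightarrow> 'a \<Rightarrow> int" and charge :: "'a \<Rightarrow> int"
  assumes "\<And>v. v \<in> V \<Longrightarrow>
      (\<Sum>m \<in> nb v. pay v m + (\<Sum>b \<in> nb m - {v}. if deg m = 2 then far v b else 0))
      \<le> charge v + (\<Sum>m \<in> nb v. pay m v + (\<Sum>b \<in> nb m - {v}. if deg m = 2 then far b v else 0))"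
  shows "0 \<le> (\<Sum>v \<in> V. charge v)"
proof -
  \<comment> \<open>The condition \<open>v \<noteq> b\<close> is moved into the summand, so that the
    sum over \<open>v\<close> and \<open>b\<close> in \<open>nb m\<close> becomes symmetric and all
    transfers cancel.\<close>
  define F where "F v m b = (if v \<noteq> b then if deg m = 2 then far v b else 0 else 0)" for v m b
  have F: "(\<Sum>b \<in> nb m - {v}. if deg m = 2 then far v b else 0) = (\<Sum>b \<in> nb m. F v m b)"
    "(\<Sum>b \<in> nb m - {v}. if deg m = 2 then far b v else 0) = (\<Sum>b \<in> nb m. F b m v)" for v m
    by (intro sum.mono_neutral_cong_left; auto simp: F_def)+
  have "(\<Sum>v \<in> V. \<Sum>m \<in> nb v. \<Sum>b \<in> nb m. F v m b) = (\<Sum>m \<in> V. \<Sum>v \<in> nb m. \<Sum>b \<in> nb m. F v m b)"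
    by (rule sum_nb_swap)
  also have "\<dots> = (\<Sum>m \<in> V. \<Sum>b \<in> nb m. \<Sum>v \<in> nb m. F v m b)"
    by (intro sum.cong refl sum.swap)
  also have "\<dots> = (\<Sum>b \<in> V. \<Sum>m \<in> nb b. \<Sum>v \<in> nb m. F v m b)"
    by (rule sum_nb_swap)
  finally have far: "(\<Sum>v \<in> V. \<Sum>m \<in> nb v. \<Sum>b \<in> nb m. F v m b)
      = (\<Sum>v \<in> V. \<Sum>m \<in> nb v. \<Sum>b \<in> nb m. F b m v)" .
  have "(\<Sum>v \<in> V. \<Sum>m \<in> nb v. pay v m + (\<Sum>b \<in> nb m. F v m b))
      \<le> (\<Sum>v \<in> V. charge v + (\<Sum>m \<in> nb v. pay m v + (\<Sum>b \<in> nb m. F b m v)))"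
    using assms unfolding F by (intro sum_mono)
  then show ?thesis
    using sum_nb_swap[of pay] far by (simp add: sum.distrib)
qed


section \<open>Maximum degree at least 5\<close>

text \<open>A vertex of degree 2 lacks 2, supplied by one neighbour of degree D or by 1 from each
  side. Degree D can pay 2 to all neighbours, degrees from 4 to D - 1 can pay 1 to all. Degree 3 has
  charge 2 and could only fail by paying three times, but then all its neighbours have degree 2 and
  lead to vertices of degree D, which pay instead.\<close>

lemma dense_large_degree:
  assumes "5 \<le> D"
  shows "0 \<le> (\<Sum>v \<in> V. 4 * int (deg v) - 10)"
proof -
  define pay :: "'a \<Rightarrow> 'a \<Rightarrow> int" where "pay v m =
    (if deg m = 2 \<and> 3 \<le> deg v then
       if deg v = D then 2 else if \<exists>w \<in> nb m - {v}. deg w = D then 0 else 1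
     else 0)" for v m
  have nonneg: "0 \<le> pay v m" for v m by (simp add: pay_def)
  show ?thesis
  proof (rule discharge[where pay = pay and far = "\<lambda>_ _. 0"])
    fix v assume v: "v \<in> V"
    have "(\<Sum>m \<in> nb v. pay v m) \<le> 4 * int (deg v) - 10 + (\<Sum>m \<in> nb v. pay m v)"
    proof (cases "deg v = 2")
      case True
      then obtain a b where ab: "nb v = {a, b}" "a \<noteq> b" by (auto simp: card_2_iff)
      have va: "v \<in> nb a" "v \<in> nb b" using ab nb_sym by auto
      have big: "deg b' = D" if h: "nb v = {a', b'}" "a' \<noteq> b'" "deg a' = 2" for a' b'
      proof -
        have "v \<in> nb a'" using h nb_sym by auto
        then obtain w where "nb a' = {v, w}" "v \<noteq> w" using nb2[OF h(3)] by blast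
        then have "arm2 b' v a' w" using h by (auto simp: arm2_def)
        then show ?thesis by (rule arm2_deg)
      qed
      have "2 \<le> pay a v + pay b v"
      proof (cases "deg a = D \<or> deg b = D")
        case D: True
        then show ?thesis
          using nonneg[of a v] nonneg[of b v] True assms by (auto simp: pay_def)
      next
        case False
        have "2 \<le> deg a" "2 \<le> deg b" using va nb_V deg_ge2 by blast+
        moreover have "deg a \<noteq> 2" "deg b \<noteq> 2"
          using big[of a b] big[of b a] ab False by (auto simp: insert_commute)
        ultimately show ?thesis using True False ab by (auto simp: pay_def)
      qed
      moreover have "pay v m = 0" for m using True by (simp add: pay_def)
      ultimately show ?thesis using ab True by simp
    next
      case False
      then have 3: "3 \<le> deg v" using deg_ge2[OF v] by simp
      have in0: "0 \<le> (\<Sum>m \<in> nb v. pay m v)" by (intro sum_nonneg nonneg)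
      consider "deg v = D" | "4 \<le> deg v" "deg v \<noteq> D" | "deg v = 3" "deg v \<noteq> D"
        using 3 by linarith
      then have "(\<Sum>m \<in> nb v. pay v m) \<le> 4 * int (deg v) - 10"
      proof cases
        case 1
        have "(\<Sum>m \<in> nb v. pay v m) \<le> of_nat (deg v) * 2"
          by (intro sum_bounded_above) (simp add: pay_def)
        then show ?thesis using 1 assms by simp
      next
        case 2
        have "(\<Sum>m \<in> nb v. pay v m) \<le> of_nat (deg v) * 1"
          using 2 by (intro sum_bounded_above) (simp add: pay_def)
        then show ?thesis using 2 by simp
      next
        case 3
        then obtain x y z where nbv: "nb v = {x, y, z}" "distinct [x, y, z]"
          by (auto simp: card_3_iff)
        have le1: "pay v m \<le> 1" for m using 3 by (simp add: pay_def)
        have "\<not> (pay v x = 1 \<and> pay v y = 1 \<and> pay v z = 1)"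
        proof
          assume p: "pay v x = 1 \<and> pay v y = 1 \<and> pay v z = 1"
          then have d: "deg x = 2" "deg y = 2" "deg z = 2"
            by (auto simp: pay_def split: if_splits)
          have arm: "\<exists>x'. arm1 v x x'" if "x \<in> nb v" "deg x = 2" for x
            using nb2[OF that(2) nb_sym[OF that(1)]] by (auto simp: arm1_def)
          obtain x' y' z' where a: "arm1 v x x'" "arm1 v y y'" "arm1 v z z'"
            using arm[of x] arm[of y] arm[of z] nbv d by auto
          have "deg x' = D" by (rule bad_vertex_ends[OF assms nbv a])
          then show False using p a(1) 3 by (auto simp: pay_def arm1_def split: if_splits)
        qed
        then have "pay v x + pay v y + pay v z \<le> 2"
          using le1[of x] le1[of y] le1[of z] by linarith
        then show ?thesis using nbv 3 by simp
      qed
      then show ?thesis using in0 by simp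
    qed
    then show "(\<Sum>m \<in> nb v. pay v m + (\<Sum>b \<in> nb m - {v}. if deg m = 2 then 0 else 0))
      \<le> 4 * int (deg v) - 10 +
        (\<Sum>m \<in> nb v. pay m v + (\<Sum>b \<in> nb m - {v}. if deg m = 2 then 0 else 0))"
      by simp
  qed
qed

section \<open>Maximum degree 4\<close>

definition bad :: "'a \<Rightarrow> bool" where
  "bad u \<longleftrightarrow> deg u = 3 \<and> (\<forall>x \<in> nb u. deg x = 2)"

text \<open>At most one end has degree 4, so the payments of 3 cannot cover the deficit of 6; ends
  of degree 3 have to contribute 2 each.\<close>

definition needy :: "'a \<Rightarrow> bool" where
  "needy u \<longleftrightarrow> bad u \<and> (\<exists>x x' y y'. x \<noteq> y \<and> arm1 u x x' \<and> arm1 u y y' \<and>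
     x \<in> nb u \<and> y \<in> nb u \<and> deg x' = 3 \<and> deg y' = 3)"

text \<open>Here \<open>m\<close>, of degree 3, may have to support a needy vertex in each of its
  two other directions, so a neighbour of degree 4 gives it 4 instead of 2.\<close>

definition two_3_ends :: "'a \<Rightarrow> 'a \<Rightarrow> bool" where
  "two_3_ends v m \<longleftrightarrow> (\<exists>x u r r'. nb m = {v, x, r} \<and> distinct [v, x, r] \<and>
     arm1 m x u \<and> arm1 m r r' \<and> deg u = 3 \<and> deg r' = 3)"

text \<open>The scaled charges of degrees 2, 3, 4 are -12, 12, 36. A vertex of degree 2 gets 6 from
  either side, or all 12 from one side if its other neighbour also has degree 2. The payments of 2
  and 4 to degree 3 refund what is passed on by \<open>far\<close>.\<close>

definition pay :: "'a \<Rightarrow> 'a \<Rightarrow> int" where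
  "pay v m =
    (if deg m = 2 \<and> 3 \<le> deg v then if \<exists>q \<in> nb m - {v}. deg q = 2 then 12 else 6
     else if deg m = 3 \<and> deg v = 4 then if two_3_ends v m then 4 else 2
     else 0)"

text \<open>A bad vertex has 12 and pays 18. The missing 6 arrives as 3 + 3, 3 + 2 + 2 or 2 + 2 + 2.
  A payment of 2 from degree 4 to a vertex that is not bad refunds one such contribution.\<close>

definition far :: "'a \<Rightarrow> 'a \<Rightarrow> int" where
  "far v b =
    (if deg v = 4 \<and> deg b = 3 then if bad b then 3 else 2
     else if deg v = 3 \<and> \<not> bad v \<and> needy b then 2
     else 0)"

definition spent :: "'a \<Rightarrow> 'a \<Rightarrow> int" where
  "spent v m = pay v m + (\<Sum>b \<in> nb m - {v}. if deg m = 2 then far v b else 0)"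

definition earned :: "'a \<Rightarrow> 'a \<Rightarrow> int" where
  "earned v m = pay m v + (\<Sum>b \<in> nb m - {v}. if deg m = 2 then far b v else 0)"

lemma pay_nonneg: "0 \<le> pay v m" and far_nonneg: "0 \<le> far v b"
  by (simp_all add: pay_def far_def)

lemma earned_nonneg: "0 \<le> earned v m"
  unfolding earned_def by (intro add_nonneg_nonneg pay_nonneg sum_nonneg) (simp add: far_nonneg)

lemma arm1_sum:
  assumes "arm1 v m b"
  shows "spent v m = pay v m + far v b" "earned v m = pay m v + far b v" "deg m = 2"
proof -
  have "nb m - {v} = {b}" "deg m = 2" using assms by (auto simp: arm1_def)
  then show "spent v m = pay v m + far v b" "earned v m = pay m v + far b v" "deg m = 2"
    by (simp_all add: spent_def earned_def)
qed

lemma not_2_sum: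
  assumes "deg m \<noteq> 2"
  shows "spent v m = pay v m" "earned v m = pay m v"
  using assms by (simp_all add: spent_def earned_def)

lemma pay_arm1:
  assumes "arm1 v m b" "3 \<le> deg v" "3 \<le> deg b"
  shows "pay v m = 6"
  using assms arm1_sum(3)[OF assms(1)] by (auto simp: pay_def arm1_def)

lemma needy_needs:
  assumes "needy u"
  shows "bad u" "deg u = 3"
  using assms by (auto simp: needy_def bad_def)

lemma bad_arms:
  assumes "D = 4" "bad u" "x \<in> nb u"
  obtains y z x' y' z' where "nb u = {x, y, z}" "distinct [x, y, z]"
    "arm1 u x x'" "arm1 u y y'" "arm1 u z z'" "3 \<le> deg x'" "3 \<le> deg y'" "3 \<le> deg z'"
proof -
  have u: "deg u = 3" using assms(2) by (simp add: bad_def)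
  obtain y z where yz: "nb u = {x, y, z}" "distinct [x, y, z]" using nb3[OF u assms(3)] .
  have "\<exists>m'. arm1 u m m' \<and> 3 \<le> deg m'" if "m \<in> nb u" for m
    using that
  proof (cases rule: edge_cases)
    case (two q w)
    then show ?thesis using arm2_deg[OF two(3)] u assms(1) by simp
  next
    case zero
    then show ?thesis using assms(2) that by (auto simp: bad_def)
  qed blast
  then show ?thesis using that yz by (metis insertCI)
qed

lemma needy_other_end:
  assumes "D = 4" "needy u" "arm1 u x v" "x \<in> nb u"
  obtains y z y' z' where "nb u = {x, y, z}" "distinct [x, y, z]"
    "arm1 u y y'" "arm1 u z z'" "deg y' = 3"
proof -
  obtain y y' where y: "y \<noteq> x" "arm1 u y y'" "y \<in> nb u" "deg y' = 3"
    using assms(2) unfolding needy_def by metis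
  obtain a b a' b' where ab: "nb u = {x, a, b}" "distinct [x, a, b]" "arm1 u a a'" "arm1 u b b'"
    using bad_arms[OF assms(1) needy_needs(1)[OF assms(2)] assms(4)] by metis
  then consider "y = a" | "y = b" using y by auto
  then show ?thesis
  proof cases
    case 1
    then show ?thesis using that[of a b y' b'] ab y by auto
  next
    case 2
    then show ?thesis using that[of b a y' a'] ab y by (auto simp: insert_commute)
  qed
qed

lemma charge_2:
  assumes "D = 4" "v \<in> V" "deg v = 2"
  shows "(\<Sum>m \<in> nb v. spent v m) \<le> 12 * (2 * int (deg v) - 5) + (\<Sum>m \<in> nb v. earned v m)"
proof -
  obtain a b where ab: "nb v = {a, b}" "a \<noteq> b" using assms(3) by (auto simp: card_2_iff)
  have va: "v \<in> nb a" "v \<in> nb b" using ab nb_sym by auto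
  have "spent v m = 0" for m
  proof -
    have "far v b = 0" for b using assms(3) by (simp add: far_def)
    then show ?thesis using assms(3) by (auto simp: spent_def pay_def split: if_splits intro!: sum.neutral)
  qed
  then have "(\<Sum>m \<in> nb v. spent v m) = 0" by simp
  moreover have ge: "pay m v \<le> earned v m" for m
    unfolding earned_def by (simp add: far_nonneg sum_nonneg)
  moreover have "12 \<le> pay a v + pay b v"
  proof -
    have big: "pay b' v = 12" if h: "nb v = {a', b'}" "a' \<noteq> b'" "deg a' = 2" for a' b'
    proof -
      have "v \<in> nb a'" using h nb_sym by auto
      then obtain w where "nb a' = {v, w}" "v \<noteq> w" using nb2[OF h(3)] by blast
      then have "arm2 b' v a' w" using h by (auto simp: arm2_def)
      then have "deg b' = 4" using arm2_deg assms(1) by simp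
      then show ?thesis using h assms(3) by (auto simp: pay_def)
    qed
    have "2 \<le> deg a" "2 \<le> deg b" using va nb_V deg_ge2 by blast+
    then consider "deg a = 2" | "deg b = 2" | "3 \<le> deg a" "3 \<le> deg b" by linarith
    then show ?thesis
    proof cases
      case 1
      then show ?thesis using big[of a b] ab pay_nonneg[of a v] by simp
    next
      case 2
      then show ?thesis using big[of b a] ab pay_nonneg[of b v] by (simp add: insert_commute)
    next
      case 3
      then show ?thesis using ab assms(3) by (auto simp: pay_def)
    qed
  qed
  moreover have "(\<Sum>m \<in> nb v. earned v m) = earned v a + earned v b"
    using ab by simp
  moreover have "12 * (2 * int (deg v) - 5) = -12" using assms(3) by simp
  ultimately show ?thesis using ge[of a] ge[of b] by linarith
qed

lemma charge_3_bad:
  assumes "D = 4" "bad v"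
  shows "(\<Sum>m \<in> nb v. spent v m) \<le> 12 * (2 * int (deg v) - 5) + (\<Sum>m \<in> nb v. earned v m)"
proof -
  have v: "deg v = 3" using assms(2) by (simp add: bad_def)
  then have "nb v \<noteq> {}" by auto
  then obtain x where x: "x \<in> nb v" by blast
  obtain y z x' y' z' where nbv: "nb v = {x, y, z}" "distinct [x, y, z]"
    and arms: "arm1 v x x'" "arm1 v y y'" "arm1 v z z'"
    and ends: "3 \<le> deg x'" "3 \<le> deg y'" "3 \<le> deg z'"
    using bad_arms[OF assms x] .
  have sp: "spent v m = 6" if "arm1 v m b" "3 \<le> deg b" for m b
    using arm1_sum[OF that(1)] pay_arm1[OF that(1)] that v assms by (simp add: far_def)
  have ea: "far b v \<le> earned v m" if "arm1 v m b" for m b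
    using arm1_sum[OF that] pay_nonneg by simp
  have end4: "deg b = 3 \<or> deg b = 4" if "3 \<le> deg b" for b
    using that deg_le[of b] assms(1) by linarith
  have far4: "far b v = 3" if "deg b = 4" for b using that v assms by (simp add: far_def)
  \<comment> \<open>An end of degree 3 contributes only if it is not bad itself; this is guaranteed
    as soon as another end has degree 3.\<close>
  have not_bad: "\<not> bad a'"
    if "nb v = {a, b, c}" "distinct [a, b, c]" "arm1 v a a'" "arm1 v b b'" "arm1 v c c'" "deg b' = 3"
    for a b c a' b' c'
  proof
    assume "bad a'"
    moreover have "a \<in> nb a'" using that(3) nb_sym by (auto simp: arm1_def)
    ultimately obtain r s r' s' where rs: "nb a' = {a, r, s}" "distinct [a, r, s]"
      "arm1 a' r r'" "arm1 a' s s'"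
      using bad_arms[OF assms(1)] by metis
    show False
      by (rule no_bad_end_of_bad_vertex[OF assms(1) that(1-5) rs]) (simp add: that(6))
  qed
  have far3: "far a' v = 2"
    if "nb v = {a, b, c}" "distinct [a, b, c]" "arm1 v a a'" "arm1 v b b'" "arm1 v c c'" "deg b' = 3"
      "deg a' = 3" for a b c a' b' c'
  proof -
    have "a \<noteq> b" "a \<in> nb v" "b \<in> nb v" using that(1,2) by auto
    then have "needy v" unfolding needy_def
      using that(3,4,6,7) assms(2) by blast
    then show ?thesis using not_bad[OF that(1-6)] that v by (simp add: far_def)
  qed
  have two: "4 \<le> far a' v + far b' v"
    if "nb v = {a, b, c}" "distinct [a, b, c]" "arm1 v a a'" "arm1 v b b'" "arm1 v c c'" "deg b' = 3"
      "deg a' = 3" for a b c a' b' c'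
  proof -
    have "nb v = {b, a, c}" "distinct [b, a, c]" using that by auto
    then show ?thesis using far3[OF that] far3[of b a c b' a' c'] that by simp
  qed
  have "6 \<le> far x' v + far y' v + far z' v"
  proof -
    have n: "nb v = {x, z, y}" "distinct [x, z, y]" "nb v = {y, z, x}" "distinct [y, z, x]"
      "nb v = {z, x, y}" "distinct [z, x, y]"
      using nbv by auto
    note nn = far_nonneg[of x' v] far_nonneg[of y' v] far_nonneg[of z' v]
    note e = end4[OF ends(1)] end4[OF ends(2)] end4[OF ends(3)]
    from e consider "deg x' = 4" "deg y' = 4" | "deg x' = 4" "deg z' = 4" | "deg y' = 4" "deg z' = 4"
      | "deg x' = 3" "deg y' = 3" | "deg x' = 3" "deg z' = 3" "deg y' = 4"
      | "deg y' = 3" "deg z' = 3" "deg x' = 4" by blast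
    then show ?thesis
    proof cases
      case 1
      show ?thesis using far4[OF 1(1)] far4[OF 1(2)] nn by linarith
    next
      case 2
      show ?thesis using far4[OF 2(1)] far4[OF 2(2)] nn by linarith
    next
      case 3
      show ?thesis using far4[OF 3(1)] far4[OF 3(2)] nn by linarith
    next
      case 4
      have "2 \<le> far z' v"
        using e(3) far4[of z'] far3[OF n(5,6) arms(3,1,2)] 4 by force
      then show ?thesis using two[OF nbv arms 4(2,1)] by linarith
    next
      case 5
      show ?thesis using two[OF n(1,2) arms(1,3,2) 5(2,1)] far4[OF 5(3)] by linarith
    next
      case 6
      show ?thesis using two[OF n(3,4) arms(2,3,1) 6(2,1)] far4[OF 6(3)] by linarith
    qed
  qed
  moreover have "(\<Sum>m \<in> nb v. spent v m) = 18"
    using nbv sp[OF arms(1) ends(1)] sp[OF arms(2) ends(2)] sp[OF arms(3) ends(3)] by simp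
  moreover have "(\<Sum>m \<in> nb v. earned v m) = earned v x + earned v y + earned v z"
    using nbv by simp
  ultimately show ?thesis
    using ea[OF arms(1)] ea[OF arms(2)] ea[OF arms(3)] v by simp
qed

text \<open>The charge 12 covers at most two neighbours of degree 2; what goes to needy vertices
  must come back. If one end is needy, the other end or \<open>m0\<close> has degree 4 and refunds
  2. If both are needy, both have degree 3, so \<open>m0\<close> has degree 4 and pays 4.\<close>

lemma charge_3:
  assumes "D = 4" "deg v = 3" "\<not> bad v"
  shows "(\<Sum>m \<in> nb v. spent v m) \<le> 12 * (2 * int (deg v) - 5) + (\<Sum>m \<in> nb v. earned v m)"
proof -
  obtain m0 where m0: "m0 \<in> nb v" "deg m0 \<noteq> 2" using assms by (auto simp: bad_def)
  then have m0_3: "3 \<le> deg m0" using deg_ge2[of m0] nb_V'[of m0 v] by simp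
  obtain x r where nbv: "nb v = {m0, x, r}" "distinct [m0, x, r]" using nb3[OF assms(2) m0(1)] .
  have sp0: "spent v m = 0" if "3 \<le> deg m" for m
    using not_2_sum[of m v] that assms(2) by (simp add: pay_def)
  have far2: "far v b \<le> 2" for b using assms by (simp add: far_def)
  have sp1: "spent v m = 6 + far v b" if "arm1 v m b" "3 \<le> deg b" for m b
    using arm1_sum[OF that(1)] pay_arm1[OF that(1)] that assms by simp
  have cases: "3 \<le> deg m \<or> (\<exists>b. arm1 v m b \<and> 3 \<le> deg b)" if "m \<in> nb v" for m
    using that
  proof (cases rule: edge_cases)
    case (two q w)
    then show ?thesis using arm2_deg[OF two(3)] assms by simp
  qed auto
  have sp8: "spent v m \<le> 8" if "m \<in> nb v" for m
    using cases[OF that] sp0[of m] sp1[of m] far2 by fastforce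
  have spent: "(\<Sum>m \<in> nb v. spent v m) = spent v x + spent v r"
    using nbv sp0[OF m0_3] by simp
  have earned: "(\<Sum>m \<in> nb v. earned v m) = pay m0 v + earned v x + earned v r"
    using nbv not_2_sum(2)[of m0 v] m0_3 by simp
  have xr: "x \<in> nb v" "r \<in> nb v" using nbv by auto
  show ?thesis
  proof (cases "3 \<le> deg x \<or> 3 \<le> deg r")
    case True
    then have "spent v x + spent v r \<le> 12"
      using sp0[of x] sp0[of r] sp8[OF xr(1)] sp8[OF xr(2)] by auto
    then show ?thesis
      using spent earned earned_nonneg[of v x] earned_nonneg[of v r] pay_nonneg[of m0 v] assms(2)
      by simp
  next
    case False
    then obtain u r' where arms: "arm1 v x u" "3 \<le> deg u" "arm1 v r r'" "3 \<le> deg r'"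
      using cases xr by blast
    have ea: "earned v m = far b v" if "arm1 v m b" for m b
      using arm1_sum[OF that] assms(2) by (simp add: pay_def)
    have key: "deg r' = 4 \<or> deg m0 = 4"
      if h: "needy u" "arm1 v x u" "arm1 v r r'" "nb v = {m0, x, r}" "distinct [m0, x, r]" for x r u r'
    proof (rule ccontr)
      assume "\<not> ?thesis"
      then have le: "deg r' \<le> 3" "deg m0 \<le> 3"
        using deg_le[of r'] deg_le[of m0] assms(1) by auto
      have xu: "arm1 u x v" "x \<in> nb u" using h(2) nb_sym by (auto simp: arm1_def insert_commute)
      obtain y z y' z' where yz: "nb u = {x, y, z}" "distinct [x, y, z]"
        "arm1 u y y'" "arm1 u z z'" "deg y' = 3"
        using needy_other_end[OF assms(1) h(1) xu] .
      have n: "nb v = {x, r, m0}" "distinct [x, r, m0]" using h by auto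
      show False
        by (rule no_two_3_ends_of_bad_vertex[OF assms(1) yz(1,2) xu(1) yz(3,4) n h(3)])
          (use le yz in auto)
    qed
    have nbv': "nb v = {m0, r, x}" "distinct [m0, r, x]" using nbv by auto
    have m4: "2 \<le> pay m0 v" "deg u = 3 \<Longrightarrow> deg r' = 3 \<Longrightarrow> pay m0 v = 4" if "deg m0 = 4"
      using that assms(2) nbv arms by (auto simp: pay_def two_3_ends_def)
    have far0: "far v b = 0" if "\<not> needy b" for b using that assms(2) by (simp add: far_def)
    have bak: "far b v = 2" if "deg b = 4" for b using that assms by (simp add: far_def)
    have four: "\<not> needy b" if "deg b = 4" for b using that by (auto simp: needy_def bad_def)
    have "far v u + far v r' \<le> pay m0 v + far u v + far r' v"
    proof (cases "deg m0 = 4")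
      case True
      then show ?thesis
        using m4[OF True] far0[of u] far0[of r'] far2[of u] far2[of r'] needy_needs(2)[of u]
          needy_needs(2)[of r'] far_nonneg[of u v] far_nonneg[of r' v]
        by (cases "needy u"; cases "needy r'") auto
    next
      case False
      have "deg r' = 4" if "needy u" using key[OF that arms(1,3) nbv] False by blast
      moreover have "deg u = 4" if "needy r'" using key[OF that arms(3,1) nbv'] False by blast
      ultimately show ?thesis
        using far0[of u] far0[of r'] far2[of u] far2[of r'] bak[of u] bak[of r'] four[of u]
          four[of r'] far_nonneg[of u v] far_nonneg[of r' v] pay_nonneg[of m0 v]
        by (cases "needy u"; cases "needy r'") auto
    qed
    then show ?thesis
      using spent earned sp1[OF arms(1,2)] sp1[OF arms(3,4)] ea[OF arms(1)] ea[OF arms(3)] assms(2)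
      by simp
  qed
qed


lemma arm2_spent:
  assumes "deg v = 4" "arm2 v m q w"
  shows "spent v m = 12"
proof -
  have nm: "nb m - {v} = {q}" "deg m = 2" "deg q = 2"
    using assms(2) by (auto simp: arm2_def)
  have "pay v m = 12" unfolding pay_def nm(1) using nm assms(1) by simp
  moreover have "far v q = 0" using nm assms(1) by (simp add: far_def)
  ultimately show ?thesis unfolding spent_def nm(1) by simp
qed

lemma edge_cases_4:
  assumes "D = 4" "deg v = 4" "m \<in> nb v"
  obtains (two) q w where "arm2 v m q w" "spent v m = 12"
    | (one4) b where "arm1 v m b" "deg b = 4" "spent v m = 6"
    | (one3) b where "arm1 v m b" "deg b = 3" "spent v m = (if bad b then 9 else 8)"
    | (zero3) "deg m = 3" "spent v m = (if two_3_ends v m then 4 else 2)"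
    | (zero4) "spent v m = 0"
  using assms(3)
proof (cases rule: edge_cases)
  case t: (two q w)
  then show ?thesis using two arm2_spent[OF assms(2)] by blast
next
  case o: (one b)
  have s: "spent v m = 6 + far v b"
    using arm1_sum(1)[OF o(2)] pay_arm1[OF o(2) _ o(3)] assms by simp
  have "deg b = 3 \<or> deg b = 4" using o deg_le[of b] assms(1) by linarith
  then show ?thesis
  proof
    assume b: "deg b = 3"
    have "far v b = (if bad b then 3 else 2)" using b assms by (simp add: far_def)
    then have "spent v m = (if bad b then 9 else 8)" using s by simp
    then show ?thesis using one3 o b by blast
  next
    assume b: "deg b = 4"
    then have "spent v m = 6" using s assms by (simp add: far_def)
    then show ?thesis using one4 o b by blast
  qed
next
  case z: zero
  have "deg m = 3 \<or> deg m = 4" using z deg_le[of m] assms(1) by linarith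
  moreover have "spent v m = pay v m" using not_2_sum(1)[of m v] z by simp
  ultimately show ?thesis using zero3 zero4 assms by (auto simp: pay_def)
qed

text \<open>Each chain of two costs 12. Three chains leave nothing, and nothing more is spent. Two
  chains leave 12, against 6 + 6 or 9 + 2 at most. One chain leaves 24, against 6 + 9 + 9 or 8 + 8 +
  8. Without chains four times 9 is affordable.\<close>

lemma charge_4:
  assumes "D = 4" "deg v = 4"
  shows "(\<Sum>m \<in> nb v. spent v m) \<le> 36"
proof -
  define P where "P = {m \<in> nb v. \<exists>q w. arm2 v m q w}"
  note cases = edge_cases_4[OF assms, consumes 1, case_names two one4 one3 zero3 zero4]
  have le: "spent v m \<le> 9" if "m \<in> nb v" "m \<notin> P" for m
    using that(1) by (cases rule: cases) (use that in \<open>auto simp: P_def\<close>)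
  have twoP: "\<exists>q w. arm2 v m q w" "spent v m = 12" if "m \<in> P" for m
    using that arm2_spent[OF assms(2)] by (auto simp: P_def)
  have fin: "finite P" "P \<subseteq> nb v" by (auto simp: P_def)
  have rest: "card (nb v - P) + card P = 4"
    using card_Diff_subset[OF fin] card_mono[of "nb v" P] fin assms by simp
  have S: "(\<Sum>m \<in> nb v. spent v m) = (\<Sum>m \<in> nb v - P. spent v m) + 12 * int (card P)"
    using sum.subset_diff[OF fin(2), of "spent v"] twoP(2) by simp
  have "card P \<le> 4" using rest by simp
  then consider "card P \<ge> 3" | "card P = 2" | "card P = 1" | "card P = 0" by linarith
  then show ?thesis
  proof cases
    case 1
    then obtain R where "R \<subseteq> P" "card R = 3" using obtain_subset_with_card_n by metis
    then obtain p1 p2 p3 where p: "{p1, p2, p3} \<subseteq> P" "distinct [p1, p2, p3]"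
      by (auto simp: card_3_iff)
    have "card (nb v - {p1, p2, p3}) = 1"
      using p fin assms by (subst card_Diff_subset) auto
    then obtain m where m: "nb v - {p1, p2, p3} = {m}" by (auto simp: card_1_singleton_iff)
    then have nbv: "nb v = {p1, p2, p3, m}" "distinct [p1, p2, p3, m]"
      using p fin by auto
    obtain q1 w1 q2 w2 q3 w3 where arms: "arm2 v p1 q1 w1" "arm2 v p2 q2 w2" "arm2 v p3 q3 w3"
      using twoP(1)[of p1] twoP(1)[of p2] twoP(1)[of p3] p by auto
    have "m \<in> nb v" using nbv by simp
    then have "spent v m = 0"
    proof (cases rule: cases)
      case (two q w)
      then show ?thesis using no_2222[OF assms(1) nbv arms] by blast
    next
      case (one4 b)
      then show ?thesis using no_2221[OF assms(1) nbv arms] by blast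
    next
      case (one3 b)
      then show ?thesis using no_2221[OF assms(1) nbv arms] by blast
    next
      case zero3
      then show ?thesis using no_2220[OF assms(1) nbv arms] by simp
    qed
    then show ?thesis using nbv twoP(2)[of p1] twoP(2)[of p2] twoP(2)[of p3] p by simp
  next
    case 2
    then obtain p1 p2 where p: "P = {p1, p2}" "p1 \<noteq> p2" by (auto simp: card_2_iff)
    have "card (nb v - P) = 2" using rest 2 by simp
    then obtain m n where mn: "nb v - P = {m, n}" "m \<noteq> n" by (auto simp: card_2_iff)
    obtain q1 w1 q2 w2 where arms: "arm2 v p1 q1 w1" "arm2 v p2 q2 w2"
      using twoP(1)[of p1] twoP(1)[of p2] p by auto
    have nbv: "nb v = {p1, p2, m, n}" "distinct [p1, p2, m, n]"
      "nb v = {p1, p2, n, m}" "distinct [p1, p2, n, m]"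
      using p mn fin by auto
    have notP: "\<not> arm2 v m q w" "\<not> arm2 v n q w" for q w
      using mn by (auto simp: P_def)
    have *: "spent v m + spent v n \<le> 12"
      if nbv: "nb v = {p1, p2, m, n}" "distinct [p1, p2, m, n]"
        and notP: "\<And>q w. \<not> arm2 v m q w" "\<And>q w. \<not> arm2 v n q w"
        and m: "arm1 v m b" "deg b = 3" "spent v m = (if bad b then 9 else 8)"
      for m n b
    proof -
      have "n \<in> nb v" using nbv by simp
      then show ?thesis
      proof (cases rule: cases)
        case (two q w)
        then show ?thesis using notP by blast
      next
        case (one4 t)
        then show ?thesis using no_2211[OF assms(1) nbv arms m(1) one4(1)] m(2) by simp
      next
        case (one3 t)
        then show ?thesis using no_2211[OF assms(1) nbv arms m(1) one3(1)] m(2) by simp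
      next
        case zero3
        have "\<not> two_3_ends v n"
        proof
          assume "two_3_ends v n"
          then obtain x u r r' where t: "nb n = {v, x, r}" "distinct [v, x, r]" "arm1 n x u"
            "arm1 n r r'" "deg u = 3" "deg r' = 3" by (auto simp: two_3_ends_def)
          show False
            by (rule no_2210[OF assms(1) nbv arms m(1) t(1-4)]) (use m t in simp_all)
        qed
        then show ?thesis using zero3 m(3) by simp
      next
        case zero4
        then show ?thesis using m(3) by simp
      qed
    qed
    have m: "m \<in> nb v" and n: "n \<in> nb v" using mn by auto
    have small: "(\<exists>b. arm1 v m b \<and> deg b = 3 \<and> spent v m = (if bad b then 9 else 8)) \<or> spent v m \<le> 6"
      if "m \<in> nb v" "\<And>q w. \<not> arm2 v m q w" for m
      using that(1) by (cases rule: cases) (use that(2) in auto)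
    have "spent v m + spent v n \<le> 12"
      using small[OF m notP(1)] small[OF n notP(2)] *[OF nbv(1,2) notP] *[OF nbv(3,4) notP(2,1)]
      by fastforce
    then show ?thesis using S mn 2 by simp
  next
    case 3
    then obtain p where p: "P = {p}" by (auto simp: card_1_singleton_iff)
    have "card (nb v - P) = 3" using rest 3 by simp
    then obtain a b c where abc: "nb v - P = {a, b, c}" "distinct [a, b, c]"
      by (auto simp: card_3_iff)
    have nb9: "spent v a \<le> 9" "spent v b \<le> 9" "spent v c \<le> 9"
      using le[of a] le[of b] le[of c] abc by blast+
    obtain q w where arm: "arm2 v p q w" using twoP(1)[of p] p by auto
    have nbv: "nb v = {p, a, b, c}" "distinct [p, a, b, c]" "nb v = {p, b, a, c}"
      "distinct [p, b, a, c]" "nb v = {p, c, a, b}" "distinct [p, c, a, b]"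
      using p abc fin by auto
    have notP: "\<not> arm2 v a q w" "\<not> arm2 v b q w" "\<not> arm2 v c q w" for q w
      using abc by (auto simp: P_def)
    have small: "(\<exists>b. arm1 v m b \<and> deg b = 3 \<and> spent v m = (if bad b then 9 else 8)) \<or> spent v m \<le> 6"
      if "m \<in> nb v" "\<And>q w. \<not> arm2 v m q w" for m
      using that(1) by (cases rule: cases) (use that(2) in auto)
    have 8: "spent v s1 = 8"
      if "nb v = {p, s1, s2, s3}" "distinct [p, s1, s2, s3]" "arm1 v s1 t1" "arm1 v s2 t2"
        "arm1 v s3 t3" "deg t1 = 3" "deg t2 = 3" "deg t3 = 3"
        "spent v s1 = (if bad t1 then 9 else 8)" for s1 s2 s3 t1 t2 t3
    proof -
      have "\<not> bad t1"
      proof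
        assume "bad t1"
        moreover have "s1 \<in> nb t1" using that(3) nb_sym by (auto simp: arm1_def)
        ultimately obtain y z y' z' where t: "nb t1 = {s1, y, z}" "distinct [s1, y, z]"
          "arm1 t1 y y'" "arm1 t1 z z'" using bad_arms[OF assms(1)] by metis
        show False
          by (rule no_bad_end_2111[OF assms(1) that(1,2) arm that(3-5) _ _ t])
            (simp_all add: that)
      qed
      then show ?thesis using that by simp
    qed
    have m: "a \<in> nb v" "b \<in> nb v" "c \<in> nb v" using abc by auto
    have "spent v a + spent v b + spent v c \<le> 24"
    proof (cases "spent v a \<le> 6 \<or> spent v b \<le> 6 \<or> spent v c \<le> 6")
      case True
      then show ?thesis using nb9 by linarith
    next
      case False
      then obtain ta tb tc where t: "arm1 v a ta" "deg ta = 3" "spent v a = (if bad ta then 9 else 8)"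
        "arm1 v b tb" "deg tb = 3" "spent v b = (if bad tb then 9 else 8)"
        "arm1 v c tc" "deg tc = 3" "spent v c = (if bad tc then 9 else 8)"
        using small[OF m(1) notP(1)] small[OF m(2) notP(2)] small[OF m(3) notP(3)] by auto
      show ?thesis
        using 8[OF nbv(1,2) t(1,4,7,2,5,8,3)] 8[OF nbv(3,4) t(4,1,7,5,2,8,6)]
          8[OF nbv(5,6) t(7,1,4,8,2,5,9)] by linarith
    qed
    then show ?thesis using S abc 3 by simp
  next
    case 4
    then have "P = {}" using fin by simp
    have "(\<Sum>m \<in> nb v. spent v m) \<le> of_nat (card (nb v)) * 9"
      using le \<open>P = {}\<close> by (intro sum_bounded_above) auto
    then show ?thesis using assms by simp
  qed
qed

lemma dense_degree_4:
  assumes "D = 4"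
  shows "0 \<le> (\<Sum>v \<in> V. 12 * (2 * int (deg v) - 5))"
proof (rule discharge[where pay = pay and far = far])
  fix v assume v: "v \<in> V"
  have e: "0 \<le> (\<Sum>m \<in> nb v. earned v m)" by (intro sum_nonneg earned_nonneg)
  have "deg v = 2 \<or> deg v = 3 \<or> deg v = 4"
    using deg_ge2[OF v] deg_le[of v] assms by linarith
  then have "(\<Sum>m \<in> nb v. spent v m) \<le> 12 * (2 * int (deg v) - 5) + (\<Sum>m \<in> nb v. earned v m)"
    using charge_2[OF assms v] charge_3_bad[OF assms, of v] charge_3[OF assms, of v]
      charge_4[OF assms, of v] e by fastforce
  then show "(\<Sum>m \<in> nb v. pay v m + (\<Sum>b \<in> nb m - {v}. if deg m = 2 then far v b else 0))
      \<le> 12 * (2 * int (deg v) - 5) +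
        (\<Sum>m \<in> nb v. pay m v + (\<Sum>b \<in> nb m - {v}. if deg m = 2 then far b v else 0))"
    by (simp only: spent_def earned_def)
qed

lemma dense: "5 * card V \<le> 2 * (\<Sum>v \<in> V. deg v)"
proof -
  have "0 \<le> (\<Sum>v \<in> V. 2 * int (deg v) - 5)"
  proof (cases "D = 4")
    case True
    have "(\<Sum>v \<in> V. 12 * (2 * int (deg v) - 5)) = 12 * (\<Sum>v \<in> V. 2 * int (deg v) - 5)"
      by (rule sum_distrib_left[symmetric])
    then show ?thesis using dense_degree_4[OF True] by linarith
  next
    case False
    then have "0 \<le> (\<Sum>v \<in> V. 2 * (2 * int (deg v) - 5))"
      using dense_large_degree D_ge by (simp add: algebra_simps)
    moreover have "(\<Sum>v \<in> V. 2 * (2 * int (deg v) - 5)) = 2 * (\<Sum>v \<in> V. 2 * int (deg v) - 5)"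
      by (rule sum_distrib_left[symmetric])
    ultimately show ?thesis by linarith
  qed
  then have "int (5 * card V) \<le> int (2 * (\<Sum>v \<in> V. deg v))"
    by (simp add: sum_subtractf sum_distrib_left)
  then show ?thesis by linarith
qed

end

section \<open>Planar graphs of large girth\<close>

context critical
begin

definition edges :: "'a set set" where
  "edges = {{x, y} | x y. y \<in> nb x}"

lemma edge_iff: "{x, y} \<in> edges \<longleftrightarrow> y \<in> nb x"
  using nb_sym by (auto simp: edges_def doubleton_eq_iff)

lemma nbwalk_path_edges: "nbwalk xs \<Longrightarrow> path_edges xs \<subseteq> edges"
  by (induction xs rule: nbwalk.induct) (use nb_sym in \<open>auto simp: edge_iff\<close>)

text \<open>The first return of \<open>x\<close> closes a cycle, of length at least 3 because the
  walk does not backtrack and at most 9 because the repeated vertex is counted once.\<close>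

lemma nbwalk_distinct:
  assumes cyc: "\<And>ys. is_cycle edges ys \<Longrightarrow> 10 \<le> length ys"
    and xs: "nbwalk xs" "length xs \<le> 10"
  shows "distinct xs"
  using xs
proof (induction xs)
  case (Cons x ys)
  have tl: "nbwalk ys" using Cons.prems(1) by (cases ys; cases "tl ys") auto
  have "x \<notin> set ys"
  proof
    assume "x \<in> set ys"
    then obtain as bs where ys: "ys = as @ x # bs" "x \<notin> set as"
      using split_list_first by metis
    show False
    proof (cases as)
      case Nil
      then show ?thesis using Cons.prems(1) nb_irrefl ys by (cases bs) auto
    next
      case (Cons a as')
      have "nbwalk (x # a # as' @ x # bs)" using Cons.prems(1) ys Cons by simp
      then have "as' \<noteq> []" by (cases as') auto
      then have as: "2 \<le> length as" "last (x # as) = last as" using Cons by (cases as'; simp)+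
      have "path_edges ((x # as) @ (x # bs)) \<subseteq> edges"
        using nbwalk_path_edges[OF Cons.prems(1)] ys(1) by (simp only: append_Cons)
      then have "cycle_edges (x # as) \<subseteq> edges"
        unfolding path_edges_append[of "x # as" "x # bs", OF list.simps(3) list.simps(3)]
          cycle_edges_def by auto
      then have "is_cycle edges (x # as)"
        using Cons.IH[OF tl] Cons.prems(2) ys as by (simp add: is_cycle_def)
      from cyc[OF this] show ?thesis using Cons.prems(2) ys by simp
    qed
  qed
  then show ?case using Cons tl by simp
qed simp

lemma handshake: "(\<Sum>v \<in> V. card (nb v)) = 2 * card edges"
proof -
  have sub: "edges \<subseteq> Pow V" using nb_V nb_V' by (auto simp: edges_def)
  then have fin: "finite edges" using finite_V finite_subset by blast
  have two: "card {v \<in> V. v \<in> e} = 2" if e: "e \<in> edges" for e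
  proof -
    obtain x y where "e = {x, y}" "y \<in> nb x" using e by (auto simp: edges_def)
    moreover have "{v \<in> V. v \<in> e} = e" using sub e by blast
    moreover have "x \<noteq> y" using calculation(2) nb_irrefl by blast
    ultimately show ?thesis by simp
  qed
  have "card {e \<in> edges. v \<in> e} = card (nb v)" for v
  proof -
    have "{e \<in> edges. v \<in> e} = (\<lambda>y. {v, y}) ` nb v"
    proof (intro equalityI subsetI)
      fix e assume "e \<in> {e \<in> edges. v \<in> e}"
      then obtain x y where "e = {x, y}" "y \<in> nb x" "v = x \<or> v = y" by (auto simp: edges_def)
      then show "e \<in> (\<lambda>y. {v, y}) ` nb v" using nb_sym[of y x] by auto
    qed (auto simp: edge_iff)
    moreover have "inj_on (\<lambda>y. {v, y}) (nb v)" by (auto simp: inj_on_def doubleton_eq_iff)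
    ultimately show ?thesis by (simp add: card_image)
  qed
  then have "(\<Sum>v \<in> V. card (nb v)) = (\<Sum>v \<in> V. card {e \<in> edges. v \<in> e})" by simp
  also have "\<dots> = (\<Sum>e \<in> edges. 2)"
    using two by (intro sum_multicount_gen finite_V fin) auto
  finally show ?thesis by simp
qed

end

section \<open>From sparseness to colourings\<close>

lemma sparse_imp_colourable:
  fixes V :: "'a set" and nb :: "'a \<Rightarrow> 'a set"
  assumes "finite V" "4 \<le> D"
    and sym: "\<And>x y. y \<in> nb x \<Longrightarrow> x \<in> nb y" and irrefl: "\<And>x. x \<notin> nb x"
    and deg: "\<And>x. x \<in> V \<Longrightarrow> finite (nb x) \<and> card (nb x) \<le> D"
    and girth: "\<And>xs. is_cycle {{x, y} | x y. y \<in> nb x} xs \<Longrightarrow> 10 \<le> length xs"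
    and sparse: "\<And>S. S \<subseteq> V \<Longrightarrow> S \<noteq> {} \<Longrightarrow>
      4 * card {{x, y} | x y. x \<in> S \<and> y \<in> S \<and> y \<in> nb x} < 5 * card S"
  shows "\<exists>c. \<forall>x \<in> V. c x < D + 2 \<and>
    (\<forall>y \<in> V. x \<noteq> y \<longrightarrow> y \<in> nb x \<or> (\<exists>z \<in> V. z \<in> nb x \<and> y \<in> nb z) \<longrightarrow> c x \<noteq> (c y :: nat))"
proof -
  define col where "col S c \<longleftrightarrow> (\<forall>x \<in> S. c x < D + 2 \<and>
    (\<forall>y \<in> S. x \<noteq> y \<longrightarrow> y \<in> nb x \<or> (\<exists>z \<in> S. z \<in> nb x \<and> y \<in> nb z) \<longrightarrow> c x \<noteq> (c y :: nat)))" for S c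
  have "\<exists>c. col S c" if "S \<subseteq> V" for S
    using finite_subset[OF that assms(1)] that
  proof (induction S rule: finite_psubset_induct)
    case (psubset S)
    show ?case
    proof (rule ccontr)
      assume no: "\<nexists>c. col S c"
      then have "S \<noteq> {}" by (auto simp: col_def)
      \<comment> \<open>Emptied outside \<open>S\<close>, so that \<open>nbS\<close> describes the
        induced subgraph in the form required by the locale.\<close>
      define nbS where "nbS x = (if x \<in> S then nb x \<inter> S else {})" for x
      interpret S: critical S nbS D
      proof
        show "card (nbS x) \<le> D" for x
        proof (cases "x \<in> S")
          case True
          then have "finite (nb x)" "card (nb x) \<le> D" using deg psubset.prems by auto
          then show ?thesis
            using True card_mono[of "nb x" "nb x \<inter> S"] by (simp add: nbS_def)
        qed (simp add: nbS_def)
      qed (use psubset.hyps assms(2) sym irrefl in \<open>auto simp: nbS_def split: if_splits\<close>)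
      have E: "S.edges = {{x, y} | x y. x \<in> S \<and> y \<in> S \<and> y \<in> nb x}"
        by (auto simp: S.edges_def nbS_def split: if_splits)
      then have sub: "S.edges \<subseteq> {{x, y} | x y. y \<in> nb x}" by blast
      have cyc: "10 \<le> length ys" if "is_cycle S.edges ys" for ys
        using that sub by (intro girth) (auto simp: is_cycle_def)
      interpret S: minimal_counterexample S nbS D
      proof
        show "distinct xs" if "S.nbwalk xs" "length xs \<le> 10" for xs
          using S.nbwalk_distinct[OF cyc] that by blast
        show "\<not> S.proper S c" for c
        proof
          assume c: "S.proper S c"
          have "col S c"
            unfolding col_def
          proof (intro ballI conjI impI)
            fix x y assume "x \<in> S" "y \<in> S" "x \<noteq> y" "y \<in> nb x \<or> (\<exists>z \<in> S. z \<in> nb x \<and> y \<in> nb z)"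
            then have "y \<in> S.near x" by (auto simp: S.near_iff nbS_def)
            then show "c x \<noteq> c y" using S.properD[OF c] \<open>x \<in> S\<close> \<open>y \<in> S\<close> by blast
          qed (use S.proper_less[OF c] in auto)
          then show False using no by blast
        qed
        show "\<exists>c. \<forall>x \<in> S'. c x < D + 2 \<and>
          (\<forall>y \<in> S'. x \<noteq> y \<longrightarrow> y \<in> nbS x \<or> (\<exists>z \<in> S'. z \<in> nbS x \<and> y \<in> nbS z) \<longrightarrow> c x \<noteq> (c y :: nat))"
          if S': "S' \<subset> S" for S'
        proof -
          obtain c where "col S' c" using psubset.IH[OF S'] psubset.prems S' by blast
          then show ?thesis
            using S' by (intro exI[of _ c]) (auto simp: col_def nbS_def split: if_splits)
        qed
      qed
      have "4 * card S.edges < 5 * card S"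
        unfolding E using psubset.prems \<open>S \<noteq> {}\<close> by (rule sparse)
      then show False using S.dense S.handshake by simp
    qed
  qed
  then show ?thesis unfolding col_def by blast
qed

section \<open>Translation from symmetric digraphs\<close>

lemma plane_drawing_imp_arc_drawing:
  assumes "pair_graph G" "plane_drawing G pos \<gamma>"
  shows "arc_drawing {{u, v} | u v. (u, v) \<in> parcs G} (pverts G) pos (\<lambda>u v. \<gamma> (u, v))"
proof -
  have dr: "arc (\<gamma> (u, v))" "pathstart (\<gamma> (u, v)) = pos u" "pathfinish (\<gamma> (u, v)) = pos v"
    "\<gamma> (v, u) = reversepath (\<gamma> (u, v))" "path_image (\<gamma> (u, v)) \<inter> pos ` pverts G = {pos u, pos v}"
    if "(u, v) \<in> parcs G" for u v
    using assms(2) that by (fastforce simp: plane_drawing_def)+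
  have cr: "path_image (\<gamma> (u, v)) \<inter> path_image (\<gamma> (x, y)) \<subseteq> pos ` pverts G"
    if "(u, v) \<in> parcs G" "(x, y) \<in> parcs G" "{u, v} \<noteq> {x, y}" for u v x y
    using assms(2) that by (fastforce simp: plane_drawing_def)
  have G: "\<And>u v. (u, v) \<in> parcs G \<Longrightarrow> (v, u) \<in> parcs G" "finite (parcs G)"
    "\<And>u v. (u, v) \<in> parcs G \<Longrightarrow> u \<noteq> v \<and> u \<in> pverts G \<and> v \<in> pverts G"
  proof -
    interpret pair_graph G by fact
    show "\<And>u v. (u, v) \<in> parcs G \<Longrightarrow> (v, u) \<in> parcs G" "finite (parcs G)"
      "\<And>u v. (u, v) \<in> parcs G \<Longrightarrow> u \<noteq> v \<and> u \<in> pverts G \<and> v \<in> pverts G"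
      using arcs_symmetric pair_finite_arcs pair_no_loops wellformed' by fastforce+
  qed
  define F where "F = {{u, v} | u v. (u, v) \<in> parcs G}"
  have adj: "(u, v) \<in> parcs G" if "{u, v} \<in> F" for u v
    using that G(1) by (auto simp: F_def doubleton_eq_iff)
  have "arc_drawing F (pverts G) pos (\<lambda>u v. \<gamma> (u, v))"
  proof
    have "F = (\<lambda>(u, v). {u, v}) ` parcs G" by (auto simp: F_def)
    then show "finite F" using G(2) by simp
    show "\<exists>u v. u \<noteq> v \<and> u \<in> pverts G \<and> v \<in> pverts G \<and> e = {u, v}" if "e \<in> F" for e
      using that G(3) by (force simp: F_def)
    show "inj_on pos (pverts G)" using assms(2) by (simp add: plane_drawing_def)
    fix u v assume uv: "{u, v} \<in> F"
    note dr' = dr[OF adj[OF uv]]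
    show "arc (\<gamma> (u, v))" "pathstart (\<gamma> (u, v)) = pos u" "pathfinish (\<gamma> (u, v)) = pos v"
      "\<gamma> (v, u) = reversepath (\<gamma> (u, v))" "path_image (\<gamma> (u, v)) \<inter> pos ` pverts G = {pos u, pos v}"
      by (fact dr')+
    show "path_image (\<gamma> (u, v)) \<inter> path_image (\<gamma> (x, y)) \<subseteq> pos ` pverts G"
      if "{x, y} \<in> F" "{u, v} \<noteq> {x, y}" for x y
      by (rule cr[OF adj[OF uv] adj[OF that(1)] that(2)])
  qed
  then show ?thesis by (simp add: F_def)
qed

lemma girth_le_cycle:
  assumes "pair_graph G" "is_cycle {{u, v} | u v. (u, v) \<in> parcs G} xs"
  shows "girth G \<le> enat (length xs)"
proof -
  interpret pair_graph G by fact
  define F where "F = {{u, v} | u v. (u, v) \<in> parcs G}"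
  have adj: "{u, v} \<in> F \<longleftrightarrow> (u, v) \<in> parcs G" for u v
    using arcs_symmetric by (auto simp: F_def doubleton_eq_iff)
  have F: "is_cycle F xs" using assms(2) by (simp add: F_def)
  obtain x ys where xs: "xs = x # ys" "ys \<noteq> []"
    using assms(2) by (cases xs; cases "tl xs") (auto simp: is_cycle_def)
  \<comment> \<open>The list is closed up by repeating \<open>x\<close>; zipping
    \<open>x # zs\<close> with \<open>zs\<close> then yields the arcs of the closed walk.\<close>
  define zs where "zs = ys @ [x]"
  define p where "p = zip (x # zs) zs"
  have verts: "pawalk_verts a (zip (a # bs) bs) = a # bs" for a :: 'a and bs
    by (induction bs arbitrary: a) auto
  have cas: "pcas a (zip (a # bs) bs) (last (a # bs))" for a :: 'a and bs
    by (induction bs arbitrary: a) auto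
  have arcs: "set (zip (a # bs) bs) \<subseteq> parcs G"
    if "path_edges (a # bs) \<subseteq> F" for a bs
    using that by (induction bs arbitrary: a) (auto simp: adj)
  have "path_edges (x # zs) = cycle_edges xs"
    using path_edges_append[of xs "[x]"] by (simp add: xs zs_def cycle_edges_def)
  then have "set p \<subseteq> parcs G"
    unfolding p_def using F by (intro arcs) (simp add: is_cycle_def)
  moreover have "x \<in> pverts G"
    using calculation wellformed' by (cases ys) (auto simp: p_def zs_def)
  moreover have "pcas x p x"
    using cas[of x zs] by (simp add: p_def zs_def)
  ultimately have "awalk x p x" by (simp add: awalk_def)
  moreover have "distinct (tl (pawalk_verts x p))"
    using assms(2) by (simp add: p_def verts zs_def is_cycle_def xs)
  moreover have len: "length p = length xs" by (simp add: p_def zs_def xs)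
  moreover have "3 \<le> length xs" using assms(2) by (simp add: is_cycle_def)
  ultimately have "cycle p" "3 \<le> length p"
    unfolding cycle_def by auto
  then have "girth G \<le> enat (length p)"
    unfolding girth_def by (intro INF_lower) simp
  then show ?thesis by (simp add: len)
qed

lemma graph_dist_le_2:
  assumes "pair_graph G" "graph_dist G u v \<le> 2" "u \<noteq> v"
  shows "(u, v) \<in> parcs G \<or> (\<exists>w. (u, w) \<in> parcs G \<and> (w, v) \<in> parcs G)"
proof -
  interpret pair_graph G by fact
  \<comment> \<open>Distance is an infimum of walk costs; a strict bound yields an actual walk, and
    integrality of its length brings the 3 back to 2.\<close>
  have "\<mu> (\<lambda>_. 1) u v < 3"
    using assms(2) by (simp add: graph_dist_def order_le_less_trans)
  then obtain p where p: "awalk u p v" "ereal (awalk_cost (\<lambda>_. 1) p) < 3"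
    unfolding \<mu>_def by (auto simp: INF_less_iff)
  have "awalk_cost (\<lambda>_. 1) p = real (length p)"
    by (simp add: awalk_cost_def sum_list_triv)
  then have "length p < 3" using p(2) by simp
  then consider "p = []" | e where "p = [e]" | e f where "p = [e, f]"
    by (cases p; cases "tl p"; cases "tl (tl p)") auto
  then show ?thesis
    using p(1) assms(3) by cases (auto simp: awalk_def)
qed

theorem theorem3:
  fixes G :: "'a pair_pre_digraph"
  assumes "pair_graph G"
    and "planar G"
    and "girth G \<ge> 10"
    and "max_degree G \<ge> 4"
  shows "two_distance_chromatic_number G \<le> max_degree G + 2"
proof -
  interpret pair_graph G by fact
  define nb where "nb x = {y. (x, y) \<in> parcs G}" for x
  define F0 where "F0 = {{u, v} | u v. (u, v) \<in> parcs G}"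
  obtain pos \<gamma> where "plane_drawing G pos \<gamma>"
    using assms(2) by (auto simp: planar_def)
  then interpret dr: arc_drawing F0 "pverts G" pos "\<lambda>u v. \<gamma> (u, v)"
    unfolding F0_def by (rule plane_drawing_imp_arc_drawing[OF assms(1)])
  have cyc: "10 \<le> length xs" if "is_cycle F0 xs" for xs
  proof -
    have "10 \<le> enat (length xs)"
      using order_trans[OF assms(3) girth_le_cycle[OF assms(1) that[unfolded F0_def]]] .
    then show ?thesis by (simp add: numeral_eq_enat)
  qed
  have fin: "finite (nb x)" for x
    using pair_finite_verts wellformed'
    by (intro finite_subset[of "nb x" "pverts G"]) (auto simp: nb_def)
  have deg: "card (nb x) \<le> max_degree G" if "x \<in> pverts G" for x
  proof -
    have "out_arcs (with_proj G) x = Pair x ` nb x"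
      by (auto simp: out_arcs_def nb_def)
    then have "out_degree (with_proj G) x = card (nb x)"
      by (simp add: out_degree_def card_image inj_on_def)
    then show ?thesis
      unfolding max_degree_def using that pair_finite_verts by (intro Max_ge) force+
  qed
  have sparse: "4 * card {{x, y} | x y. x \<in> S \<and> y \<in> S \<and> y \<in> nb x} < 5 * card S"
    if "S \<subseteq> pverts G" "S \<noteq> {}" for S
  proof -
    let ?F = "{{x, y} | x y. x \<in> S \<and> y \<in> S \<and> y \<in> nb x}"
    have "?F \<subseteq> F0" by (auto simp: F0_def nb_def)
    moreover have "finite S" using that pair_finite_verts finite_subset by blast
    moreover have "10 \<le> length xs" if "is_cycle ?F xs" for xs
      using that calculation(1) by (intro cyc) (auto simp: is_cycle_def)
    ultimately have "4 * card ?F + 5 \<le> 5 * card S"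
      using that(2) by (intro dr.girth_edge_bound) auto
    then show ?thesis by simp
  qed
  have "\<exists>c. \<forall>x \<in> pverts G. c x < max_degree G + 2 \<and>
    (\<forall>y \<in> pverts G. x \<noteq> y \<longrightarrow> y \<in> nb x \<or> (\<exists>z \<in> pverts G. z \<in> nb x \<and> y \<in> nb z) \<longrightarrow>
      c x \<noteq> (c y :: nat))"
  proof (rule sparse_imp_colourable[OF pair_finite_verts assms(4) _ _ _ _ sparse])
    show "10 \<le> length xs" if "is_cycle {{x, y} | x y. y \<in> nb x} xs" for xs
      using that by (intro cyc) (simp add: F0_def nb_def)
    show "x \<notin> nb x" for x
      using pair_no_loops[of "(x, x)"] by (auto simp: nb_def)
  qed (use arcs_symmetric fin deg in \<open>auto simp: nb_def\<close>)
  then obtain c where c: "\<And>x. x \<in> pverts G \<Longrightarrow> c x < max_degree G + 2"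
    "\<And>x y. \<lbrakk>x \<in> pverts G; y \<in> pverts G; x \<noteq> y;
      y \<in> nb x \<or> (\<exists>z \<in> pverts G. z \<in> nb x \<and> y \<in> nb z)\<rbrakk> \<Longrightarrow> c x \<noteq> (c y :: nat)"
    by blast
  \<comment> \<open>\<open>Suc\<close> shifts the colours from 0, ..., D + 1 to 1, ..., D +
    2.\<close>
  have "two_distance_coloring G (max_degree G + 2) (\<lambda>x. Suc (c x))"
    unfolding two_distance_coloring_def
  proof (intro conjI ballI impI)
    show "(\<lambda>x. Suc (c x)) ` pverts G \<subseteq> {1..max_degree G + 2}"
      using c(1) by (auto simp: Suc_le_eq)
    fix u v assume uv: "u \<in> pverts G" "v \<in> pverts G" "u \<noteq> v \<and> graph_dist G u v \<le> 2"
    then have "(u, v) \<in> parcs G \<or> (\<exists>w. (u, w) \<in> parcs G \<and> (w, v) \<in> parcs G)"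
      using graph_dist_le_2[OF assms(1)] by blast
    then have "v \<in> nb u \<or> (\<exists>z \<in> pverts G. z \<in> nb u \<and> v \<in> nb z)"
      using wellformed' by (auto simp: nb_def)
    then show "Suc (c u) \<noteq> Suc (c v)" using c(2) uv by simp
  qed
  then show ?thesis
    unfolding two_distance_chromatic_number_def by (intro Least_le) blast
qed

end
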